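(* Let $p$ be an odd prime and let $n\in\mathbb{N}$. Set $$\Lambda_{\emptyset}=\{\lambda\vdash n \mid \alpha_{\lambda}^{(p+1)/2}=\emptyset\},$$ where $\alpha_\lambda=(\alpha_\lambda^1,\ldots,\alpha_\lambda^p)$ is the $p$-quotient of $\lambda$. Then $\mathcal{B}_{\emptyset}=\{\chi_{\lambda}\mid \lambda\in\Lambda_{\emptyset}\}$ is a $p$-basic set of the symmetric group $\mathfrak{S}_n$. Furthermore, $\mathcal{B}_{\emptyset}$ satisfies the following properties: (1) If $\chi_{\lambda}\in\mathcal{B}_{\emptyset}$, then $\chi_{\lambda^*}\in\mathcal{B}_{\emptyset}$. (2) If $\lambda=\lambda^*$, then $\chi_{\lambda}\in\mathcal{B}_{\emptyset}$ if and only if the partition $\overline{\lambda}$ is $p$-regular.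
   Context: $p$-basic set: for a finite group $G$ and a complex class function $\varphi$ of $G$, let $\varphi^{p\text{-reg}}$ be the class function equal to $\varphi$ on $p$-regular elements (order prime to $p$) and $0$ elsewhere. A subset $B\subseteq\operatorname{Irr}(G)$ is a $p$-basic set of $G$ if the family $(\chi^{p\text{-reg}})_{\chi\in B}$ is a $\mathbb{Z}$-basis of the $\mathbb{Z}$-module generated by $\{\chi^{p\text{-reg}}\mid\chi\in\operatorname{Irr}(G)\}$. $\chi_\lambda$ denotes the irreducible complex character of $\mathfrak{S}_n$ labelled by $\lambda\vdash n$ in the usual way, and $\lambda^*$ is the conjugate partition (so $\varepsilon\chi_\lambda=\chi_{\lambda^*}$ with $\varepsilon$ the sign character). A partition is called $p$-regular if none of its parts is divisible by $p$. For a self-conjugate partition $\lambda$, $\overline{\lambda}$ is the partition of $n$ whose parts are the lengths of the diagonal hooks of $\lambda$, i.e. the numbers $2\lambda_i-(2i-1)$ for those $i$ with $\lambda_i\ge i$. $p$-quotient: to a partition $\lambda=(\lambda_1\ge\lambda_2\ge\cdots)$ (extended by zeros) associate the set $X_\lambda=\{\lambda_i-i\mid i\ge 1\}\subset\mathbb{Z}$ of bead positions. For $1\le j\le p$, the $j$-th runner of the $p$-abacus consists of the positions $pm+(j-1)$, $m\in\mathbb{Z}$ ($m$ increasing upwards). The $j$-th part $\alpha_\lambda^j=\lambda^{(j)}$ of the $p$-quotient is the partition whose parts are the nonzero numbers among $\#\{m'<m \mid pm'+(j-1)\notin X_\lambda\}$, one for each $m$ with $pm+(j-1)\in X_\lambda$.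 This is the choice of origin for which conjugation acts on runners as the reflection $j\mapsto p+1-j$, i.e. $\alpha_{\lambda^*}=(\lambda^{(p)^*},\ldots,\lambda^{(1)^*})$. *)

theory Defs
  imports
    "HOL-Algebra.Sym_Groups"
    "HOL-Algebra.Multiplicative_Group"
    "HOL-Computational_Algebra.Primes"
    "HOL-Library.Function_Algebras"
    "Jordan_Normal_Form.VS_Connect"
begin

section \<open>Complex characters of a group\<close>

text \<open>Class functions on \<open>G\<close> are functions on the underlying type that vanish outside \<open>carrier G\<close>;
  in particular two characters of \<open>G\<close> are equal iff they agree on \<open>carrier G\<close>.\<close>

definition matrix_rep :: "('g, 'm) monoid_scheme \<Rightarrow> nat \<Rightarrow> ('g \<Rightarrow> complex mat) \<Rightarrow> bool" where
  "matrix_rep G d \<rho> \<longleftrightarrow> \<rho> \<in> hom G (units_of (ring_mat TYPE(complex) d ()))"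

definition irreducible_rep :: "('g, 'm) monoid_scheme \<Rightarrow> nat \<Rightarrow> ('g \<Rightarrow> complex mat) \<Rightarrow> bool" where
  "irreducible_rep G d \<rho> \<longleftrightarrow> matrix_rep G d \<rho> \<and> 0 < d \<and>
     (\<forall>W. VectorSpace.subspace class_ring W (module_vec TYPE(complex) d) \<and>
          (\<forall>g\<in>carrier G. \<forall>w\<in>W. \<rho> g *\<^sub>v w \<in> W)
        \<longrightarrow> W = {0\<^sub>v d} \<or> W = carrier_vec d)"

definition rep_character ::
  "('g, 'm) monoid_scheme \<Rightarrow> nat \<Rightarrow> ('g \<Rightarrow> complex mat) \<Rightarrow> 'g \<Rightarrow> complex" where
  "rep_character G d \<rho> = (\<lambda>g. if g \<in> carrier G then \<Sum>i<d. \<rho> g $$ (i, i) else 0)"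

definition Irr :: "('g, 'm) monoid_scheme \<Rightarrow> ('g \<Rightarrow> complex) set" where
  "Irr G = {rep_character G d \<rho> | d \<rho>. irreducible_rep G d \<rho>}"

definition char_inner ::
  "('g, 'm) monoid_scheme \<Rightarrow> ('g \<Rightarrow> complex) \<Rightarrow> ('g \<Rightarrow> complex) \<Rightarrow> complex" where
  "char_inner G \<phi> \<psi> = (\<Sum>g\<in>carrier G. \<phi> g * cnj (\<psi> g)) / of_nat (card (carrier G))"

definition induced ::
  "('g, 'm) monoid_scheme \<Rightarrow> 'g set \<Rightarrow> ('g \<Rightarrow> complex) \<Rightarrow> 'g \<Rightarrow> complex" where
  "induced G H \<phi> = (\<lambda>g. if g \<in> carrier G then
       (\<Sum>x | x \<in> carrier G \<and> inv\<^bsub>G\<^esub> x \<otimes>\<^bsub>G\<^esub> g \<otimes>\<^bsub>G\<^esub> x \<in> H.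
          \<phi> (inv\<^bsub>G\<^esub> x \<otimes>\<^bsub>G\<^esub> g \<otimes>\<^bsub>G\<^esub> x)) / of_nat (card H)
     else 0)"


section \<open>Basic sets\<close>

definition p_reg_part ::
  "nat \<Rightarrow> ('g, 'm) monoid_scheme \<Rightarrow> ('g \<Rightarrow> complex) \<Rightarrow> 'g \<Rightarrow> complex" where
  "p_reg_part p G \<phi> = (\<lambda>g. if g \<in> carrier G \<and> coprime (group.ord G g) p then \<phi> g else 0)"

definition int_scale :: "int \<Rightarrow> ('g \<Rightarrow> complex) \<Rightarrow> 'g \<Rightarrow> complex" where
  "int_scale k \<phi> = (\<lambda>g. of_int k * \<phi> g)"

interpretation int_fun: Modules.module "int_scale :: int \<Rightarrow> ('g \<Rightarrow> complex) \<Rightarrow> 'g \<Rightarrow> complex"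
  by unfold_locales (auto simp: int_scale_def fun_eq_iff algebra_simps)

text \<open>Independence is a property of the family \<open>(p_reg_part p G \<chi>)\<close> indexed by \<open>B\<close>, hence the
  injectivity requirement next to the independence of its set of values.\<close>

definition p_basic_set ::
  "nat \<Rightarrow> ('g, 'm) monoid_scheme \<Rightarrow> ('g \<Rightarrow> complex) set \<Rightarrow> bool" where
  "p_basic_set p G B \<longleftrightarrow> B \<subseteq> Irr G \<and>
     inj_on (p_reg_part p G) B \<and>
     int_fun.independent (p_reg_part p G ` B) \<and>
     int_fun.span (p_reg_part p G ` B) = int_fun.span (p_reg_part p G ` Irr G)"


section \<open>Partitions\<close>

text \<open>A partition is the weakly decreasing list of its (positive) parts.\<close>

definition partitions :: "nat \<Rightarrow> nat list set" where
  "partitions n = {\<mu>. sorted_wrt (\<ge>) \<mu> \<and> 0 \<notin> set \<mu> \<and> sum_list \<mu> = n}"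

text \<open>\<open>part \<mu> i\<close> is \<open>\<mu>\<^sub>i\<close>, indexed from 1 and extended by zeros.\<close>

definition part :: "nat list \<Rightarrow> nat \<Rightarrow> nat" where
  "part \<mu> i = (if 1 \<le> i \<and> i \<le> length \<mu> then \<mu> ! (i - 1) else 0)"

definition conj_part :: "nat list \<Rightarrow> nat list" where
  "conj_part \<mu> = map (\<lambda>j. length (filter (\<lambda>a. j \<le> a) \<mu>)) [1..<Suc (part \<mu> 1)]"

definition p_regular_partition :: "nat \<Rightarrow> nat list \<Rightarrow> bool" where
  "p_regular_partition p \<mu> \<longleftrightarrow> (\<forall>a\<in>set \<mu>. \<not> p dvd a)"

definition diag_hooks :: "nat list \<Rightarrow> nat list" where
  "diag_hooks \<mu> =
     map (\<lambda>i. 2 * part \<mu> i - (2 * i - 1)) (filter (\<lambda>i. i \<le> part \<mu> i) [1..<Suc (length \<mu>)])"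

definition beads :: "nat list \<Rightarrow> int set" where
  "beads \<mu> = {int (part \<mu> i) - int i | i. 1 \<le> i}"

definition gaps_below :: "nat \<Rightarrow> nat list \<Rightarrow> nat \<Rightarrow> int \<Rightarrow> nat" where
  "gaps_below p \<mu> j m = card {m'. m' < m \<and> int p * m' + (int j - 1) \<notin> beads \<mu>}"

text \<open>\<open>gaps_below p \<mu> j\<close> is weakly increasing, so listing the finitely many relevant beads of the
  \<open>j\<close>-th runner from the top down yields the parts in weakly decreasing order.\<close>

definition p_quotient :: "nat \<Rightarrow> nat list \<Rightarrow> nat \<Rightarrow> nat list" where
  "p_quotient p \<mu> j = map (gaps_below p \<mu> j) (rev (sorted_list_of_set
     {m. int p * m + (int j - 1) \<in> beads \<mu> \<and> gaps_below p \<mu> j m \<noteq> 0}))"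


section \<open>Irreducible characters of symmetric groups\<close>

definition young_block :: "nat list \<Rightarrow> nat \<Rightarrow> nat set" where
  "young_block \<mu> i = {sum_list (take i \<mu>)<..sum_list (take (Suc i) \<mu>)}"

definition young_subgroup :: "nat list \<Rightarrow> (nat \<Rightarrow> nat) set" where
  "young_subgroup \<mu> =
     {g. g permutes {1..sum_list \<mu>} \<and> (\<forall>i<length \<mu>. g ` young_block \<mu> i = young_block \<mu> i)}"

text \<open>The labelling of James and Kerber: \<open>\<chi>\<^sub>\<mu>\<close> is the unique common irreducible constituent of
  the trivial character induced from the Young subgroup of \<open>\<mu>\<close> and the sign character induced from
  the Young subgroup of \<open>\<mu>\<^sup>*\<close>, that is, the character of the Specht module of \<open>\<mu>\<close>.
  Thus \<open>(n)\<close> labels the trivial character and \<open>(1, \<dots>, 1)\<close> the sign character.\<close>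

definition sym_char :: "nat list \<Rightarrow> (nat \<Rightarrow> nat) \<Rightarrow> complex" where
  "sym_char \<mu> = (let G = sym_group (sum_list \<mu>) in
     THE \<chi>. \<chi> \<in> Irr G \<and>
       char_inner G (induced G (young_subgroup \<mu>) (\<lambda>_. 1)) \<chi> \<noteq> 0 \<and>
       char_inner G (induced G (young_subgroup (conj_part \<mu>)) (\<lambda>g. of_int (sign g))) \<chi> \<noteq> 0)"

definition Lambda_empty :: "nat \<Rightarrow> nat \<Rightarrow> nat list set" where
  "Lambda_empty p n = {\<mu> \<in> partitions n. p_quotient p \<mu> ((p + 1) div 2) = []}"

definition B_empty :: "nat \<Rightarrow> nat \<Rightarrow> ((nat \<Rightarrow> nat) \<Rightarrow> complex) set" where
  "B_empty p n = {sym_char \<mu> | \<mu>. \<mu> \<in> Lambda_empty p n}"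

end

theory Submission
  imports Defs "Jordan_Normal_Form.Spectral_Radius" "HOL-Combinatorics.Orbits"
begin

text \<open>
  Throughout, a partition \<open>\<mu>\<close> of \<open>n\<close> is encoded by the strictly decreasing vector \<open>\<mu> + \<delta>\<close> of \<open>N \<ge> n\<close>
  bead positions, where \<open>\<delta> = (N - 1, \<dots>, 1, 0)\<close>.  An alternating function \<open>y\<close> of vectors
  \<open>\<beta> \<in> \<nat>\<^sup>N\<close> is a linear functional \<open>x\<^sup>\<beta> \<mapsto> y \<beta>\<close> on polynomials in \<open>N\<close> variables which changes sign
  under transpositions.  On such functions act the bosonic operators of the Fock space: \<open>U\<^sub>k\<close> (\<open>up\<close>)
  evaluates \<open>y\<close> after multiplication by the power sum \<open>p\<^sub>k\<close>, and \<open>D\<^sub>k\<close> (\<open>down\<close>) is its adjoint.  They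
  satisfy the Heisenberg relation \<open>[U\<^sub>l, D\<^sub>k] = k \<delta>\<^sub>k\<^sub>l\<close> (\<open>up_down_commute\<close>), and \<open>\<Sum>\<^sub>k D\<^sub>k U\<^sub>k\<close> is
  multiplication by the degree (\<open>energy\<close>).

  Characters.  For a permutation \<open>g\<close> let \<open>\<Psi>\<^sub>g \<beta>\<close> (\<open>Psi\<close>) be the coefficient of \<open>x\<^sup>\<beta>\<close> in
  \<open>a\<^sub>\<delta> \<Prod> p\<^sub>l\<close>, with \<open>a\<^sub>\<delta>\<close> the Vandermonde determinant and \<open>l\<close> running through the cycle lengths of \<open>g\<close>.
  Frobenius' formula \<open>\<chi>\<^sub>\<mu> g = \<Psi>\<^sub>g (\<mu> + \<delta>)\<close> is \<open>sym_char_eq\<close>.  Its proof: the functions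
  \<open>g \<mapsto> \<Psi>\<^sub>g (\<mu> + \<delta>)\<close> are orthonormal by Cauchy's identity (\<open>cauchy_matrices\<close>, \<open>sum_Psi_Psi\<close>), where the
  identity itself follows by induction from the energy formula; they are integer combinations of the
  permutation characters on the cosets of Young subgroups, triangular with ones on the diagonal with
  respect to the sum of the squares of the parts (\<open>perm_char_triangular\<close>), hence irreducible; the labels
  agree because a common constituent of the permutation character of \<open>\<nu>\<close> and the signed one of \<open>\<mu>\<^sup>*\<close>
  requires a 0-1 matrix, which forces \<open>\<Sum> \<nu>\<^sub>i\<^sup>2 \<le> \<Sum> \<mu>\<^sub>i\<^sup>2\<close>.

  Spanning.  If \<open>g\<close> is \<open>p\<close>-regular, then \<open>U\<^bsub>pk\<^esub> \<Psi>\<^sub>g = 0\<close> for all \<open>k \<ge> 1\<close>: by the rule of Murnaghan and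
  Nakayama \<open>\<Psi>\<^sub>g\<close> arises from the vacuum by operators \<open>D\<^sub>l\<close> with \<open>p\<close> not dividing \<open>l\<close>, and \<open>U\<^bsub>pk\<^esub>\<close>
  commutes with all of them.  For every \<open>y\<close> annihilated by the \<open>U\<^bsub>pk\<^esub>\<close>, multiplication by \<open>h\<^sub>m(x\<^sup>p)\<close> is
  zero for \<open>m \<ge> 1\<close>, and so is multiplication by \<open>h\<^sub>m(x\<^sup>p)\<close> in all but \<open>r < m\<close> of the variables.  If a
  runner of the abacus carries \<open>r + 1\<close> beads and one of them lies at a level \<open>m > r\<close>, this relation
  expresses \<open>y \<beta>\<close> with integer coefficients through values at vectors where the beads of the runner
  lie lower.  Repeating this leads to vectors whose beads on the runner are pushed down (\<open>flat\<close>), which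
  means that the component of the \<open>p\<close>-quotient at this runner is empty (\<open>flat_combination_eval\<close>).

  Independence.  Let \<open>E = \<Sum>\<^sub>k D\<^sub>k\<^sup>c U\<^bsub>pk\<^esub>\<close>, where \<open>D\<^sub>k\<^sup>c\<close> lowers only beads on the runner \<open>c\<close>, and only by
  \<open>pk\<close>.  The Heisenberg relation gives \<open>U\<^bsub>pl\<^esub> E = (E + l) U\<^bsub>pl\<^esub>\<close>, so on functions of degree \<open>m\<close> the
  product of the \<open>E - e\<close> for \<open>0 \<le> e \<le> m\<close> vanishes.  Therefore \<open>\<Prod>\<^bsub>1 \<le> e \<le> n\<^esub> (E - e)\<close> maps every alternating
  function to one annihilated by all \<open>U\<^bsub>pl\<^esub>\<close>, while on flat vectors \<open>E\<close> is zero and the product is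
  just the scalar \<open>(-1)\<^sup>n n!\<close>.  This yields, for each flat \<open>\<gamma>\<close>, a function dual to \<open>\<gamma>\<close> and
  annihilated by the \<open>U\<^bsub>pl\<^esub>\<close> (\<open>ex_killed_dual\<close>).  The class function attached to it vanishes outside the
  \<open>p\<close>-regular elements, so its inner product with a relation between the restricted characters
  isolates the coefficient at \<open>\<gamma>\<close> (\<open>flat_chars_independent\<close>).  Both arguments work for every runner; the
  middle one has the following symmetry.

  Conjugation.  The beads of \<open>\<mu>\<^sup>*\<close> are the reflections \<open>-1 - x\<close> of the gaps of \<open>\<mu>\<close>, and the middle runner
  is mapped to itself.  So emptiness of the middle component is invariant under conjugation; and if
  \<open>\<mu> = \<mu>\<^sup>*\<close>, it means that the middle runner has no bead \<open>x \<ge> 0\<close>.  The diagonal hook lengths are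
  \<open>2x + 1\<close> for the beads \<open>x \<ge> 0\<close>, and \<open>p\<close> divides \<open>2x + 1\<close> exactly for \<open>x\<close> on the middle runner.
\<close>

section \<open>Matrix representations\<close>

definition mtrace :: "complex mat \<Rightarrow> complex" where
  "mtrace A = (\<Sum>i<dim_row A. A $$ (i, i))"

lemma mult_entry:
  assumes "A \<in> carrier_mat a b" "B \<in> carrier_mat b c" "i < a" "j < c"
  shows "(A * B) $$ (i, j) = (\<Sum>k<b. A $$ (i, k) * B $$ (k, j))"
  using assms by (auto simp: scalar_prod_def atLeast0LessThan intro!: sum.cong)

lemma mult_unit_vec_entry:
  assumes "A \<in> carrier_mat a b" "i < a" "j < b"
  shows "(A *\<^sub>v unit_vec b j) $ i = (A $$ (i, j) :: complex)"
  using assms by (simp add: scalar_prod_right_unit)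

lemma mtrace_comm:
  assumes "A \<in> carrier_mat a b" "B \<in> carrier_mat b a"
  shows "mtrace (A * B) = mtrace (B * A)"
proof -
  have "mtrace (A * B) = (\<Sum>i<a. \<Sum>k<b. A $$ (i, k) * B $$ (k, i))"
    using assms by (simp add: mtrace_def mult_entry[OF assms] del: index_mult_mat(1))
  also have "\<dots> = (\<Sum>k<b. \<Sum>i<a. A $$ (i, k) * B $$ (k, i))" by (rule sum.swap)
  also have "\<dots> = mtrace (B * A)"
    using assms by (simp add: mtrace_def mult_entry[OF assms(2,1)] mult.commute del: index_mult_mat(1))
  finally show ?thesis .
qed

lemma subspace_iff:
  "VectorSpace.subspace class_ring W (module_vec TYPE(complex) d) \<longleftrightarrow>
   W \<subseteq> carrier_vec d \<and> 0\<^sub>v d \<in> W \<and> (\<forall>v\<in>W. \<forall>w\<in>W. v + w \<in> W) \<and> (\<forall>c. \<forall>v\<in>W. c \<cdot>\<^sub>v v \<in> W)"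
  using vec_vs[where 'a = complex, of d] vec_module[where 'a = complex, of d]
  by (auto simp: VectorSpace.subspace_def submodule_def module_vec_simps class_ring_simps)

lemma matrix_repI:
  fixes G (structure)
  assumes "group G" and car: "\<And>g. g \<in> carrier G \<Longrightarrow> \<rho> g \<in> carrier_mat d d"
    and mult: "\<And>g h. g \<in> carrier G \<Longrightarrow> h \<in> carrier G \<Longrightarrow> \<rho> (g \<otimes>\<^bsub>G\<^esub> h) = \<rho> g * \<rho> h"
    and one: "\<rho> \<one>\<^bsub>G\<^esub> = 1\<^sub>m d"
  shows "matrix_rep G d \<rho>"
proof -
  interpret group G by fact
  have "\<rho> g \<in> Units (ring_mat TYPE(complex) d ())" if g: "g \<in> carrier G" for g
  proof -
    have "\<rho> (inv g) * \<rho> g = 1\<^sub>m d" "\<rho> g * \<rho> (inv g) = 1\<^sub>m d"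
      using g one by (simp_all flip: mult)
    then show ?thesis using car[OF g] car[of "inv g"] g by (auto simp: Units_def ring_mat_simps)
  qed
  then show ?thesis unfolding matrix_rep_def hom_def
    by (auto simp: units_of_def ring_mat_simps mult)
qed

locale mat_rep = group G for G (structure) +
  fixes d \<rho>
  assumes rep: "matrix_rep G d \<rho>"
begin

lemma rep_carrier: "g \<in> carrier G \<Longrightarrow> \<rho> g \<in> carrier_mat d d"
  using rep by (auto simp: matrix_rep_def hom_def units_of_def Units_def ring_mat_simps Pi_iff)

lemma rep_mult: "g \<in> carrier G \<Longrightarrow> h \<in> carrier G \<Longrightarrow> \<rho> (g \<otimes> h) = \<rho> g * \<rho> h"
  using rep by (auto simp: matrix_rep_def hom_def units_of_def ring_mat_simps)

lemma rep_one: "\<rho> \<one> = 1\<^sub>m d"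
proof -
  interpret R: ring "ring_mat TYPE(complex) d ()" by (rule ring_mat)
  have "\<rho> \<one> = \<one>\<^bsub>units_of (ring_mat TYPE(complex) d ())\<^esub>"
    using rep unfolding matrix_rep_def by (rule hom_one) (rule group_axioms R.units_group)+
  then show ?thesis by (simp add: units_of_def ring_mat_simps)
qed

lemma rep_inv: "g \<in> carrier G \<Longrightarrow> \<rho> (inv g) * \<rho> g = 1\<^sub>m d"
  by (simp add: rep_one flip: rep_mult)

lemma character_eq: "g \<in> carrier G \<Longrightarrow> rep_character G d \<rho> g = mtrace (\<rho> g)"
  using rep_carrier[of g] by (auto simp: rep_character_def mtrace_def)

end

text \<open>The dimensions \<open>a\<close> and \<open>b\<close> may differ: Schur's lemma compares representations whose degrees are
  only found to be equal afterwards.\<close>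

lemma two_sided_inverse:
  fixes T :: "complex mat"
  assumes T: "T \<in> carrier_mat a b"
    and inj: "\<And>v. v \<in> carrier_vec b \<Longrightarrow> T *\<^sub>v v = 0\<^sub>v a \<Longrightarrow> v = 0\<^sub>v b"
    and surj: "\<And>u. u \<in> carrier_vec a \<Longrightarrow> \<exists>v\<in>carrier_vec b. T *\<^sub>v v = u"
  obtains S where "S \<in> carrier_mat b a" "T * S = 1\<^sub>m a" "S * T = 1\<^sub>m b"
proof -
  have "\<forall>j\<in>{..<a}. \<exists>v. v \<in> carrier_vec b \<and> T *\<^sub>v v = unit_vec a j"
    using surj[OF unit_vec_carrier] by blast
  from bchoice[OF this] obtain v where v: "\<And>j. j < a \<Longrightarrow> v j \<in> carrier_vec b" "\<And>j. j < a \<Longrightarrow> T *\<^sub>v v j = unit_vec a j"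
    by auto
  define S where "S = mat b a (\<lambda>(i, j). v j $ i)"
  have S: "S \<in> carrier_mat b a" by (simp add: S_def)
  have colS: "col S j = v j" if "j < a" for j
    using v(1)[OF that] that by (auto simp: S_def intro!: eq_vecI)
  have TS: "T * S = 1\<^sub>m a"
  proof (rule eq_matI)
    fix i j assume "i < dim_row (1\<^sub>m a)" "j < dim_col (1\<^sub>m a)"
    then have ij: "i < a" "j < a" by auto
    have "(T * S) $$ (i, j) = (T *\<^sub>v v j) $ i"
      using ij T S by (simp add: colS)
    also have "\<dots> = 1\<^sub>m a $$ (i, j)"
      using ij by (auto simp: v(2))
    finally show "(T * S) $$ (i, j) = 1\<^sub>m a $$ (i, j)" .
  qed (use T S in auto)
  have "S * T = 1\<^sub>m b"
  proof (rule eq_matI)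
    fix i j assume "i < dim_row (1\<^sub>m b)" "j < dim_col (1\<^sub>m b)"
    then have ij: "i < b" "j < b" by auto
    let ?u = "unit_vec b j :: complex vec"
    have u: "?u \<in> carrier_vec b" by simp
    let ?w = "S *\<^sub>v (T *\<^sub>v ?u)"
    have w: "?w \<in> carrier_vec b" using S T u by auto
    have "T *\<^sub>v ?w = (T * S) *\<^sub>v (T *\<^sub>v ?u)"
      using S T u by (metis assoc_mult_mat_vec mult_mat_vec_carrier)
    also have "\<dots> = T *\<^sub>v ?u" using TS T u by simp
    finally have "T *\<^sub>v (?w - ?u) = 0\<^sub>v a"
      using T w u by (subst mult_minus_distrib_mat_vec) auto
    moreover have "?w - ?u \<in> carrier_vec b" using w by simp
    ultimately have "?w - ?u = 0\<^sub>v b" by (intro inj)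
    then have "(?w - ?u) $ i = 0" using ij by simp
    then have "?w $ i = ?u $ i" using w u ij by simp
    moreover have "?w = (S * T) *\<^sub>v ?u" by (rule assoc_mult_mat_vec[OF S T u, symmetric])
    ultimately have "(S * T) $$ (i, j) = ?u $ i"
      by (simp only: mult_unit_vec_entry[OF mult_carrier_mat[OF S T] ij])
    then show "(S * T) $$ (i, j) = 1\<^sub>m b $$ (i, j)" using ij by simp
  qed (use T S in auto)
  with S TS show thesis by (rule that)
qed

text \<open>Schur's lemma: the kernel and the image of an intertwiner are invariant subspaces.\<close>

lemma schur_alternative:
  assumes r1: "irreducible_rep G d1 \<rho>1" and r2: "irreducible_rep G d2 \<rho>2" and G: "group G"
    and T: "T \<in> carrier_mat d2 d1" and comm: "\<And>g. g \<in> carrier G \<Longrightarrow> T * \<rho>1 g = \<rho>2 g * T"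
  shows "T = 0\<^sub>m d2 d1 \<or> (\<exists>S\<in>carrier_mat d1 d2. T * S = 1\<^sub>m d2 \<and> S * T = 1\<^sub>m d1)"
proof -
  interpret m1: mat_rep G d1 \<rho>1 using r1 G by (simp add: irreducible_rep_def mat_rep_def mat_rep_axioms_def)
  interpret m2: mat_rep G d2 \<rho>2 using r2 G by (simp add: irreducible_rep_def mat_rep_def mat_rep_axioms_def)
  have app: "T *\<^sub>v (\<rho>1 g *\<^sub>v v) = \<rho>2 g *\<^sub>v (T *\<^sub>v v)" if "g \<in> carrier G" "v \<in> carrier_vec d1" for g v
    unfolding assoc_mult_mat_vec[OF T m1.rep_carrier[OF that(1)] that(2), symmetric]
      assoc_mult_mat_vec[OF m2.rep_carrier[OF that(1)] T that(2), symmetric] comm[OF that(1)] ..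
  define K where "K = {v \<in> carrier_vec d1. T *\<^sub>v v = 0\<^sub>v d2}"
  define I where "I = (\<lambda>v. T *\<^sub>v v) ` carrier_vec d1"
  have "VectorSpace.subspace class_ring K (module_vec TYPE(complex) d1)"
    unfolding subspace_iff K_def using T by (auto simp: mult_add_distrib_mat_vec mult_mat_vec)
  moreover have "\<forall>g\<in>carrier G. \<forall>w\<in>K. \<rho>1 g *\<^sub>v w \<in> K"
    unfolding K_def using app m1.rep_carrier m2.rep_carrier by (fastforce intro: mult_mat_vec_carrier)
  ultimately have K: "K = {0\<^sub>v d1} \<or> K = carrier_vec d1" using r1 by (auto simp: irreducible_rep_def)
  have "VectorSpace.subspace class_ring I (module_vec TYPE(complex) d2)"
    unfolding subspace_iff
  proof (intro conjI ballI allI)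
    show "I \<subseteq> carrier_vec d2" using T by (auto simp: I_def)
    show "0\<^sub>v d2 \<in> I" unfolding I_def using T by (intro image_eqI[of _ _ "0\<^sub>v d1"]) auto
    fix v w assume "v \<in> I" "w \<in> I"
    then show "v + w \<in> I" unfolding I_def using T
      by (auto simp flip: mult_add_distrib_mat_vec)
  next
    fix c v assume "v \<in> I"
    then show "c \<cdot>\<^sub>v v \<in> I" unfolding I_def using T by (auto simp flip: mult_mat_vec)
  qed
  moreover have "\<forall>g\<in>carrier G. \<forall>w\<in>I. \<rho>2 g *\<^sub>v w \<in> I"
  proof (intro ballI)
    fix g w assume g: "g \<in> carrier G" and "w \<in> I"
    then obtain v where v: "v \<in> carrier_vec d1" "w = T *\<^sub>v v" by (auto simp: I_def)
    then have "\<rho>2 g *\<^sub>v w = T *\<^sub>v (\<rho>1 g *\<^sub>v v)" using app g by simp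
    then show "\<rho>2 g *\<^sub>v w \<in> I"
      unfolding I_def using mult_mat_vec_carrier[OF m1.rep_carrier[OF g] v(1)] by (rule image_eqI)
  qed
  ultimately have I: "I = {0\<^sub>v d2} \<or> I = carrier_vec d2" using r2 by (auto simp: irreducible_rep_def)
  show ?thesis
  proof (cases "T = 0\<^sub>m d2 d1")
    case False
    have nz: "\<exists>v\<in>carrier_vec d1. T *\<^sub>v v \<noteq> 0\<^sub>v d2"
    proof (rule ccontr)
      assume "\<not> ?thesis"
      then have z: "T *\<^sub>v unit_vec d1 j = 0\<^sub>v d2" for j by simp
      have "T = 0\<^sub>m d2 d1"
      proof (rule eq_matI)
        fix i j assume ij: "i < dim_row (0\<^sub>m d2 d1 :: complex mat)" "j < dim_col (0\<^sub>m d2 d1 :: complex mat)"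
        then have "T $$ (i, j) = (T *\<^sub>v unit_vec d1 j) $ i"
          using mult_unit_vec_entry[OF T, of i j] by simp
        then show "T $$ (i, j) = 0\<^sub>m d2 d1 $$ (i, j)" using ij z[of j] by simp
      qed (use T in auto)
      then show False using False by simp
    qed
    then have "K \<noteq> carrier_vec d1" "I \<noteq> {0\<^sub>v d2}" by (auto simp: K_def I_def)
    then have "K = {0\<^sub>v d1}" "I = carrier_vec d2" using K I by auto
    then have inj: "\<And>v. v \<in> carrier_vec d1 \<Longrightarrow> T *\<^sub>v v = 0\<^sub>v d2 \<Longrightarrow> v = 0\<^sub>v d1"
      unfolding K_def by blast
    have surj: "\<exists>v\<in>carrier_vec d1. T *\<^sub>v v = u" if "u \<in> carrier_vec d2" for u
    proof -
      have "u \<in> I" using that \<open>I = carrier_vec d2\<close> by simp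
      then show ?thesis by (auto simp: I_def)
    qed
    from two_sided_inverse[OF T inj surj] show ?thesis by blast
  qed simp
qed

text \<open>The bilinear form with \<open>g\<^sup>-\<^sup>1\<close> in place of complex conjugation: Schur's relations for it hold for
  arbitrary matrix representations, unitary or not.\<close>

definition bilin :: "('g, 'm) monoid_scheme \<Rightarrow> ('g \<Rightarrow> complex) \<Rightarrow> ('g \<Rightarrow> complex) \<Rightarrow> complex" where
  "bilin G \<phi> \<psi> = (\<Sum>g\<in>carrier G. \<phi> g * \<psi> (inv\<^bsub>G\<^esub> g)) / of_nat (card (carrier G))"

text \<open>The sum of \<open>\<rho>2 g X \<rho>1 g\<^sup>-\<^sup>1\<close> over the group, for the elementary matrix \<open>X\<close> with its entry at
  \<open>(k, l)\<close>.\<close>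

definition averaged ::
  "('g, 'm) monoid_scheme \<Rightarrow> nat \<Rightarrow> ('g \<Rightarrow> complex mat) \<Rightarrow> nat \<Rightarrow> ('g \<Rightarrow> complex mat) \<Rightarrow> nat \<Rightarrow> nat \<Rightarrow> complex mat" where
  "averaged G d1 \<rho>1 d2 \<rho>2 k l =
     mat d2 d1 (\<lambda>(i, j). \<Sum>g\<in>carrier G. \<rho>2 g $$ (i, k) * \<rho>1 (inv\<^bsub>G\<^esub> g) $$ (l, j))"

lemma averaged_intertwines:
  fixes G (structure)
  assumes m1: "mat_rep G d1 \<rho>1" and m2: "mat_rep G d2 \<rho>2" and fin: "finite (carrier G)"
    and h: "h \<in> carrier G" and kl: "k < d2" "l < d1"
  shows "averaged G d1 \<rho>1 d2 \<rho>2 k l * \<rho>1 h = \<rho>2 h * averaged G d1 \<rho>1 d2 \<rho>2 k l"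
proof (rule eq_matI)
  interpret m1: mat_rep G d1 \<rho>1 by fact
  interpret m2: mat_rep G d2 \<rho>2 by fact
  let ?T = "averaged G d1 \<rho>1 d2 \<rho>2 k l"
  have T: "?T \<in> carrier_mat d2 d1" by (simp add: averaged_def)
  show "dim_row (?T * \<rho>1 h) = dim_row (\<rho>2 h * ?T)" "dim_col (?T * \<rho>1 h) = dim_col (\<rho>2 h * ?T)"
    using T m1.rep_carrier[OF h] m2.rep_carrier[OF h] by auto
  fix i j assume "i < dim_row (\<rho>2 h * ?T)" "j < dim_col (\<rho>2 h * ?T)"
  then have ij: "i < d2" "j < d1" using T m2.rep_carrier[OF h] by auto
  have "(?T * \<rho>1 h) $$ (i, j) = (\<Sum>q<d1. (\<Sum>g\<in>carrier G. \<rho>2 g $$ (i, k) * \<rho>1 (inv g) $$ (l, q)) * \<rho>1 h $$ (q, j))"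
    unfolding mult_entry[OF T m1.rep_carrier[OF h] ij] using ij by (intro sum.cong) (auto simp: averaged_def)
  also have "\<dots> = (\<Sum>g\<in>carrier G. \<Sum>q<d1. \<rho>2 g $$ (i, k) * \<rho>1 (inv g) $$ (l, q) * \<rho>1 h $$ (q, j))"
    unfolding sum_distrib_right by (rule sum.swap)
  also have "\<dots> = (\<Sum>g\<in>carrier G. \<rho>2 g $$ (i, k) * \<rho>1 (inv g \<otimes> h) $$ (l, j))"
  proof (intro sum.cong refl)
    fix g assume g: "g \<in> carrier G"
    have gi: "inv g \<in> carrier G" using g by simp
    show "(\<Sum>q<d1. \<rho>2 g $$ (i, k) * \<rho>1 (inv g) $$ (l, q) * \<rho>1 h $$ (q, j)) = \<rho>2 g $$ (i, k) * \<rho>1 (inv g \<otimes> h) $$ (l, j)"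
      unfolding m1.rep_mult[OF gi h] mult_entry[OF m1.rep_carrier[OF gi] m1.rep_carrier[OF h] kl(2) ij(2)]
      by (simp only: sum_distrib_left mult.assoc)
  qed
  also have "\<dots> = (\<Sum>g\<in>carrier G. \<rho>2 (h \<otimes> g) $$ (i, k) * \<rho>1 (inv g) $$ (l, j))"
    by (rule sum.reindex_bij_witness[where i = "\<lambda>g. h \<otimes> g" and j = "\<lambda>g. inv h \<otimes> g"])
      (use h in \<open>auto simp: m1.inv_mult_group m1.m_assoc[symmetric]\<close>)
  also have "\<dots> = (\<Sum>g\<in>carrier G. \<Sum>q<d2. \<rho>2 h $$ (i, q) * (\<rho>2 g $$ (q, k) * \<rho>1 (inv g) $$ (l, j)))"
  proof (intro sum.cong refl)
    fix g assume g: "g \<in> carrier G"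
    show "\<rho>2 (h \<otimes> g) $$ (i, k) * \<rho>1 (inv g) $$ (l, j) = (\<Sum>q<d2. \<rho>2 h $$ (i, q) * (\<rho>2 g $$ (q, k) * \<rho>1 (inv g) $$ (l, j)))"
      unfolding m2.rep_mult[OF h g] mult_entry[OF m2.rep_carrier[OF h] m2.rep_carrier[OF g] ij(1) kl(1)]
      by (simp only: sum_distrib_right mult.assoc)
  qed
  also have "\<dots> = (\<Sum>q<d2. \<Sum>g\<in>carrier G. \<rho>2 h $$ (i, q) * (\<rho>2 g $$ (q, k) * \<rho>1 (inv g) $$ (l, j)))"
    by (rule sum.swap)
  also have "\<dots> = (\<Sum>q<d2. \<rho>2 h $$ (i, q) * ?T $$ (q, j))"
    using ij by (intro sum.cong) (auto simp: averaged_def sum_distrib_left)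
  also have "\<dots> = (\<rho>2 h * ?T) $$ (i, j)"
    by (rule mult_entry[OF m2.rep_carrier[OF h] T ij, symmetric])
  finally show "(?T * \<rho>1 h) $$ (i, j) = (\<rho>2 h * ?T) $$ (i, j)" .
qed

lemma sum_characters_averaged:
  assumes "group G"
  shows "(\<Sum>g\<in>carrier G. rep_character G d2 \<rho>2 g * rep_character G d1 \<rho>1 (inv\<^bsub>G\<^esub> g))
       = (\<Sum>i<d2. \<Sum>j<d1. averaged G d1 \<rho>1 d2 \<rho>2 i j $$ (i, j))"
proof -
  have "(\<Sum>g\<in>carrier G. rep_character G d2 \<rho>2 g * rep_character G d1 \<rho>1 (inv\<^bsub>G\<^esub> g))
      = (\<Sum>g\<in>carrier G. \<Sum>i<d2. \<Sum>j<d1. \<rho>2 g $$ (i, i) * \<rho>1 (inv\<^bsub>G\<^esub> g) $$ (j, j))"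
    using group.inv_closed[OF assms] by (intro sum.cong refl) (simp add: rep_character_def sum_product)
  also have "\<dots> = (\<Sum>i<d2. \<Sum>j<d1. \<Sum>g\<in>carrier G. \<rho>2 g $$ (i, i) * \<rho>1 (inv\<^bsub>G\<^esub> g) $$ (j, j))"
    by (subst sum.swap, rule sum.cong[OF refl], rule sum.swap)
  also have "\<dots> = (\<Sum>i<d2. \<Sum>j<d1. averaged G d1 \<rho>1 d2 \<rho>2 i j $$ (i, j))"
    by (intro sum.cong refl) (simp add: averaged_def)
  finally show ?thesis .
qed

text \<open>All averaged matrices vanish, because an invertible intertwiner would make the two characters equal.\<close>

lemma schur_orthogonal:
  assumes G: "group G" and fin: "finite (carrier G)"
    and r1: "irreducible_rep G d1 \<rho>1" and r2: "irreducible_rep G d2 \<rho>2"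
    and ne: "rep_character G d1 \<rho>1 \<noteq> rep_character G d2 \<rho>2"
  shows "bilin G (rep_character G d2 \<rho>2) (rep_character G d1 \<rho>1) = 0"
proof -
  have m1: "mat_rep G d1 \<rho>1" and m2: "mat_rep G d2 \<rho>2"
    using r1 r2 G by (simp_all add: irreducible_rep_def mat_rep_def mat_rep_axioms_def)
  interpret m1: mat_rep G d1 \<rho>1 by fact
  interpret m2: mat_rep G d2 \<rho>2 by fact
  have "averaged G d1 \<rho>1 d2 \<rho>2 k l = 0\<^sub>m d2 d1" if kl: "k < d2" "l < d1" for k l
  proof (rule ccontr)
    let ?T = "averaged G d1 \<rho>1 d2 \<rho>2 k l"
    assume "?T \<noteq> 0\<^sub>m d2 d1"
    moreover have T: "?T \<in> carrier_mat d2 d1" by (simp add: averaged_def)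
    ultimately obtain S where S: "S \<in> carrier_mat d1 d2" "?T * S = 1\<^sub>m d2" "S * ?T = 1\<^sub>m d1"
      using schur_alternative[OF r1 r2 G T averaged_intertwines[OF m1 m2 fin _ kl]] by auto
    have "rep_character G d1 \<rho>1 g = rep_character G d2 \<rho>2 g" for g
    proof (cases "g \<in> carrier G")
      case g: True
      note c1 = m1.rep_carrier[OF g] and c2 = m2.rep_carrier[OF g]
      have "mtrace (\<rho>2 g) = mtrace (\<rho>2 g * (?T * S))" using S(2) c2 by simp
      also have "\<rho>2 g * (?T * S) = (\<rho>2 g * ?T) * S" by (rule assoc_mult_mat[OF c2 T S(1), symmetric])
      also have "\<dots> = ?T * (\<rho>1 g * S)"
        using averaged_intertwines[OF m1 m2 fin g kl] assoc_mult_mat[OF T c1 S(1)] by simp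
      also have "mtrace \<dots> = mtrace ((\<rho>1 g * S) * ?T)"
        by (rule mtrace_comm[OF T]) (use c1 S in auto)
      also have "(\<rho>1 g * S) * ?T = \<rho>1 g" using assoc_mult_mat[OF c1 S(1) T] S(3) c1 by simp
      finally show ?thesis by (simp add: m1.character_eq m2.character_eq g)
    qed (simp add: rep_character_def)
    then show False using ne by blast
  qed
  then show ?thesis
    unfolding bilin_def sum_characters_averaged[OF G] by simp
qed

text \<open>Each averaged matrix is a scalar by Schur's lemma, and its trace determines the scalar.\<close>

lemma schur_normed:
  assumes G: "group G" and fin: "finite (carrier G)" and r: "irreducible_rep G d \<rho>"
  shows "bilin G (rep_character G d \<rho>) (rep_character G d \<rho>) = 1"
proof -
  have m: "mat_rep G d \<rho>" and d: "0 < d"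
    using r G by (simp_all add: irreducible_rep_def mat_rep_def mat_rep_axioms_def)
  interpret m: mat_rep G d \<rho> by fact
  let ?n = "of_nat (card (carrier G)) :: complex"
  have n: "?n \<noteq> 0" using fin m.one_closed by auto
  have "averaged G d \<rho> d \<rho> k l $$ (i, j) = (if i = j \<and> k = l then ?n / of_nat d else 0)"
    if kl: "k < d" "l < d" and ij: "i < d" "j < d" for k l i j
  proof -
    let ?T = "averaged G d \<rho> d \<rho> k l"
    have T: "?T \<in> carrier_mat d d" by (simp add: averaged_def)
    \<comment> \<open>minus an eigenvalue, the intertwiner is singular and hence zero\<close>
    obtain c where "eigenvalue ?T c"
      using spectrum_non_empty[OF T d] by (auto simp: spectrum_def)
    then obtain v where v: "v \<in> carrier_vec d" "v \<noteq> 0\<^sub>v d" "?T *\<^sub>v v = c \<cdot>\<^sub>v v"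
      using T by (auto simp: eigenvalue_def eigenvector_def)
    let ?C = "c \<cdot>\<^sub>m 1\<^sub>m d"
    let ?U = "?T - ?C"
    have C: "?C \<in> carrier_mat d d" by simp
    have U: "?U \<in> carrier_mat d d" using T by auto
    have "?U * \<rho> g = \<rho> g * ?U" if g: "g \<in> carrier G" for g
    proof -
      note cg = m.rep_carrier[OF g]
      have "?U * \<rho> g = ?T * \<rho> g - ?C * \<rho> g" by (rule minus_mult_distrib_mat[OF T C cg])
      also have "?C * \<rho> g = c \<cdot>\<^sub>m \<rho> g" using mult_smult_assoc_mat[OF one_carrier_mat cg] cg by simp
      also have "\<dots> = \<rho> g * ?C" using mult_smult_distrib[OF cg one_carrier_mat] cg by simp
      also have "?T * \<rho> g = \<rho> g * ?T" by (rule averaged_intertwines[OF m m fin g kl])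
      also have "\<rho> g * ?T - \<rho> g * ?C = \<rho> g * ?U" by (rule mult_minus_distrib_mat[OF cg T C, symmetric])
      finally show ?thesis .
    qed
    note alt = schur_alternative[OF r r G U this]
    have Uv: "?U *\<^sub>v v = 0\<^sub>v d"
    proof -
      have "?U *\<^sub>v v = ?T *\<^sub>v v - ?C *\<^sub>v v" by (rule minus_mult_distrib_mat_vec[OF T C v(1)])
      also have "?C *\<^sub>v v = c \<cdot>\<^sub>v v" using v(1) by auto
      finally show ?thesis using v by simp
    qed
    have U0: "?U = 0\<^sub>m d d"
    proof (rule ccontr)
      assume "?U \<noteq> 0\<^sub>m d d"
      then obtain S where S: "S \<in> carrier_mat d d" "S * ?U = 1\<^sub>m d" using alt by blast
      have "v = (S * ?U) *\<^sub>v v" using S v(1) by simp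
      also have "\<dots> = S *\<^sub>v (?U *\<^sub>v v)" by (rule assoc_mult_mat_vec[OF S(1) U v(1)])
      also have "\<dots> = 0\<^sub>v d" using S(1) by (simp only: Uv) auto
      finally show False using v(2) by simp
    qed
    have Tij: "?T $$ (i, j) = (if i = j then c else 0)" if "i < d" "j < d" for i j
    proof -
      have "?U $$ (i, j) = ?T $$ (i, j) - ?C $$ (i, j)" using T that by simp
      moreover have "?U $$ (i, j) = 0" unfolding U0 using that by simp
      ultimately show ?thesis using that by (auto split: if_splits)
    qed
    \<comment> \<open>the trace of the sum of \<open>\<rho> g X \<rho> g\<^sup>-\<^sup>1\<close> is \<open>card G\<close> times the trace of \<open>X\<close>\<close>
    have "of_nat d * c = (\<Sum>i<d. ?T $$ (i, i))" by (simp add: Tij)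
    also have "\<dots> = (\<Sum>i<d. \<Sum>g\<in>carrier G. \<rho> (inv\<^bsub>G\<^esub> g) $$ (l, i) * \<rho> g $$ (i, k))"
      by (intro sum.cong refl) (simp add: averaged_def mult.commute)
    also have "\<dots> = (\<Sum>g\<in>carrier G. \<Sum>i<d. \<rho> (inv\<^bsub>G\<^esub> g) $$ (l, i) * \<rho> g $$ (i, k))"
      by (rule sum.swap)
    also have "\<dots> = (\<Sum>g\<in>carrier G. 1\<^sub>m d $$ (l, k))"
    proof (intro sum.cong[OF refl])
      fix g assume g: "g \<in> carrier G"
      show "(\<Sum>i<d. \<rho> (inv\<^bsub>G\<^esub> g) $$ (l, i) * \<rho> g $$ (i, k)) = 1\<^sub>m d $$ (l, k)"
        unfolding m.rep_inv[OF g, symmetric]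
        by (rule mult_entry[symmetric]) (use g kl m.rep_carrier in auto)
    qed
    also have "\<dots> = (if k = l then ?n else 0)" using kl by auto
    finally have "c = (if k = l then ?n / of_nat d else 0)" using d by (auto simp: field_simps split: if_splits)
    then show ?thesis using Tij[OF ij] by auto
  qed
  then have "(\<Sum>i<d. \<Sum>j<d. averaged G d \<rho> d \<rho> i j $$ (i, j)) = (\<Sum>i<d. \<Sum>j<d. if i = j then ?n / of_nat d else 0)"
    by (intro sum.cong) auto
  also have "\<dots> = ?n" using d by simp
  finally show ?thesis unfolding bilin_def sum_characters_averaged[OF G] using n by simp
qed

lemma bilin_Irr:
  assumes "group G" "finite (carrier G)" "\<chi> \<in> Irr G" "\<psi> \<in> Irr G"
  shows "bilin G \<chi> \<psi> = (if \<chi> = \<psi> then 1 else 0)"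
proof -
  obtain d \<rho> d' \<rho>' where *: "\<chi> = rep_character G d \<rho>" "irreducible_rep G d \<rho>"
    "\<psi> = rep_character G d' \<rho>'" "irreducible_rep G d' \<rho>'"
    using assms(3,4) by (auto simp: Irr_def)
  show ?thesis
  proof (cases "\<chi> = \<psi>")
    case True
    then show ?thesis using schur_normed[OF assms(1,2) *(2)] *(1) by simp
  next
    case False
    then show ?thesis using schur_orthogonal[OF assms(1,2) *(4,2)] *(1,3) by simp
  qed
qed

lemma sum_lessThan_add:
  fixes f :: "nat \<Rightarrow> 'a::comm_monoid_add"
  shows "(\<Sum>l<k + m. f l) = (\<Sum>l<k. f l) + (\<Sum>l<m. f (l + k))"
  by (induction m) (simp_all add: ac_simps)

text \<open>The columns of \<open>P\<close> are a basis of \<open>W\<close> followed by a completion to a basis of the whole space; \<open>Q\<close>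
  computes coordinates with respect to it.\<close>

lemma adapted_basis:
  assumes W: "VectorSpace.subspace class_ring W (module_vec TYPE(complex) d)"
    and W0: "W \<noteq> {0\<^sub>v d}" and W1: "W \<noteq> carrier_vec d"
  obtains k P Q where "0 < k" "k < d" "P \<in> carrier_mat d d" "Q \<in> carrier_mat d d"
    "P * Q = 1\<^sub>m d" "Q * P = 1\<^sub>m d" "\<And>j. j < k \<Longrightarrow> col P j \<in> W"
    "\<And>w i. w \<in> W \<Longrightarrow> k \<le> i \<Longrightarrow> i < d \<Longrightarrow> (Q *\<^sub>v w) $ i = 0"
proof -
  interpret vec_space "TYPE(complex)" d .
  have WC: "W \<subseteq> carrier_vec d" using W by (simp add: subspace_iff)
  have empty: "lin_indpt {}" by (simp add: lin_dep_def)
  have bound: "finite S \<and> card S \<le> d" if "S \<subseteq> carrier_vec d" "lin_indpt S" for S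
    using li_le_dim[OF fin_dim, of S] that by (simp add: dim_is_n)
  obtain A where A: "maximal A (\<lambda>S. S \<subseteq> W \<and> lin_indpt S)"
    using maximal_exists[of "\<lambda>S. S \<subseteq> W \<and> lin_indpt S" d "{}"] bound WC empty by blast
  then have AW: "A \<subseteq> W" and Ali: "lin_indpt A" and Amax: "\<And>B. B \<supseteq> A \<Longrightarrow> B \<subseteq> W \<Longrightarrow> lin_indpt B \<Longrightarrow> B = A"
    by (auto simp: maximal_def)
  have AC: "A \<subseteq> carrier_vec d" using AW WC by blast
  have finA: "finite A" using bound[OF AC Ali] by simp
  obtain B where B: "maximal B (\<lambda>S. A \<subseteq> S \<and> S \<subseteq> carrier_vec d \<and> lin_indpt S)"
    using maximal_exists[of "\<lambda>S. A \<subseteq> S \<and> S \<subseteq> carrier_vec d \<and> lin_indpt S" d A] bound AC Ali by blast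
  then have AB: "A \<subseteq> B" and BC: "B \<subseteq> carrier_vec d" and Bli: "lin_indpt B" by (auto simp: maximal_def)
  have "maximal B (\<lambda>S. S \<subseteq> carrier_vec d \<and> lin_indpt S)"
    using B unfolding maximal_def by (meson order_trans)
  then have basis: "basis B" using max_li_is_basis[of B] by simp
  have finB: "finite B" using bound[OF BC Bli] by simp
  have cardB: "card B = d" using dim_basis[OF finB basis] by (simp add: dim_is_n)
  have spanB: "span B = carrier_vec d" using basis by (simp add: basis_def)
  have WA: "W \<subseteq> span A"
  proof
    fix w assume w: "w \<in> W"
    show "w \<in> span A"
    proof (rule ccontr)
      assume n: "w \<notin> span A"
      then have "w \<notin> A" using in_own_span[of A] AC by auto
      then have "lin_indpt (A \<union> {w})"
        using lin_dep_iff_in_span[of A w] n AC Ali w WC by auto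
      then have "A \<union> {w} = A" using w AW by (intro Amax) auto
      then show False using \<open>w \<notin> A\<close> by auto
    qed
  qed
  obtain as where as: "distinct as" "set as = A" using finite_distinct_list[OF finA] by blast
  obtain cs where cs: "distinct cs" "set cs = B - A" using finite_distinct_list[of "B - A"] finB by blast
  define ws where "ws = as @ cs"
  define k where "k = length as"
  have ws: "distinct ws" "set ws = B" using as cs AB by (auto simp: ws_def)
  have len: "length ws = d" using distinct_card[OF ws(1)] ws(2) cardB by simp
  have wsC: "set ws \<subseteq> carrier_vec d" using ws BC by simp
  have wsA: "ws ! i \<in> A \<longleftrightarrow> i < k" if "i < d" for i
  proof (cases "i < k")
    case True
    then show ?thesis using as nth_mem[of i as] by (auto simp: ws_def nth_append k_def)
  next
    case False
    then have "ws ! i = cs ! (i - k)" "i - k < length cs" using that len by (auto simp: ws_def nth_append k_def)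
    then have "ws ! i \<in> set cs" by auto
    then show ?thesis using cs False by auto
  qed
  define P where "P = mat_of_cols d ws"
  have P: "P \<in> carrier_mat d d" using mat_of_cols_carrier(1)[of d ws] len by (simp add: P_def)
  have lin: "lincomb f B = P *\<^sub>v vec d (\<lambda>i. f (ws ! i))" for f
    using lincomb_as_lincomb_list_distinct[OF wsC ws(1), of f] lincomb_list_as_mat_mult[of ws "\<lambda>i. f (ws ! i)"] wsC
    by (auto simp: ws(2) P_def len subset_iff)
  have inj: "x = 0\<^sub>v d" if x: "x \<in> carrier_vec d" "P *\<^sub>v x = 0\<^sub>v d" for x
  proof -
    define f where "f u = x $ (THE i. i < d \<and> ws ! i = u)" for u
    have f: "f (ws ! i) = x $ i" if "i < d" for i
    proof -
      have "(THE i'. i' < d \<and> ws ! i' = ws ! i) = i"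
        using that ws(1) len by (intro the_equality) (auto simp: nth_eq_iff_index_eq)
      then show ?thesis by (simp add: f_def)
    qed
    then have "vec d (\<lambda>i. f (ws ! i)) = x" using x by auto
    then have "lincomb f B = 0\<^sub>v d" using lin x by simp
    then have "f \<in> B \<rightarrow> {0}" using not_lindepD[OF Bli finB] by (simp add: class_ring_simps)
    then have "f (ws ! i) \<in> {0}" if "i < d" for i
      using nth_mem[of i ws] that len ws(2) by (intro Pi_mem[of f B "\<lambda>_. {0}"]) auto
    then have "x $ i = 0" if "i < d" for i using f[OF that] that by simp
    then show ?thesis using x(1) by auto
  qed
  have surj: "\<exists>v\<in>carrier_vec d. P *\<^sub>v v = u" if "u \<in> carrier_vec d" for u
  proof -
    have "u \<in> span B" using that spanB by simp
    then obtain a where "u = lincomb a B" using finite_span[OF finB] BC by auto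
    then show ?thesis using lin by (metis vec_carrier)
  qed
  obtain Q where Q: "Q \<in> carrier_mat d d" "P * Q = 1\<^sub>m d" "Q * P = 1\<^sub>m d"
    using two_sided_inverse[OF P inj surj] by blast
  have QW: "(Q *\<^sub>v w) $ i = 0" if w: "w \<in> W" and i: "k \<le> i" "i < d" for w i
  proof -
    obtain a where a: "w = lincomb a A" using finite_span[OF finA] AC WA w by auto
    define b where "b u = (if u \<in> A then a u else 0)" for u
    have "lincomb b B = w"
    proof (rule eq_vecI)
      show dims: "dim_vec (lincomb b B) = dim_vec w" using lincomb_dim[OF finB BC, of b] lincomb_dim[OF finA AC, of a] a by simp
      fix j assume "j < dim_vec w"
      then have j: "j < d" using w WC by auto
      have "(lincomb b B) $ j = (\<Sum>u\<in>B. b u * u $ j)" by (rule lincomb_index[OF j BC])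
      also have "\<dots> = (\<Sum>u\<in>A. a u * u $ j)"
        using AB finB by (intro sum.mono_neutral_cong_right) (auto simp: b_def)
      also have "\<dots> = w $ j" unfolding a by (rule lincomb_index[OF j AC, symmetric])
      finally show "(lincomb b B) $ j = w $ j" .
    qed
    then have "Q *\<^sub>v w = Q *\<^sub>v (P *\<^sub>v vec d (\<lambda>i. b (ws ! i)))" using lin by simp
    also have "\<dots> = vec d (\<lambda>i. b (ws ! i))"
      using assoc_mult_mat_vec[OF Q(1) P, of "vec d (\<lambda>i. b (ws ! i))"] Q(3) by simp
    finally show ?thesis using i wsA[of i] by (simp add: b_def)
  qed
  have "k \<noteq> 0"
  proof
    assume "k = 0"
    then have "A = {}" using as by (simp add: k_def)
    then have "W \<subseteq> {0\<^sub>v d}" using WA by (simp add: span_empty)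
    moreover have "0\<^sub>v d \<in> W" using W by (simp add: subspace_iff)
    ultimately show False using W0 by auto
  qed
  moreover have "k < d"
  proof (rule ccontr)
    assume "\<not> k < d"
    then have "length cs = 0" using len unfolding ws_def k_def length_append by linarith
    then have "cs = []" by simp
    then have "A = B" using cs AB by auto
    then have "carrier_vec d \<subseteq> W" using span_is_subset[of A W] W AW spanB by (simp add: VectorSpace.subspace_def)
    then show False using W1 WC by auto
  qed
  moreover have "col P j \<in> W" if "j < k" for j
    using wsA[of j] that \<open>k < d\<close> AW P len wsC nth_mem[of j ws] by (auto simp: P_def subset_iff)
  ultimately show thesis using that[of k P Q] P Q QW by blast
qed

text \<open>In a basis adapted to an invariant subspace the representation is block triangular, and its trace is
  the sum of the traces of the two diagonal blocks, which are representations of smaller degree.\<close>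

lemma character_decomposition:
  assumes G: "group G" and "matrix_rep G d \<rho>"
  shows "\<exists>cs. set cs \<subseteq> Irr G \<and> rep_character G d \<rho> = (\<lambda>g. \<Sum>\<chi>\<leftarrow>cs. \<chi> g)"
  using assms(2)
proof (induction d arbitrary: \<rho> rule: less_induct)
  case (less d)
  show ?case
  proof (cases "d = 0 \<or> irreducible_rep G d \<rho>")
    case True
    then show ?thesis
    proof
      assume "d = 0"
      then show ?thesis by (intro exI[of _ "[]"]) (auto simp: rep_character_def)
    next
      assume "irreducible_rep G d \<rho>"
      then have "rep_character G d \<rho> \<in> Irr G" by (auto simp: Irr_def)
      then show ?thesis by (intro exI[of _ "[rep_character G d \<rho>]"]) auto
    qed
  next
    case False
    interpret m: mat_rep G d \<rho> using G less.prems by (simp add: mat_rep_def mat_rep_axioms_def)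
    obtain W where W: "VectorSpace.subspace class_ring W (module_vec TYPE(complex) d)"
      and inv: "\<And>g w. g \<in> carrier G \<Longrightarrow> w \<in> W \<Longrightarrow> \<rho> g *\<^sub>v w \<in> W" and "W \<noteq> {0\<^sub>v d}" "W \<noteq> carrier_vec d"
      using False less.prems by (auto simp: irreducible_rep_def)
    from adapted_basis[OF this(1,3,4)]
    obtain k P Q where k: "0 < k" "k < d" and P: "P \<in> carrier_mat d d" and Q: "Q \<in> carrier_mat d d"
      and PQ: "P * Q = 1\<^sub>m d" and QP: "Q * P = 1\<^sub>m d" and colP: "\<And>j. j < k \<Longrightarrow> col P j \<in> W"
      and QW: "\<And>w i. w \<in> W \<Longrightarrow> k \<le> i \<Longrightarrow> i < d \<Longrightarrow> (Q *\<^sub>v w) $ i = 0" by blast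
    define \<sigma> where "\<sigma> g = Q * (\<rho> g * P)" for g
    define \<rho>1 where "\<rho>1 g = mat k k (\<lambda>(i, j). \<sigma> g $$ (i, j))" for g
    define \<rho>2 where "\<rho>2 g = mat (d - k) (d - k) (\<lambda>(i, j). \<sigma> g $$ (i + k, j + k))" for g
    have \<sigma>C: "\<sigma> g \<in> carrier_mat d d" if "g \<in> carrier G" for g
      using m.rep_carrier[OF that] P Q by (auto simp: \<sigma>_def)
    have \<sigma>mult: "\<sigma> (g \<otimes>\<^bsub>G\<^esub> h) = \<sigma> g * \<sigma> h" if g: "g \<in> carrier G" and h: "h \<in> carrier G" for g h
    proof -
      note cg = m.rep_carrier[OF g] and ch = m.rep_carrier[OF h]
      have hP: "\<rho> h * P \<in> carrier_mat d d" using ch P by auto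
      have "\<sigma> g * \<sigma> h = Q * ((\<rho> g * P) * (Q * (\<rho> h * P)))"
        unfolding \<sigma>_def using assoc_mult_mat[OF Q mult_carrier_mat[OF cg P] mult_carrier_mat[OF Q hP]] .
      also have "(\<rho> g * P) * (Q * (\<rho> h * P)) = \<rho> g * (P * (Q * (\<rho> h * P)))"
        by (rule assoc_mult_mat[OF cg P mult_carrier_mat[OF Q hP]])
      also have "P * (Q * (\<rho> h * P)) = \<rho> h * P"
        by (simp only: assoc_mult_mat[OF P Q hP, symmetric] PQ left_mult_one_mat[OF hP])
      also have "\<rho> g * (\<rho> h * P) = \<rho> (g \<otimes>\<^bsub>G\<^esub> h) * P"
        using assoc_mult_mat[OF cg ch P] m.rep_mult[OF g h] by simp
      finally show ?thesis by (simp add: \<sigma>_def)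
    qed
    have \<sigma>one: "\<sigma> \<one>\<^bsub>G\<^esub> = 1\<^sub>m d" using P QP by (simp add: \<sigma>_def m.rep_one)
    have \<sigma>0: "\<sigma> g $$ (i, j) = 0" if g: "g \<in> carrier G" and "k \<le> i" "i < d" "j < k" for g i j
    proof -
      note cg = m.rep_carrier[OF g]
      have j: "j < d" and u: "unit_vec d j \<in> carrier_vec d" using that k by auto
      have "P *\<^sub>v unit_vec d j = col P j"
        using P j by (intro eq_vecI) (auto simp: mult_unit_vec_entry[OF P] simp del: index_mult_mat_vec)
      then have "\<sigma> g *\<^sub>v unit_vec d j = Q *\<^sub>v (\<rho> g *\<^sub>v col P j)"
        unfolding \<sigma>_def
        using assoc_mult_mat_vec[OF Q mult_carrier_mat[OF cg P] u] assoc_mult_mat_vec[OF cg P u] by simp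
      then have "(\<sigma> g *\<^sub>v unit_vec d j) $ i = 0"
        using QW inv[OF g colP[OF that(4)]] that by simp
      then show ?thesis using mult_unit_vec_entry[OF \<sigma>C[OF g] that(3) j] by simp
    qed
    have split: "(\<Sum>l<d. f l) = (\<Sum>l<k. f l) + (\<Sum>l<d - k. f (l + k))" for f :: "nat \<Rightarrow> complex"
      using sum_lessThan_add[of f k "d - k"] k by simp
    have r1: "matrix_rep G k \<rho>1"
    proof (rule matrix_repI[OF G])
      fix g h assume g: "g \<in> carrier G" and h: "h \<in> carrier G"
      show "\<rho>1 (g \<otimes>\<^bsub>G\<^esub> h) = \<rho>1 g * \<rho>1 h"
      proof (rule eq_matI)
        fix i j assume "i < dim_row (\<rho>1 g * \<rho>1 h)" "j < dim_col (\<rho>1 g * \<rho>1 h)"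
        then have ij: "i < k" "j < k" by (auto simp: \<rho>1_def)
        have "\<rho>1 (g \<otimes>\<^bsub>G\<^esub> h) $$ (i, j) = (\<Sum>l<d. \<sigma> g $$ (i, l) * \<sigma> h $$ (l, j))"
          using ij k mult_entry[OF \<sigma>C[OF g] \<sigma>C[OF h], of i j]
          by (simp add: \<rho>1_def \<sigma>mult[OF g h] del: index_mult_mat(1))
        also have "\<dots> = (\<Sum>l<k. \<rho>1 g $$ (i, l) * \<rho>1 h $$ (l, j))"
          unfolding split using \<sigma>0[OF h] ij k by (simp add: \<rho>1_def)
        also have "\<dots> = (\<rho>1 g * \<rho>1 h) $$ (i, j)"
          by (rule mult_entry[symmetric]) (use ij in \<open>auto simp: \<rho>1_def\<close>)
        finally show "\<rho>1 (g \<otimes>\<^bsub>G\<^esub> h) $$ (i, j) = (\<rho>1 g * \<rho>1 h) $$ (i, j)" .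
      qed (auto simp: \<rho>1_def)
    qed (use k \<sigma>one in \<open>auto simp: \<rho>1_def\<close>)
    have r2: "matrix_rep G (d - k) \<rho>2"
    proof (rule matrix_repI[OF G])
      fix g h assume g: "g \<in> carrier G" and h: "h \<in> carrier G"
      show "\<rho>2 (g \<otimes>\<^bsub>G\<^esub> h) = \<rho>2 g * \<rho>2 h"
      proof (rule eq_matI)
        fix i j assume "i < dim_row (\<rho>2 g * \<rho>2 h)" "j < dim_col (\<rho>2 g * \<rho>2 h)"
        then have ij: "i < d - k" "j < d - k" by (auto simp: \<rho>2_def)
        have "\<rho>2 (g \<otimes>\<^bsub>G\<^esub> h) $$ (i, j) = (\<Sum>l<d. \<sigma> g $$ (i + k, l) * \<sigma> h $$ (l, j + k))"
          using ij k mult_entry[OF \<sigma>C[OF g] \<sigma>C[OF h], of "i + k" "j + k"]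
          by (simp add: \<rho>2_def \<sigma>mult[OF g h] del: index_mult_mat(1))
        also have "\<dots> = (\<Sum>l<d - k. \<rho>2 g $$ (i, l) * \<rho>2 h $$ (l, j))"
          unfolding split using \<sigma>0[OF g] ij k by (simp add: \<rho>2_def)
        also have "\<dots> = (\<rho>2 g * \<rho>2 h) $$ (i, j)"
          by (rule mult_entry[symmetric]) (use ij in \<open>auto simp: \<rho>2_def\<close>)
        finally show "\<rho>2 (g \<otimes>\<^bsub>G\<^esub> h) $$ (i, j) = (\<rho>2 g * \<rho>2 h) $$ (i, j)" .
      qed (auto simp: \<rho>2_def)
    qed (use k \<sigma>one in \<open>auto simp: \<rho>2_def\<close>)
    have char: "rep_character G d \<rho> g = rep_character G k \<rho>1 g + rep_character G (d - k) \<rho>2 g" for g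
    proof (cases "g \<in> carrier G")
      case g: True
      note cg = m.rep_carrier[OF g]
      have "mtrace (\<sigma> g) = mtrace ((\<rho> g * P) * Q)"
        unfolding \<sigma>_def by (rule mtrace_comm[OF Q]) (use cg P in auto)
      also have "(\<rho> g * P) * Q = \<rho> g" using assoc_mult_mat[OF cg P Q] PQ cg by simp
      finally have "rep_character G d \<rho> g = (\<Sum>l<d. \<sigma> g $$ (l, l))"
        using \<sigma>C[OF g] g by (simp add: m.character_eq mtrace_def)
      also have "\<dots> = rep_character G k \<rho>1 g + rep_character G (d - k) \<rho>2 g"
        unfolding split using g by (simp add: rep_character_def \<rho>1_def \<rho>2_def)
      finally show ?thesis .
    qed (simp add: rep_character_def)
    obtain cs1 cs2 where "set cs1 \<subseteq> Irr G" "rep_character G k \<rho>1 = (\<lambda>g. \<Sum>\<chi>\<leftarrow>cs1. \<chi> g)"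
      "set cs2 \<subseteq> Irr G" "rep_character G (d - k) \<rho>2 = (\<lambda>g. \<Sum>\<chi>\<leftarrow>cs2. \<chi> g)"
      using less.IH[OF k(2) r1] less.IH[OF _ r2] k by auto
    then show ?thesis by (intro exI[of _ "cs1 @ cs2"]) (auto simp: char fun_eq_iff)
  qed
qed

section \<open>Characters and generalised characters\<close>

definition is_character :: "('g, 'm) monoid_scheme \<Rightarrow> ('g \<Rightarrow> complex) \<Rightarrow> bool" where
  "is_character G F \<longleftrightarrow> (\<exists>cs. set cs \<subseteq> Irr G \<and> F = (\<lambda>g. \<Sum>\<chi>\<leftarrow>cs. \<chi> g))"

lemma bilin_sum_list_left: "bilin G (\<lambda>g. \<Sum>\<chi>\<leftarrow>cs. \<chi> g) \<psi> = (\<Sum>\<chi>\<leftarrow>cs. bilin G \<chi> \<psi>)"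
  by (induction cs) (auto simp: bilin_def sum.distrib algebra_simps add_divide_distrib)

lemma bilin_sum_list_right: "bilin G \<phi> (\<lambda>g. \<Sum>\<chi>\<leftarrow>cs. \<chi> g) = (\<Sum>\<chi>\<leftarrow>cs. bilin G \<phi> \<chi>)"
  by (induction cs) (auto simp: bilin_def sum.distrib algebra_simps add_divide_distrib)

lemma is_character_multiplicity:
  assumes "group G" "finite (carrier G)" "is_character G F" "\<chi> \<in> Irr G"
  obtains m :: nat where "bilin G F \<chi> = of_nat m"
proof -
  obtain cs where cs: "set cs \<subseteq> Irr G" "F = (\<lambda>g. \<Sum>\<chi>\<leftarrow>cs. \<chi> g)" using assms(3) by (auto simp: is_character_def)
  have "(\<Sum>\<psi>\<leftarrow>cs. bilin G \<psi> \<chi>) = of_nat (count_list cs \<chi>)"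
    using cs(1) by (induction cs) (auto simp: bilin_Irr[OF assms(1,2) _ assms(4)])
  then show thesis using that cs(2) bilin_sum_list_left by metis
qed

text \<open>The form is a sum of products of multiplicities, which are nonnegative, so nothing can cancel.\<close>

lemma common_constituent_iff:
  assumes G: "group G" "finite (carrier G)" and F: "is_character G F" and F': "is_character G F'"
  shows "bilin G F F' \<noteq> 0 \<longleftrightarrow> (\<exists>\<chi>\<in>Irr G. bilin G F \<chi> \<noteq> 0 \<and> bilin G F' \<chi> \<noteq> 0)"
proof -
  obtain cs where cs: "set cs \<subseteq> Irr G" "F = (\<lambda>g. \<Sum>\<chi>\<leftarrow>cs. \<chi> g)" using F by (auto simp: is_character_def)
  obtain ds where ds: "set ds \<subseteq> Irr G" "F' = (\<lambda>g. \<Sum>\<chi>\<leftarrow>ds. \<chi> g)" using F' by (auto simp: is_character_def)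
  have mult: "(\<Sum>\<psi>\<leftarrow>es. bilin G \<psi> \<chi>) = of_nat (count_list es \<chi>)" if "set es \<subseteq> Irr G" "\<chi> \<in> Irr G" for es \<chi>
    using that by (induction es) (auto simp: bilin_Irr[OF G])
  have b: "bilin G F \<chi> = of_nat (count_list cs \<chi>)" "bilin G F' \<chi> = of_nat (count_list ds \<chi>)"
    if "\<chi> \<in> Irr G" for \<chi>
    unfolding cs(2) ds(2) bilin_sum_list_left using mult that cs(1) ds(1) by auto
  have "bilin G F F' = (\<Sum>\<chi>\<leftarrow>ds. of_nat (count_list cs \<chi>))"
    unfolding ds(2) bilin_sum_list_right using b ds(1) by (intro arg_cong[where f = sum_list] map_cong) auto
  also have "\<dots> = of_nat (\<Sum>\<chi>\<leftarrow>ds. count_list cs \<chi>)"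
    by (induction ds) auto
  finally have "bilin G F F' \<noteq> 0 \<longleftrightarrow> (\<exists>\<chi>\<in>set ds. count_list cs \<chi> \<noteq> 0)"
    by (simp only: of_nat_eq_0_iff sum_list_eq_0_iff) auto
  also have "\<dots> \<longleftrightarrow> (\<exists>\<chi>\<in>Irr G. bilin G F \<chi> \<noteq> 0 \<and> bilin G F' \<chi> \<noteq> 0)"
    using b ds(1) by (auto simp: count_list_0_iff)
  finally show ?thesis .
qed

lemma sum_fun_apply: "(\<Sum>a\<in>A. f a) x = (\<Sum>a\<in>A. f a x)"
  by (induction A rule: infinite_finite_induct) auto

lemma is_character_in_span:
  assumes "is_character G F"
  shows "F \<in> int_fun.span (Irr G)"
proof -
  obtain cs where cs: "set cs \<subseteq> Irr G" "F = (\<lambda>g. \<Sum>\<chi>\<leftarrow>cs. \<chi> g)" using assms by (auto simp: is_character_def)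
  have "(\<lambda>g. \<Sum>\<chi>\<leftarrow>cs. \<chi> g) \<in> int_fun.span (Irr G)"
    using cs(1)
  proof (induction cs)
    case Nil
    then show ?case using int_fun.span_zero by (simp add: zero_fun_def)
  next
    case (Cons \<chi> cs)
    then show ?case using int_fun.span_add[OF int_fun.span_base[of \<chi> "Irr G"]] by (simp add: plus_fun_def)
  qed
  then show ?thesis by (simp add: cs(2))
qed

text \<open>A sum of integer squares equal to one has a single nonzero term, and its root is \<open>1\<close> or \<open>-1\<close>.\<close>

lemma norm_one_irreducible:
  assumes G: "group G" "finite (carrier G)" and F: "F \<in> int_fun.span (Irr G)" and norm: "bilin G F F = 1"
  shows "F \<in> Irr G \<or> (\<lambda>g. - F g) \<in> Irr G"
proof -
  obtain S z where S: "finite S" "S \<subseteq> Irr G" and F: "F = (\<Sum>\<chi>\<in>S. int_scale (z \<chi>) \<chi>)"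
    using F unfolding int_fun.span_explicit by blast
  have Fg: "F g = (\<Sum>\<chi>\<in>S. of_int (z \<chi>) * \<chi> g)" for g by (simp add: F sum_fun_apply int_scale_def)
  have "bilin G F F = (\<Sum>\<chi>\<in>S. \<Sum>\<psi>\<in>S. of_int (z \<chi>) * of_int (z \<psi>) * bilin G \<chi> \<psi>)"
  proof -
    have "(\<Sum>g\<in>carrier G. F g * F (inv\<^bsub>G\<^esub> g))
        = (\<Sum>g\<in>carrier G. \<Sum>\<chi>\<in>S. \<Sum>\<psi>\<in>S. of_int (z \<chi>) * of_int (z \<psi>) * (\<chi> g * \<psi> (inv\<^bsub>G\<^esub> g)))"
      unfolding Fg sum_product by (intro sum.cong refl) (simp add: mult_ac)
    also have "\<dots> = (\<Sum>\<chi>\<in>S. \<Sum>\<psi>\<in>S. \<Sum>g\<in>carrier G. of_int (z \<chi>) * of_int (z \<psi>) * (\<chi> g * \<psi> (inv\<^bsub>G\<^esub> g)))"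
      by (subst sum.swap, rule sum.cong[OF refl], rule sum.swap)
    finally show ?thesis
      by (simp add: bilin_def sum_divide_distrib sum_distrib_left)
  qed
  also have "\<dots> = (\<Sum>\<chi>\<in>S. \<Sum>\<psi>\<in>S. if \<chi> = \<psi> then of_int ((z \<chi>)\<^sup>2) else 0)"
    using S(2) by (intro sum.cong refl) (auto simp: bilin_Irr[OF G] power2_eq_square subset_iff)
  also have "\<dots> = of_int (\<Sum>\<chi>\<in>S. (z \<chi>)\<^sup>2)" using S(1) by simp
  finally have "of_int (\<Sum>\<chi>\<in>S. (z \<chi>)\<^sup>2) = (1 :: complex)" using norm by simp
  then have one: "(\<Sum>\<chi>\<in>S. (z \<chi>)\<^sup>2) = 1" by (simp only: of_int_eq_1_iff)
  then obtain \<chi>0 where \<chi>0: "\<chi>0 \<in> S" "z \<chi>0 \<noteq> 0" using sum.neutral[of S "\<lambda>\<chi>. (z \<chi>)\<^sup>2"] by fastforce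
  have split: "(z \<chi>0)\<^sup>2 + (\<Sum>\<chi>\<in>S - {\<chi>0}. (z \<chi>)\<^sup>2) = 1" using one S(1) \<chi>0(1) by (simp add: sum.remove)
  have ge: "(z \<chi>0)\<^sup>2 \<ge> 1" using \<chi>0(2) by (metis add_cancel_right_right add_le_same_cancel1 int_one_le_iff_zero_less zero_less_power2)
  have "(\<Sum>\<chi>\<in>S - {\<chi>0}. (z \<chi>)\<^sup>2) = 0" using split ge sum_nonneg[of "S - {\<chi>0}" "\<lambda>\<chi>. (z \<chi>)\<^sup>2"] by simp
  then have z0: "\<forall>\<chi>\<in>S - {\<chi>0}. z \<chi> = 0" using S(1) by (subst (asm) sum_nonneg_eq_0_iff) auto
  have "(z \<chi>0)\<^sup>2 = 1" using split \<open>(\<Sum>\<chi>\<in>S - {\<chi>0}. (z \<chi>)\<^sup>2) = 0\<close> by simp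
  then have pm: "z \<chi>0 = 1 \<or> z \<chi>0 = -1" by (simp add: power2_eq_1_iff)
  have "F g = of_int (z \<chi>0) * \<chi>0 g" for g
    unfolding Fg using S(1) \<chi>0(1) z0 by (simp add: sum.remove)
  then have "F = \<chi>0 \<or> (\<lambda>g. - F g) = \<chi>0" using pm by (auto simp: fun_eq_iff)
  then show ?thesis using \<chi>0(1) S(2) by auto
qed

section \<open>Weak compositions and alternating functions\<close>

definition weak_comps :: "'i set \<Rightarrow> nat \<Rightarrow> ('i \<Rightarrow> nat) set" where
  "weak_comps I m = {\<kappa>. (\<forall>i. i \<notin> I \<longrightarrow> \<kappa> i = 0) \<and> sum \<kappa> I = m}"

lemma finite_weak_comps [simp]:
  assumes "finite I"
  shows "finite (weak_comps I m)"
proof -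
  have "weak_comps I m \<subseteq> {\<kappa>. \<forall>i. (i \<in> I \<longrightarrow> \<kappa> i \<in> {..m}) \<and> (i \<notin> I \<longrightarrow> \<kappa> i = 0)}"
    using member_le_sum[of _ I] assms by (fastforce simp: weak_comps_def)
  then show ?thesis
    by (rule finite_subset) (rule finite_set_of_finite_funs[OF assms finite_atMost])
qed

lemma sum_fun_upd_add:
  fixes \<kappa> :: "'i \<Rightarrow> nat"
  assumes "finite I" "i \<in> I"
  shows "sum (\<kappa>(i := \<kappa> i + k)) I = sum \<kappa> I + k"
  using assms by (simp add: sum.remove[of I i])

lemma sum_fun_upd_diff:
  fixes \<kappa> :: "'i \<Rightarrow> nat"
  assumes "finite I" "i \<in> I" "k \<le> \<kappa> i"
  shows "sum (\<kappa>(i := \<kappa> i - k)) I = sum \<kappa> I - k"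
  using assms by (simp add: sum.remove[of I i])

lemma weak_comps_le: "finite I \<Longrightarrow> \<kappa> \<in> weak_comps I m \<Longrightarrow> \<kappa> i \<le> m"
  using member_le_sum[of i I \<kappa>] by (cases "i \<in> I") (auto simp: weak_comps_def)

lemma sum_weak_comps_part:
  fixes F :: "('i \<Rightarrow> nat) \<Rightarrow> 'b::comm_monoid_add"
  assumes "finite I" "i \<in> I"
  shows "(\<Sum>\<kappa> | \<kappa> \<in> weak_comps I m \<and> k \<le> \<kappa> i. F \<kappa>)
       = (if k \<le> m then \<Sum>\<kappa>\<in>weak_comps I (m - k). F (\<kappa>(i := \<kappa> i + k)) else 0)"
proof (cases "k \<le> m")
  case True
  show ?thesis unfolding if_P[OF True]
  proof (rule sum.reindex_bij_witness[where i = "\<lambda>\<kappa>. \<kappa>(i := \<kappa> i + k)" and j = "\<lambda>\<kappa>. \<kappa>(i := \<kappa> i - k)"])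
    fix \<kappa> assume "\<kappa> \<in> {\<kappa> \<in> weak_comps I m. k \<le> \<kappa> i}"
    then show "\<kappa>(i := \<kappa> i - k) \<in> weak_comps I (m - k)"
      using sum_fun_upd_diff[OF assms, of k \<kappa>] assms by (auto simp: weak_comps_def)
  next
    fix \<kappa> assume "\<kappa> \<in> weak_comps I (m - k)"
    then show "\<kappa>(i := \<kappa> i + k) \<in> {\<kappa> \<in> weak_comps I m. k \<le> \<kappa> i}"
      using sum_fun_upd_add[OF assms, of \<kappa> k] assms True by (auto simp: weak_comps_def)
  qed auto
next
  case False
  then have "{\<kappa> \<in> weak_comps I m. k \<le> \<kappa> i} = {}"
    using weak_comps_le[OF assms(1), of _ m i] by (auto dest: le_trans)
  then show ?thesis using False by (simp only: sum.empty if_False)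
qed

text \<open>Newton's identity \<open>m h\<^sub>m = \<Sum>\<^sub>k p\<^sub>k h\<^bsub>m-k\<^esub>\<close>, with an arbitrary linear functional \<open>F\<close> in place of
  the evaluation of monomials: a monomial of degree \<open>m\<close> is divisible by \<open>x\<^sub>i\<^sup>k\<close> with \<open>k \<ge> 1\<close> for exactly
  \<open>m\<close> pairs \<open>(i, k)\<close>.\<close>

lemma newton_weak_comps:
  fixes F :: "('i \<Rightarrow> nat) \<Rightarrow> 'b::comm_semiring_1"
  assumes "finite I"
  shows "of_nat m * (\<Sum>\<kappa>\<in>weak_comps I m. F \<kappa>)
       = (\<Sum>k=1..m. \<Sum>i\<in>I. \<Sum>\<kappa>\<in>weak_comps I (m - k). F (\<kappa>(i := \<kappa> i + k)))"
proof -
  have "of_nat m * (\<Sum>\<kappa>\<in>weak_comps I m. F \<kappa>) = (\<Sum>\<kappa>\<in>weak_comps I m. \<Sum>i\<in>I. \<Sum>k | k \<in> {1..m} \<and> k \<le> \<kappa> i. F \<kappa>)"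
    unfolding sum_distrib_left
  proof (rule sum.cong[OF refl])
    fix \<kappa> assume \<kappa>: "\<kappa> \<in> weak_comps I m"
    have "{k \<in> {1..m}. k \<le> \<kappa> i} = {1..\<kappa> i}" for i
      using weak_comps_le[OF assms \<kappa>, of i] by auto
    then have "(\<Sum>i\<in>I. \<Sum>k | k \<in> {1..m} \<and> k \<le> \<kappa> i. F \<kappa>) = of_nat (sum \<kappa> I) * F \<kappa>"
      by (simp add: sum_distrib_right)
    then show "of_nat m * F \<kappa> = (\<Sum>i\<in>I. \<Sum>k | k \<in> {1..m} \<and> k \<le> \<kappa> i. F \<kappa>)"
      using \<kappa> by (simp only: weak_comps_def mem_Collect_eq)
  qed
  also have "\<dots> = (\<Sum>i\<in>I. \<Sum>\<kappa>\<in>weak_comps I m. \<Sum>k | k \<in> {1..m} \<and> k \<le> \<kappa> i. F \<kappa>)"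
    by (rule sum.swap)
  also have "\<dots> = (\<Sum>i\<in>I. \<Sum>k\<in>{1..m}. \<Sum>\<kappa> | \<kappa> \<in> weak_comps I m \<and> k \<le> \<kappa> i. F \<kappa>)"
    by (intro sum.cong[OF refl] sum.swap_restrict) (simp_all add: assms)
  also have "\<dots> = (\<Sum>i\<in>I. \<Sum>k=1..m. \<Sum>\<kappa>\<in>weak_comps I (m - k). F (\<kappa>(i := \<kappa> i + k)))"
    by (intro sum.cong[OF refl]) (subst sum_weak_comps_part, auto simp: assms)
  also have "\<dots> = (\<Sum>k=1..m. \<Sum>i\<in>I. \<Sum>\<kappa>\<in>weak_comps I (m - k). F (\<kappa>(i := \<kappa> i + k)))"
    by (rule sum.swap)
  finally show ?thesis .
qed

abbreviation vecs :: "nat \<Rightarrow> nat \<Rightarrow> (nat \<Rightarrow> nat) set" where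
  "vecs N \<equiv> weak_comps {..<N}"

text \<open>The least degree of a vector with pairwise distinct entries.\<close>

definition stair :: "nat \<Rightarrow> nat" where
  "stair N = (\<Sum>i<N. i)"

definition alternating :: "nat \<Rightarrow> ((nat \<Rightarrow> nat) \<Rightarrow> complex) \<Rightarrow> bool" where
  "alternating N y \<longleftrightarrow> (\<forall>w \<beta>. w permutes {..<N} \<longrightarrow> y (\<beta> \<circ> w) = of_int (sign w) * y \<beta>)"

text \<open>If \<open>y\<close> is read as the functional \<open>x\<^sup>\<beta> \<mapsto> y \<beta>\<close> on polynomials, then \<open>up N k y\<close> is \<open>f \<mapsto> y (p\<^sub>k f)\<close>.\<close>

definition up :: "nat \<Rightarrow> nat \<Rightarrow> ((nat \<Rightarrow> nat) \<Rightarrow> complex) \<Rightarrow> (nat \<Rightarrow> nat) \<Rightarrow> complex" where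
  "up N k y = (\<lambda>\<beta>. \<Sum>i<N. y (\<beta>(i := \<beta> i + k)))"

text \<open>If \<open>y\<close> is read as the series \<open>\<Sum> y \<beta> x\<^sup>\<beta>\<close> and \<open>P\<close> holds everywhere, then this is multiplication
  by the power sum \<open>p\<^sub>k\<close>.  In general only the entries of \<open>\<beta>\<close> with the property \<open>P\<close> are lowered.\<close>

definition down ::
  "nat \<Rightarrow> (nat \<Rightarrow> bool) \<Rightarrow> nat \<Rightarrow> ((nat \<Rightarrow> nat) \<Rightarrow> complex) \<Rightarrow> (nat \<Rightarrow> nat) \<Rightarrow> complex" where
  "down N P k y = (\<lambda>\<beta>. \<Sum>j<N. if k \<le> \<beta> j \<and> P (\<beta> j) then y (\<beta>(j := \<beta> j - k)) else 0)"

lemma alternatingD: "alternating N y \<Longrightarrow> w permutes {..<N} \<Longrightarrow> y (\<beta> \<circ> w) = of_int (sign w) * y \<beta>"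
  by (simp add: alternating_def)

lemma alternating_repeat:
  assumes "alternating N y" "i < N" "j < N" "i \<noteq> j" "\<beta> i = \<beta> j"
  shows "y \<beta> = 0"
proof -
  have "\<beta> \<circ> Transposition.transpose i j = \<beta>"
    using assms by (auto simp: fun_eq_iff Transposition.transpose_def)
  moreover have "y (\<beta> \<circ> Transposition.transpose i j) = - y \<beta>"
    using alternatingD[OF assms(1), of "Transposition.transpose i j" \<beta>] assms
    by (simp add: permutes_swap_id sign_swap_id)
  ultimately show ?thesis by simp
qed

lemma alternating_not_inj: "alternating N y \<Longrightarrow> \<not> inj_on \<beta> {..<N} \<Longrightarrow> y \<beta> = 0"
  unfolding inj_on_def using alternating_repeat by blast

lemma fun_upd_comp_permutes:
  assumes "w permutes S"
  shows "(\<beta> \<circ> w)(i := v) = \<beta>(w i := v) \<circ> w"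
  using permutes_inj[OF assms] by (auto simp: fun_eq_iff inj_eq)

lemma alternating_up:
  assumes "alternating N y"
  shows "alternating N (up N k y)"
  unfolding alternating_def
proof (intro allI impI)
  fix w :: "nat \<Rightarrow> nat" and \<beta> assume w: "w permutes {..<N}"
  have "up N k y (\<beta> \<circ> w) = (\<Sum>i<N. of_int (sign w) * y (\<beta>(w i := \<beta> (w i) + k)))"
    using alternatingD[OF assms w] by (simp add: up_def fun_upd_comp_permutes[OF w])
  also have "\<dots> = (\<Sum>i<N. of_int (sign w) * y (\<beta>(i := \<beta> i + k)))"
    by (rule sum.reindex_bij_betw[OF permutes_imp_bij[OF w], of "\<lambda>i. of_int (sign w) * y (\<beta>(i := \<beta> i + k))"])
  finally show "up N k y (\<beta> \<circ> w) = of_int (sign w) * up N k y \<beta>"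
    by (simp add: up_def sum_distrib_left)
qed

lemma alternating_down:
  assumes "alternating N y"
  shows "alternating N (down N P k y)"
  unfolding alternating_def
proof (intro allI impI)
  fix w :: "nat \<Rightarrow> nat" and \<beta> assume w: "w permutes {..<N}"
  let ?t = "\<lambda>i. of_int (sign w) * (if k \<le> \<beta> i \<and> P (\<beta> i) then y (\<beta>(i := \<beta> i - k)) else 0)"
  have "down N P k y (\<beta> \<circ> w) = (\<Sum>i<N. ?t (w i))"
    unfolding down_def
    by (rule sum.cong) (use alternatingD[OF assms w] in \<open>auto simp: fun_upd_comp_permutes[OF w]\<close>)
  also have "\<dots> = (\<Sum>i<N. ?t i)"
    by (rule sum.reindex_bij_betw[OF permutes_imp_bij[OF w], of ?t])
  finally show "down N P k y (\<beta> \<circ> w) = of_int (sign w) * down N P k y \<beta>"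
    by (simp add: down_def sum_distrib_left)
qed

section \<open>The Heisenberg relation and the energy operator\<close>

text \<open>Each position left free below \<open>N - m\<close> would push more than \<open>m\<close> beads up by one step.\<close>

lemma initial_segment:
  fixes B :: "nat set"
  assumes "finite B" "card B = N" "\<Sum>B \<le> m + stair N" "v < N - m"
  shows "v \<in> B"
proof (rule ccontr)
  assume v: "v \<notin> B"
  \<comment> \<open>close the gap at \<open>v\<close>\<close>
  define f where "f x = (if x < v then x else x - 1)" for x
  have inj: "inj_on f B"
  proof (rule inj_onI)
    fix x y assume "x \<in> B" "y \<in> B" "f x = f y"
    moreover from this v have "x \<noteq> v" "y \<noteq> v" by auto
    ultimately show "x = y" by (auto simp: f_def split: if_splits)
  qed
  have "{..<N} = {0..<card B}" using assms by auto
  then have "stair N \<le> \<Sum>(f ` B)"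
    using card_sum_le_nat_sum[of "f ` B"] card_image[OF inj] assms(2) by (simp add: stair_def atLeast0LessThan)
  also have "\<dots> = (\<Sum>x\<in>B. f x)"
    using inj by (simp add: sum.reindex)
  finally have 1: "stair N \<le> (\<Sum>x\<in>B. f x)" .
  have "(\<Sum>x\<in>B. x) = (\<Sum>x\<in>B. f x + (if v < x then 1 else 0))"
    by (rule sum.cong) (use v in \<open>auto simp: f_def not_less_iff_gr_or_eq\<close>)
  also have "\<dots> = (\<Sum>x\<in>B. f x) + card {x\<in>B. v < x}"
    using assms(1) by (simp add: sum.distrib sum.If_cases Int_def)
  finally have 2: "(\<Sum>x\<in>B. f x) + card {x\<in>B. v < x} \<le> m + stair N"
    using assms(3) by simp
  have "B = {x\<in>B. v < x} \<union> {x\<in>B. x < v}" using v by (auto simp: not_less_iff_gr_or_eq)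
  then have "card B \<le> card {x\<in>B. v < x} + card {x\<in>B. x < v}"
    by (metis card_Un_le)
  moreover have "card {x\<in>B. x < v} \<le> card {..<v}"
    by (rule card_mono) auto
  ultimately show False using 1 2 assms by simp
qed

lemma vec_initial_segment:
  assumes "inj_on \<beta> {..<N}" "sum \<beta> {..<N} \<le> m + stair N" "v + m < N"
  shows "\<exists>i<N. \<beta> i = v"
proof -
  have "v \<in> \<beta> ` {..<N}"
    by (rule initial_segment[of _ N m])
      (use assms in \<open>auto simp: card_image sum.reindex\<close>)
  then show ?thesis by auto
qed

lemma inj_sum_ge_stair: "inj_on \<beta> {..<N} \<Longrightarrow> stair N \<le> sum \<beta> {..<N}"
  using card_sum_le_nat_sum[of "\<beta> ` {..<N}"]
  by (simp add: card_image sum.reindex stair_def atLeast0LessThan)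

lemma alternating_low: "alternating N y \<Longrightarrow> sum \<beta> {..<N} < stair N \<Longrightarrow> y \<beta> = 0"
  using inj_sum_ge_stair alternating_not_inj by (metis not_le)

text \<open>The two compositions differ only where the same bead is first raised and then lowered, and would
  have been too low for lowering at the start.\<close>

lemma up_down_diff:
  assumes per: "\<And>v. P (v + l) = P v"
  shows "up N l (down N P k y) \<beta> = down N P k (up N l y) \<beta>
     + (\<Sum>j<N. if \<beta> j < k \<and> k \<le> \<beta> j + l \<and> P (\<beta> j) then y (\<beta>(j := \<beta> j + l - k)) else 0)"
proof -
  let ?T = "\<lambda>i j. if k \<le> \<beta> j \<and> P (\<beta> j) then y (\<beta>(j := \<beta> j - k, i := (\<beta>(j := \<beta> j - k)) i + l)) else 0"
  let ?d = "\<lambda>j. if \<beta> j < k \<and> k \<le> \<beta> j + l \<and> P (\<beta> j) then y (\<beta>(j := \<beta> j + l - k)) else 0"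
  have *: "(if k \<le> (\<beta>(i := \<beta> i + l)) j \<and> P ((\<beta>(i := \<beta> i + l)) j)
         then y ((\<beta>(i := \<beta> i + l))(j := (\<beta>(i := \<beta> i + l)) j - k)) else 0)
      = ?T i j + (if i = j then ?d j else 0)" for i j
    by (cases "i = j") (auto simp: per fun_upd_twist)
  have "up N l (down N P k y) \<beta> = (\<Sum>i<N. \<Sum>j<N. ?T i j + (if i = j then ?d j else 0))"
    unfolding up_def down_def * ..
  also have "\<dots> = (\<Sum>i<N. \<Sum>j<N. ?T i j) + (\<Sum>j<N. ?d j)"
    by (simp add: sum.distrib)
  also have "(\<Sum>i<N. \<Sum>j<N. ?T i j) = (\<Sum>j<N. \<Sum>i<N. ?T i j)" by (rule sum.swap)
  also have "(\<Sum>j<N. \<Sum>i<N. ?T i j) = down N P k (up N l y) \<beta>"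
    unfolding up_def down_def
  proof (rule sum.cong[OF refl])
    fix j
    show "(\<Sum>i<N. ?T i j) = (if k \<le> \<beta> j \<and> P (\<beta> j)
        then \<Sum>i<N. y ((\<beta>(j := \<beta> j - k))(i := (\<beta>(j := \<beta> j - k)) i + l)) else 0)"
      by (cases "k \<le> \<beta> j \<and> P (\<beta> j)") auto
  qed
  finally show ?thesis .
qed

text \<open>The Heisenberg relation \<open>[U\<^sub>l, D\<^sub>k] = k \<delta>\<^sub>k\<^sub>l\<close> of the Fock space, with \<open>D\<^sub>k\<close> restricted to the beads
  selected by \<open>P\<close>.  There are enough variables for \<open>\<beta>\<close> to occupy all positions below \<open>k\<close> and \<open>l\<close>.  So
  for \<open>k = l\<close> the difference counts the positions below \<open>k\<close> selected by \<open>P\<close>, and for \<open>k \<noteq> l\<close> each of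
  its terms has a repeated entry.\<close>

lemma up_down_commute:
  assumes y: "alternating N y" and per: "\<And>v. P (v + l) = P v"
    and deg: "sum \<beta> {..<N} \<le> m + stair N" and N: "m + k \<le> N" "m + l \<le> N"
  shows "up N l (down N P k y) \<beta> = down N P k (up N l y) \<beta>
     + (if k = l then of_nat (card {v. v < k \<and> P v}) * y \<beta> else 0)"
proof (cases "inj_on \<beta> {..<N}")
  case False
  have "z \<beta> = 0" if "alternating N z" for z
    using alternating_not_inj[OF that False] .
  from this[OF y] this[OF alternating_up[OF alternating_down[OF y]]]
    this[OF alternating_down[OF alternating_up[OF y]]]
  show ?thesis by simp
next
  case inj: True
  let ?d = "\<lambda>j. if \<beta> j < k \<and> k \<le> \<beta> j + l \<and> P (\<beta> j) then y (\<beta>(j := \<beta> j + l - k)) else 0"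
  have occ: "\<exists>i<N. \<beta> i = v" if "v < k \<or> v < l" for v
    by (rule vec_initial_segment[OF inj deg]) (use that N in auto)
  have "(\<Sum>j<N. ?d j) = (if k = l then of_nat (card {v. v < k \<and> P v}) * y \<beta> else 0)"
  proof (cases "k = l")
    case True
    have "(\<Sum>j<N. ?d j) = (\<Sum>j<N. if \<beta> j < k \<and> P (\<beta> j) then y \<beta> else 0)"
      using True by (intro sum.cong) auto
    also have "\<dots> = of_nat (card {j\<in>{..<N}. \<beta> j < k \<and> P (\<beta> j)}) * y \<beta>"
      by (simp add: sum.If_cases Int_def)
    also have "bij_betw \<beta> {j\<in>{..<N}. \<beta> j < k \<and> P (\<beta> j)} {v. v < k \<and> P v}"
      using inj occ by (fastforce simp: bij_betw_def inj_on_def)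
    then have "card {j\<in>{..<N}. \<beta> j < k \<and> P (\<beta> j)} = card {v. v < k \<and> P v}"
      by (rule bij_betw_same_card)
    finally show ?thesis using True by simp
  next
    case False
    have "?d j = 0" if j: "j < N" for j
    proof (cases "\<beta> j < k \<and> k \<le> \<beta> j + l")
      case c: True
      then have "\<beta> j + l - k < l" by auto
      then obtain i where i: "i < N" "\<beta> i = \<beta> j + l - k" using occ by blast
      then have "i \<noteq> j" using False c by auto
      then have "y (\<beta>(j := \<beta> j + l - k)) = 0"
        using i j by (intro alternating_repeat[OF y, of i j]) auto
      then show ?thesis by simp
    qed auto
    then show ?thesis using False by simp
  qed
  then show ?thesis using up_down_diff[of P l N k y \<beta>] per by simp
qed

lemma fun_upd2_transpose:
  "i \<noteq> j \<Longrightarrow> \<beta>(i := a, j := b) \<circ> Transposition.transpose i j = \<beta>(i := b, j := a)"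
  by (auto simp: fun_eq_iff Transposition.transpose_def)

text \<open>Two beads at \<open>a\<close> and \<open>b\<close> exchange \<open>k\<close> steps: the resulting pairs \<open>(u, a + b - u)\<close> run through all
  \<open>u \<noteq> a\<close>, so antisymmetry leaves only minus the term with \<open>u = a\<close>.\<close>

lemma pair_transfer:
  assumes y: "alternating N y" and ij: "i < N" "j < N" "i \<noteq> j"
  shows "(\<Sum>k=1..\<beta> j. y (\<beta>(j := \<beta> j - k, i := \<beta> i + k))) + (\<Sum>k=1..\<beta> i. y (\<beta>(i := \<beta> i - k, j := \<beta> j + k)))
       = - y \<beta>"
proof -
  define s where "s = \<beta> i + \<beta> j"
  define f where "f u = y (\<beta>(i := u, j := s - u))" for u
  have "f (s - u) = - f u" if "u \<le> s" for u
    using alternatingD[OF y, of "Transposition.transpose i j" "\<beta>(i := u, j := s - u)"] ij that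
    by (simp add: f_def permutes_swap_id sign_swap_id fun_upd2_transpose)
  then have "(\<Sum>u=0..s. f u) = - (\<Sum>u=0..s. f u)"
    by (subst sum.atLeastAtMost_rev) (simp add: sum_negf)
  then have 0: "(\<Sum>u=0..s. f u) = 0" by simp
  have 1: "(\<Sum>k=1..\<beta> j. y (\<beta>(j := \<beta> j - k, i := \<beta> i + k))) = (\<Sum>u\<in>{\<beta> i<..s}. f u)"
    by (rule sum.reindex_bij_witness[where i = "\<lambda>u. u - \<beta> i" and j = "\<lambda>k. \<beta> i + k"])
      (use ij in \<open>auto simp: f_def s_def fun_upd_twist\<close>)
  have 2: "(\<Sum>k=1..\<beta> i. y (\<beta>(i := \<beta> i - k, j := \<beta> j + k))) = (\<Sum>u\<in>{0..<\<beta> i}. f u)"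
    by (rule sum.reindex_bij_witness[where i = "\<lambda>u. \<beta> i - u" and j = "\<lambda>k. \<beta> i - k"])
      (auto simp: f_def s_def intro!: arg_cong[where f = y])
  have "{0..s} = insert (\<beta> i) ({\<beta> i<..s} \<union> {0..<\<beta> i})"
    by (auto simp: s_def)
  then have "(\<Sum>u=0..s. f u) = sum f (insert (\<beta> i) ({\<beta> i<..s} \<union> {0..<\<beta> i}))"
    by (rule arg_cong)
  also have "\<dots> = f (\<beta> i) + sum f ({\<beta> i<..s} \<union> {0..<\<beta> i})"
    by (rule sum.insert) auto
  also have "sum f ({\<beta> i<..s} \<union> {0..<\<beta> i}) = (\<Sum>u\<in>{\<beta> i<..s}. f u) + (\<Sum>u\<in>{0..<\<beta> i}. f u)"
    by (rule sum.union_disjoint) auto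
  finally have "(\<Sum>u=0..s. f u) = f (\<beta> i) + ((\<Sum>u\<in>{\<beta> i<..s}. f u) + (\<Sum>u\<in>{0..<\<beta> i}. f u))" .
  moreover have "f (\<beta> i) = y \<beta>" by (simp add: f_def s_def)
  ultimately show ?thesis using 0 1 2 by (simp add: add_eq_0_iff)
qed

lemma stair_eq: "2 * stair N = N * (N - 1)"
  by (induction N) (auto simp: stair_def algebra_simps)

text \<open>The bead that is lowered by \<open>k\<close> and the bead that is raised by \<open>k\<close> are either the same, which gives
  \<open>\<Sum> \<beta>\<^sub>j = n + stair N\<close> times \<open>y \<beta>\<close>, or they form one of the \<open>stair N\<close> pairs of different beads, each of
  which contributes \<open>- y \<beta>\<close>.\<close>

lemma energy:
  assumes y: "alternating N y" and deg: "sum \<beta> {..<N} = n + stair N" and K: "\<And>j. j < N \<Longrightarrow> \<beta> j \<le> K"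
  shows "(\<Sum>k=1..K. down N (\<lambda>_. True) k (up N k y) \<beta>) = of_nat n * y \<beta>"
proof -
  let ?g = "\<lambda>i j. (\<Sum>k=1..\<beta> j. y ((\<beta>(j := \<beta> j - k))(i := (\<beta>(j := \<beta> j - k)) i + k)))"
  have "(\<Sum>k=1..K. down N (\<lambda>_. True) k (up N k y) \<beta>)
     = (\<Sum>j<N. \<Sum>k=1..K. if k \<le> \<beta> j then \<Sum>i<N. y ((\<beta>(j := \<beta> j - k))(i := (\<beta>(j := \<beta> j - k)) i + k)) else 0)"
    unfolding up_def down_def by (subst sum.swap) simp
  also have "\<dots> = (\<Sum>j<N. \<Sum>k=1..\<beta> j. \<Sum>i<N. y ((\<beta>(j := \<beta> j - k))(i := (\<beta>(j := \<beta> j - k)) i + k)))"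
  proof (intro sum.cong[OF refl])
    fix j assume "j \<in> {..<N}"
    then have "{1..K} \<inter> {k. k \<le> \<beta> j} = {1..\<beta> j}" using K[of j] by auto
    then show "(\<Sum>k=1..K. if k \<le> \<beta> j then \<Sum>i<N. y ((\<beta>(j := \<beta> j - k))(i := (\<beta>(j := \<beta> j - k)) i + k)) else 0)
      = (\<Sum>k=1..\<beta> j. \<Sum>i<N. y ((\<beta>(j := \<beta> j - k))(i := (\<beta>(j := \<beta> j - k)) i + k)))"
      by (subst sum.If_cases) simp_all
  qed
  also have "\<dots> = (\<Sum>j<N. \<Sum>i<N. ?g i j)"
    by (intro sum.cong[OF refl] sum.swap)
  also have "\<dots> = (\<Sum>j<N. ?g j j + (\<Sum>i\<in>{..<N}-{j}. ?g i j))"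
    by (intro sum.cong[OF refl]) (simp add: sum.remove)
  also have "\<dots> = (\<Sum>j<N. ?g j j) + (\<Sum>j<N. \<Sum>i\<in>{..<N}-{j}. ?g i j)"
    by (rule sum.distrib)
  also have "(\<Sum>j<N. ?g j j) = of_nat (n + stair N) * y \<beta>"
  proof -
    have "?g j j = of_nat (\<beta> j) * y \<beta>" for j
    proof -
      have "?g j j = (\<Sum>k=1..\<beta> j. y \<beta>)" by (intro sum.cong) auto
      then show ?thesis by simp
    qed
    then show ?thesis by (simp flip: sum_distrib_right of_nat_sum add: deg)
  qed
  also have "(\<Sum>j<N. \<Sum>i\<in>{..<N}-{j}. ?g i j) = - of_nat (stair N) * y \<beta>"
  proof -
    let ?S = "\<Sum>j<N. \<Sum>i\<in>{..<N}-{j}. ?g i j"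
    have "?S = (\<Sum>j<N. \<Sum>i<N. if i = j then 0 else ?g i j)"
    proof (rule sum.cong[OF refl])
      fix j assume "j \<in> {..<N}"
      then show "(\<Sum>i\<in>{..<N}-{j}. ?g i j) = (\<Sum>i<N. if i = j then 0 else ?g i j)"
        by (simp only: sum.remove[of "{..<N}" j "\<lambda>i. if i = j then 0 else ?g i j"] finite_lessThan) simp
    qed
    moreover have "(\<Sum>j<N. \<Sum>i<N. if i = j then 0 else ?g i j) = (\<Sum>j<N. \<Sum>i<N. if i = j then 0 else ?g j i)"
      by (subst sum.swap, intro sum.cong refl if_cong) (rule eq_commute)
    ultimately have "2 * ?S = (\<Sum>j<N. \<Sum>i<N. (if i = j then 0 else ?g i j) + (if i = j then 0 else ?g j i))"
      unfolding sum.distrib mult_2 by argo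
    also have "\<dots> = (\<Sum>j<N. \<Sum>i<N. if i = j then 0 else - y \<beta>)"
    proof (intro sum.cong[OF refl])
      fix i j assume "j \<in> {..<N}" "i \<in> {..<N}"
      then show "(if i = j then 0 else ?g i j) + (if i = j then 0 else ?g j i) = (if i = j then 0 else - y \<beta>)"
        using pair_transfer[OF y, of i j \<beta>] by simp
    qed
    also have "\<dots> = (\<Sum>j<N. - of_nat (N - 1) * y \<beta>)"
    proof (rule sum.cong[OF refl])
      fix j assume j: "j \<in> {..<N}"
      have "(\<Sum>i<N. if i = j then 0 else - y \<beta>) = (\<Sum>i\<in>{..<N}-{j}. - y \<beta>)"
        using j by (simp add: sum.remove)
      then show "(\<Sum>i<N. if i = j then 0 else - y \<beta>) = - of_nat (N - 1) * y \<beta>"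
        using j by (simp add: algebra_simps)
    qed
    also have "\<dots> = - of_nat (N * (N - 1)) * y \<beta>"
      unfolding sum_constant card_lessThan of_nat_mult by (simp only: mult_minus_left mult_minus_right mult.assoc)
    also have "\<dots> = 2 * (- of_nat (stair N) * y \<beta>)"
      unfolding stair_eq[symmetric] of_nat_mult by simp
    finally show ?thesis by simp
  qed
  finally show ?thesis by (simp add: algebra_simps)
qed

lemma up_down_adjoint:
  "(\<Sum>\<beta>\<in>vecs N (M + l). y \<beta> * down N (\<lambda>_. True) l z \<beta>) = (\<Sum>\<gamma>\<in>vecs N M. up N l y \<gamma> * z \<gamma>)"
proof -
  have "(\<Sum>\<beta>\<in>vecs N (M + l). y \<beta> * down N (\<lambda>_. True) l z \<beta>)
      = (\<Sum>j<N. \<Sum>\<beta>\<in>vecs N (M + l). if l \<le> \<beta> j then y \<beta> * z (\<beta>(j := \<beta> j - l)) else 0)"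
    unfolding down_def sum_distrib_left by (subst sum.swap) (intro sum.cong refl, simp)
  also have "\<dots> = (\<Sum>j<N. \<Sum>\<beta> | \<beta> \<in> vecs N (M + l) \<and> l \<le> \<beta> j. y \<beta> * z (\<beta>(j := \<beta> j - l)))"
    by (intro sum.cong[OF refl]) (simp add: sum.If_cases Int_def)
  also have "\<dots> = (\<Sum>j<N. \<Sum>\<gamma>\<in>vecs N M. y (\<gamma>(j := \<gamma> j + l)) * z \<gamma>)"
    by (intro sum.cong[OF refl]) (subst sum_weak_comps_part, simp_all)
  also have "\<dots> = (\<Sum>\<gamma>\<in>vecs N M. up N l y \<gamma> * z \<gamma>)"
    unfolding up_def sum_distrib_right by (rule sum.swap)
  finally show ?thesis .
qed

section \<open>Cauchy's identity\<close>

text \<open>The alternating function with value \<open>1\<close> at \<open>\<gamma>\<close> that is supported on the rearrangements of \<open>\<gamma>\<close>; it is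
  zero if \<open>\<gamma>\<close> has a repeated entry.\<close>

definition alt_delta :: "nat \<Rightarrow> (nat \<Rightarrow> nat) \<Rightarrow> (nat \<Rightarrow> nat) \<Rightarrow> complex" where
  "alt_delta N \<gamma> \<beta> = (\<Sum>w | w permutes {..<N}. of_int (sign w) * (if \<beta> = \<gamma> \<circ> w then 1 else 0))"

definition staircase :: "nat \<Rightarrow> nat \<Rightarrow> nat" where
  "staircase N i = N - 1 - i"

text \<open>The coefficient of \<open>x\<^sup>\<beta>\<close> in \<open>x\<^sup>c a\<^sub>\<delta>\<close>, for the Vandermonde determinant
  \<open>a\<^sub>\<delta> = \<Sum>\<^sub>w sgn w x\<^bsup>\<delta> w\<^esup>\<close>.\<close>

definition frob_coeff :: "nat \<Rightarrow> (nat \<Rightarrow> nat) \<Rightarrow> (nat \<Rightarrow> nat) \<Rightarrow> complex" where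
  "frob_coeff N c \<beta> = (\<Sum>w | w permutes {..<N}.
     of_int (sign w) * (if \<beta> = (\<lambda>i. c i + staircase N (w i)) then 1 else 0))"

definition strict_dec :: "nat \<Rightarrow> (nat \<Rightarrow> nat) \<Rightarrow> bool" where
  "strict_dec N \<beta> \<longleftrightarrow> (\<forall>i j. i < j \<longrightarrow> j < N \<longrightarrow> \<beta> j < \<beta> i)"

lemma finite_perms [simp]: "finite {w. w permutes {..<N::nat}}"
  by (rule finite_permutations) simp

lemma sign_comp_perms:
  "w permutes {..<N::nat} \<Longrightarrow> v permutes {..<N} \<Longrightarrow> sign (w \<circ> v) = sign w * sign v"
  by (rule sign_compose) (auto simp: permutation_permutes)

lemma sign_sq_complex [simp]: "complex_of_int (sign w) * complex_of_int (sign w) = 1"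
  by (simp add: sign_def)

lemma comp_perm_cancel: "v permutes S \<Longrightarrow> f \<circ> v = g \<circ> v \<longleftrightarrow> f = g"
  by (metis comp_id o_assoc permutes_inv_o(1))

lemma alternating_alt_delta: "alternating N (alt_delta N \<gamma>)"
  unfolding alternating_def
proof (intro allI impI)
  fix v :: "nat \<Rightarrow> nat" and \<beta> assume v: "v permutes {..<N}"
  have "alt_delta N \<gamma> (\<beta> \<circ> v)
      = (\<Sum>w | w permutes {..<N}. of_int (sign (w \<circ> v)) * (if \<beta> \<circ> v = \<gamma> \<circ> (w \<circ> v) then 1 else 0))"
    unfolding alt_delta_def by (rule sum_permutations_compose_right[OF v])
  also have "\<dots> = of_int (sign v) * alt_delta N \<gamma> \<beta>"
    unfolding alt_delta_def sum_distrib_left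
    by (intro sum.cong refl) (simp add: o_assoc comp_perm_cancel[OF v] sign_comp_perms v)
  finally show "alt_delta N \<gamma> (\<beta> \<circ> v) = of_int (sign v) * alt_delta N \<gamma> \<beta>" .
qed

lemma alt_delta_comp_left:
  assumes v: "v permutes {..<N}"
  shows "alt_delta N (\<gamma> \<circ> v) \<beta> = of_int (sign v) * alt_delta N \<gamma> \<beta>"
proof -
  have "alt_delta N \<gamma> \<beta>
      = (\<Sum>w | w permutes {..<N}. of_int (sign (v \<circ> w)) * (if \<beta> = \<gamma> \<circ> (v \<circ> w) then 1 else 0))"
    unfolding alt_delta_def by (rule setum_permutations_compose_left[OF v])
  also have "\<dots> = of_int (sign v) * alt_delta N (\<gamma> \<circ> v) \<beta>"
    unfolding alt_delta_def sum_distrib_left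
    by (intro sum.cong refl) (simp add: o_assoc sign_comp_perms[OF v])
  finally show ?thesis
    by (simp flip: mult.assoc)
qed

text \<open>A permutation that carries a strictly decreasing vector to a strictly decreasing one is increasing.\<close>

lemma alt_delta_same_dec:
  assumes "strict_dec N \<beta>" "strict_dec N \<gamma>"
  shows "alt_delta N \<gamma> \<beta> = (if \<beta> = \<gamma> then 1 else 0)"
proof -
  have "w = id" if w: "w permutes {..<N}" "\<beta> = \<gamma> \<circ> w" for w
  proof -
    have mono: "w i < w j" if "i < j" "j < N" for i j
    proof (rule ccontr)
      assume "\<not> w i < w j"
      moreover have "w i \<noteq> w j" using permutes_inj[OF w(1)] that by (auto dest: injD)
      moreover have "w i < N" using permutes_in_image[OF w(1), of i] that by simp
      ultimately have "\<gamma> (w i) < \<gamma> (w j)" using assms(2) by (auto simp: strict_dec_def)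
      moreover have "\<beta> j < \<beta> i" using assms(1) that by (simp add: strict_dec_def)
      ultimately show False using w(2) by simp
    qed
    have "i \<le> w i" if "i < N" for i
      using that
    proof (induction i)
      case (Suc i)
      then show ?case using mono[of i "Suc i"] by simp
    qed simp
    then show "w = id" using permutes_natset_ge[OF w(1)] by blast
  qed
  then have "alt_delta N \<gamma> \<beta> = (\<Sum>w\<in>{id}. of_int (sign w) * (if \<beta> = \<gamma> \<circ> w then 1 else 0))"
    unfolding alt_delta_def by (intro sum.mono_neutral_right) (auto simp: permutes_id)
  then show ?thesis by simp
qed

lemma vecs_comp:
  assumes "w permutes {..<N}"
  shows "\<beta> \<circ> w \<in> vecs N M \<longleftrightarrow> \<beta> \<in> vecs N M"
proof -
  have "(\<forall>i. i \<notin> {..<N} \<longrightarrow> (\<beta> \<circ> w) i = 0) \<longleftrightarrow> (\<forall>i. i \<notin> {..<N} \<longrightarrow> \<beta> i = 0)"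
    using permutes_not_in[OF assms] by auto
  moreover have "sum (\<beta> \<circ> w) {..<N} = sum \<beta> {..<N}"
    using sum.reindex_bij_betw[OF permutes_imp_bij[OF assms], of \<beta>] by simp
  ultimately show ?thesis by (simp add: weak_comps_def)
qed

text \<open>Each of the \<open>N!\<close> permutations of \<open>\<gamma>\<close> contributes \<open>y \<gamma>\<close>, since the two signs cancel.\<close>

lemma sum_alt_delta:
  assumes y: "alternating N y" and \<gamma>: "\<gamma> \<in> vecs N M"
  shows "(\<Sum>\<beta>\<in>vecs N M. alt_delta N \<gamma> \<beta> * y \<beta>) = fact N * y \<gamma>"
proof -
  have "(\<Sum>\<beta>\<in>vecs N M. alt_delta N \<gamma> \<beta> * y \<beta>)
     = (\<Sum>w | w permutes {..<N}. \<Sum>\<beta>\<in>vecs N M. of_int (sign w) * (if \<beta> = \<gamma> \<circ> w then 1 else 0) * y \<beta>)"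
    unfolding alt_delta_def sum_distrib_right by (rule sum.swap)
  also have "\<dots> = (\<Sum>w | w permutes {..<N}. y \<gamma>)"
  proof (intro sum.cong[OF refl])
    fix w assume "w \<in> {w. w permutes {..<N}}"
    then have w: "w permutes {..<N}" by simp
    have "(\<Sum>\<beta>\<in>vecs N M. of_int (sign w) * (if \<beta> = \<gamma> \<circ> w then 1 else 0) * y \<beta>)
        = (\<Sum>\<beta>\<in>vecs N M. if \<beta> = \<gamma> \<circ> w then of_int (sign w) * y (\<gamma> \<circ> w) else 0)"
      by (intro sum.cong) auto
    also have "\<dots> = of_int (sign w) * y (\<gamma> \<circ> w)"
      using \<gamma> by (subst sum.delta) (auto simp: vecs_comp[OF w])
    also have "\<dots> = y \<gamma>"
      unfolding alternatingD[OF y w] by (simp flip: mult.assoc)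
    finally show "(\<Sum>\<beta>\<in>vecs N M. of_int (sign w) * (if \<beta> = \<gamma> \<circ> w then 1 else 0) * y \<beta>) = y \<gamma>" .
  qed
  also have "\<dots> = fact N * y \<gamma>"
    by (simp add: card_permutations)
  finally show ?thesis .
qed

lemma frob_coeff_shift:
  "frob_coeff N (c(j := c j + l)) \<beta> = (if l \<le> \<beta> j then frob_coeff N c (\<beta>(j := \<beta> j - l)) else 0)"
proof -
  have "\<beta> = (\<lambda>i. (c(j := c j + l)) i + staircase N (w i)) \<longleftrightarrow>
     l \<le> \<beta> j \<and> \<beta>(j := \<beta> j - l) = (\<lambda>i. c i + staircase N (w i))" for w
    by (auto simp: fun_eq_iff)
  then show ?thesis by (simp add: frob_coeff_def)
qed

lemma frob_coeff_comp:
  assumes v: "v permutes {..<N}"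
  shows "frob_coeff N (c \<circ> v) (\<beta> \<circ> v) = of_int (sign v) * frob_coeff N c \<beta>"
proof -
  have "frob_coeff N (c \<circ> v) (\<beta> \<circ> v) = (\<Sum>w | w permutes {..<N}.
     of_int (sign (w \<circ> v)) * (if \<beta> \<circ> v = (\<lambda>i. (c \<circ> v) i + staircase N ((w \<circ> v) i)) then 1 else 0))"
    unfolding frob_coeff_def by (rule sum_permutations_compose_right[OF v])
  also have "\<dots> = of_int (sign v) * frob_coeff N c \<beta>"
  proof -
    have "\<beta> \<circ> v = (\<lambda>i. (c \<circ> v) i + staircase N ((w \<circ> v) i)) \<longleftrightarrow> \<beta> = (\<lambda>i. c i + staircase N (w i))" for w
      using comp_perm_cancel[OF v, of \<beta> "\<lambda>i. c i + staircase N (w i)"] by (simp add: comp_def)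
    then show ?thesis
      unfolding frob_coeff_def sum_distrib_left by (intro sum.cong refl) (simp add: sign_comp_perms v)
  qed
  finally show ?thesis .
qed

lemma frob_coeff_zero: "frob_coeff N (\<lambda>_. 0) = alt_delta N (staircase N)"
  by (simp add: fun_eq_iff frob_coeff_def alt_delta_def comp_def)

lemma alt_delta_shift:
  assumes \<beta>: "\<And>i. i \<ge> N \<Longrightarrow> \<beta> i = 0"
  shows "(\<Sum>j<N. if k \<le> \<gamma> j then alt_delta N (\<gamma>(j := \<gamma> j - k)) \<beta> else 0) = up N k (alt_delta N \<gamma>) \<beta>"
proof -
  have eq: "(k \<le> \<gamma> (w i) \<and> \<beta> = \<gamma>(w i := \<gamma> (w i) - k) \<circ> w) \<longleftrightarrow> \<beta>(i := \<beta> i + k) = \<gamma> \<circ> w"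
    if w: "w permutes {..<N}" for w i
    using permutes_inj[OF w] by (auto simp: fun_eq_iff inj_eq)
  have "(\<Sum>j<N. if k \<le> \<gamma> j then alt_delta N (\<gamma>(j := \<gamma> j - k)) \<beta> else 0)
     = (\<Sum>j<N. \<Sum>w | w permutes {..<N}. of_int (sign w) * (if k \<le> \<gamma> j \<and> \<beta> = \<gamma>(j := \<gamma> j - k) \<circ> w then 1 else 0))"
    by (intro sum.cong refl) (simp add: alt_delta_def)
  also have "\<dots> = (\<Sum>w | w permutes {..<N}. \<Sum>j<N. of_int (sign w) * (if k \<le> \<gamma> j \<and> \<beta> = \<gamma>(j := \<gamma> j - k) \<circ> w then 1 else 0))"
    by (rule sum.swap)
  also have "\<dots> = (\<Sum>w | w permutes {..<N}. \<Sum>i<N. of_int (sign w) * (if \<beta>(i := \<beta> i + k) = \<gamma> \<circ> w then 1 else 0))"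
  proof (rule sum.cong[OF refl])
    fix w assume "w \<in> {w. w permutes {..<N}}"
    then have w: "w permutes {..<N}" by simp
    show "(\<Sum>j<N. of_int (sign w) * (if k \<le> \<gamma> j \<and> \<beta> = \<gamma>(j := \<gamma> j - k) \<circ> w then 1 else 0))
       = (\<Sum>i<N. of_int (sign w) * (if \<beta>(i := \<beta> i + k) = \<gamma> \<circ> w then 1 else 0 :: complex))"
      unfolding eq[OF w, symmetric]
      by (rule sum.reindex_bij_betw[OF permutes_imp_bij[OF w], symmetric])
  qed
  also have "\<dots> = up N k (alt_delta N \<gamma>) \<beta>"
    unfolding up_def alt_delta_def by (rule sum.swap)
  finally show ?thesis .
qed

lemma sum_staircase: "sum (staircase N) {..<N} = stair N"
  using sum.nat_diff_reindex[of "\<lambda>i. i" N] by (simp add: staircase_def[abs_def] stair_def)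

lemma staircase_in: "staircase N \<in> vecs N (stair N)"
  by (auto simp: weak_comps_def sum_staircase) (simp add: staircase_def)

lemma strict_dec_staircase: "strict_dec N (staircase N)"
  by (auto simp: strict_dec_def staircase_def)

text \<open>A vector of minimal degree with distinct entries has no gaps.\<close>

lemma inj_minimal_vec:
  assumes inj: "inj_on \<beta> {..<N}" and \<beta>: "\<beta> \<in> vecs N (stair N)"
  obtains u where "u permutes {..<N}" "\<beta> = staircase N \<circ> u"
proof -
  have "{..<N} \<subseteq> \<beta> ` {..<N}"
    using vec_initial_segment[OF inj, of 0] \<beta> by (fastforce simp: weak_comps_def)
  then have im: "\<beta> ` {..<N} = {..<N}"
    by (metis card_image card_subset_eq finite_imageI finite_lessThan inj)
  define u where "u i = (if i < N then N - 1 - \<beta> i else i)" for i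
  have lt: "\<beta> i < N" if "i < N" for i using im that by blast
  have "inj_on u {..<N}"
  proof (rule inj_onI)
    fix i j assume "i \<in> {..<N}" "j \<in> {..<N}" "u i = u j"
    then show "i = j" using lt[of i] lt[of j] inj by (auto simp: u_def inj_on_def)
  qed
  moreover have "u ` {..<N} \<subseteq> {..<N}" unfolding u_def by fastforce
  ultimately have "bij_betw u {..<N} {..<N}"
    unfolding bij_betw_def using endo_inj_surj[OF finite_lessThan] by blast
  then have "u permutes {..<N}"
    by (rule bij_imp_permutes) (simp add: u_def)
  moreover have "\<beta> = staircase N \<circ> u"
  proof
    fix i show "\<beta> i = (staircase N \<circ> u) i"
      using lt[of i] \<beta> by (cases "i < N") (auto simp: u_def staircase_def weak_comps_def)
  qed
  ultimately show thesis by (rule that)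
qed

definition row_sum :: "nat \<Rightarrow> (nat \<times> nat \<Rightarrow> nat) \<Rightarrow> nat \<Rightarrow> nat" where
  "row_sum N A i = (\<Sum>j<N. A (i, j))"

definition col_sum :: "nat \<Rightarrow> (nat \<times> nat \<Rightarrow> nat) \<Rightarrow> nat \<Rightarrow> nat" where
  "col_sum N A j = (\<Sum>i<N. A (i, j))"

lemma row_sum_upd: "j < N \<Longrightarrow> row_sum N (A((i, j) := A (i, j) + k)) = (row_sum N A)(i := row_sum N A i + k)"
proof
  fix i' assume "j < N"
  then show "row_sum N (A((i, j) := A (i, j) + k)) i' = ((row_sum N A)(i := row_sum N A i + k)) i'"
    using sum_fun_upd_add[of "{..<N}" j "\<lambda>j. A (i, j)" k]
    by (auto simp: row_sum_def fun_upd_def cong: if_cong)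
qed

lemma col_sum_upd: "i < N \<Longrightarrow> col_sum N (A((i, j) := A (i, j) + k)) = (col_sum N A)(j := col_sum N A j + k)"
proof
  fix j' assume "i < N"
  then show "col_sum N (A((i, j) := A (i, j) + k)) j' = ((col_sum N A)(j := col_sum N A j + k)) j'"
    using sum_fun_upd_add[of "{..<N}" i "\<lambda>i. A (i, j)" k]
    by (auto simp: col_sum_def fun_upd_def cong: if_cong)
qed

text \<open>Cauchy's identity \<open>a\<^sub>\<delta>(x) a\<^sub>\<delta>(y) \<Prod> 1/(1 - x\<^sub>i y\<^sub>j) = \<Sum>\<^sub>\<lambda> a\<^bsub>\<lambda>+\<delta>\<^esub>(x) a\<^bsub>\<lambda>+\<delta>\<^esub>(y)\<close>, coefficient by
  coefficient: \<open>n\<close> times the degree \<open>n\<close> part of the product is expanded by Newton's identity for the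
  variables \<open>x\<^sub>i y\<^sub>j\<close>, and the right-hand side satisfies the same recursion because \<open>\<Sum>\<^sub>k D\<^sub>k U\<^sub>k\<close> is
  multiplication by the degree.\<close>

lemma cauchy_matrices:
  assumes "\<beta> \<in> vecs N (n + stair N)" "\<gamma> \<in> vecs N (n + stair N)"
  shows "(\<Sum>A\<in>weak_comps ({..<N} \<times> {..<N}) n. frob_coeff N (row_sum N A) \<beta> * frob_coeff N (col_sum N A) \<gamma>)
       = alt_delta N \<gamma> \<beta>"
  using assms
proof (induction n arbitrary: \<beta> \<gamma> rule: less_induct)
  case (less n)
  let ?I = "{..<N} \<times> {..<N}"
  let ?F = "\<lambda>\<beta> \<gamma> A. frob_coeff N (row_sum N A) \<beta> * frob_coeff N (col_sum N A) \<gamma>"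
  show ?case
  proof (cases "n = 0")
    case True
    have "weak_comps ?I 0 = {\<lambda>_. 0}"
    proof (intro equalityI subsetI)
      fix A assume "A \<in> weak_comps ?I 0"
      then have "A x = 0" for x
        by (cases x; cases "x \<in> ?I") (auto simp: weak_comps_def)
      then show "A \<in> {\<lambda>_. 0}" by auto
    qed (auto simp: weak_comps_def)
    then have *: "(\<Sum>A\<in>weak_comps ?I n. ?F \<beta> \<gamma> A) = alt_delta N (staircase N) \<beta> * alt_delta N (staircase N) \<gamma>"
      using True by (simp add: row_sum_def[abs_def] col_sum_def[abs_def] frob_coeff_zero)
    show ?thesis
    proof (cases "inj_on \<beta> {..<N} \<and> inj_on \<gamma> {..<N}")
      case inj: True
      obtain u v where u: "u permutes {..<N}" "\<beta> = staircase N \<circ> u"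
        and v: "v permutes {..<N}" "\<gamma> = staircase N \<circ> v"
        using inj less.prems True by (metis add_0 inj_minimal_vec)
      show ?thesis
        unfolding *
        unfolding u(2) v(2) alternatingD[OF alternating_alt_delta u(1)]
          alternatingD[OF alternating_alt_delta v(1)] alt_delta_comp_left[OF v(1)]
        by (simp add: alt_delta_same_dec strict_dec_staircase)
    next
      case False
      have "alt_delta N \<gamma> \<beta> = 0" if "\<not> inj_on \<gamma> {..<N}"
        by (rule alternating_not_inj[OF _ that, of "\<lambda>\<gamma>. alt_delta N \<gamma> \<beta>"])
          (simp add: alternating_def alt_delta_comp_left)
      then show ?thesis
        using False unfolding * by (auto simp: alternating_not_inj[OF alternating_alt_delta])
    qed
  next
    case False
    have sums: "sum \<beta> {..<N} = n + stair N" "sum \<gamma> {..<N} = n + stair N"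
      and zero: "\<And>i. i \<ge> N \<Longrightarrow> \<beta> i = 0"
      using less.prems by (auto simp: weak_comps_def)
    have upd: "\<beta>(i := \<beta> i - k) \<in> vecs N ((n - k) + stair N)"
      if "\<beta> \<in> vecs N (n + stair N)" "i < N" "k \<le> \<beta> i" "k \<le> n" for \<beta> i k
      using that sum_fun_upd_diff[of "{..<N}" i k \<beta>] by (auto simp: weak_comps_def)
    have "of_nat n * (\<Sum>A\<in>weak_comps ?I n. ?F \<beta> \<gamma> A)
        = (\<Sum>k=1..n. \<Sum>x\<in>?I. \<Sum>A\<in>weak_comps ?I (n - k). ?F \<beta> \<gamma> (A(x := A x + k)))"
      by (rule newton_weak_comps) simp
    also have "\<dots> = (\<Sum>k=1..n. \<Sum>i<N. \<Sum>j<N. \<Sum>A\<in>weak_comps ?I (n - k). ?F \<beta> \<gamma> (A((i,j) := A (i,j) + k)))"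
      by (simp only: sum.cartesian_product')
    also have "\<dots> = (\<Sum>k=1..n. \<Sum>i<N. \<Sum>j<N. if k \<le> \<beta> i then
        if k \<le> \<gamma> j then alt_delta N (\<gamma>(j := \<gamma> j - k)) (\<beta>(i := \<beta> i - k)) else 0 else 0)"
    proof (intro sum.cong[OF refl])
      fix k i j assume k: "k \<in> {1..n}" and i: "i \<in> {..<N}" and j: "j \<in> {..<N}"
      then have ij: "i < N" "j < N" "k \<le> n" "n - k < n" by auto
      show "(\<Sum>A\<in>weak_comps ?I (n - k). ?F \<beta> \<gamma> (A((i,j) := A (i,j) + k)))
         = (if k \<le> \<beta> i then if k \<le> \<gamma> j then alt_delta N (\<gamma>(j := \<gamma> j - k)) (\<beta>(i := \<beta> i - k)) else 0 else 0)"
        unfolding row_sum_upd[OF ij(2)] col_sum_upd[OF ij(1)] frob_coeff_shift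
      proof (cases "k \<le> \<beta> i \<and> k \<le> \<gamma> j")
        case True
        then have "\<beta>(i := \<beta> i - k) \<in> vecs N (n - k + stair N)" "\<gamma>(j := \<gamma> j - k) \<in> vecs N (n - k + stair N)"
          using upd less.prems ij by blast+
        from less.IH[OF ij(4) this] True
        show "(\<Sum>A\<in>weak_comps ?I (n - k). (if k \<le> \<beta> i then frob_coeff N (row_sum N A) (\<beta>(i := \<beta> i - k)) else 0)
            * (if k \<le> \<gamma> j then frob_coeff N (col_sum N A) (\<gamma>(j := \<gamma> j - k)) else 0))
          = (if k \<le> \<beta> i then if k \<le> \<gamma> j then alt_delta N (\<gamma>(j := \<gamma> j - k)) (\<beta>(i := \<beta> i - k)) else 0 else 0)"
          by (simp only: simp_thms if_True)
      qed auto
    qed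
    also have "\<dots> = (\<Sum>k=1..n. down N (\<lambda>_. True) k (up N k (alt_delta N \<gamma>)) \<beta>)"
    proof (intro sum.cong[OF refl])
      fix k assume "k \<in> {1..n}"
      show "(\<Sum>i<N. \<Sum>j<N. if k \<le> \<beta> i then
        if k \<le> \<gamma> j then alt_delta N (\<gamma>(j := \<gamma> j - k)) (\<beta>(i := \<beta> i - k)) else 0 else 0)
        = down N (\<lambda>_. True) k (up N k (alt_delta N \<gamma>)) \<beta>"
        unfolding down_def
      proof (intro sum.cong[OF refl])
        fix i assume "i \<in> {..<N}"
        then have "(\<Sum>j<N. if k \<le> \<gamma> j then alt_delta N (\<gamma>(j := \<gamma> j - k)) (\<beta>(i := \<beta> i - k)) else 0)
           = up N k (alt_delta N \<gamma>) (\<beta>(i := \<beta> i - k))"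
          by (intro alt_delta_shift) (use zero in auto)
        then show "(\<Sum>j<N. if k \<le> \<beta> i then
            if k \<le> \<gamma> j then alt_delta N (\<gamma>(j := \<gamma> j - k)) (\<beta>(i := \<beta> i - k)) else 0 else 0)
          = (if k \<le> \<beta> i \<and> True then up N k (alt_delta N \<gamma>) (\<beta>(i := \<beta> i - k)) else 0)"
          by simp
      qed
    qed
    \<comment> \<open>for \<open>k > n\<close> the vector is lowered to a degree below \<open>stair N\<close>, where alternating functions vanish\<close>
    also have "\<dots> = (\<Sum>k=1..n + stair N. down N (\<lambda>_. True) k (up N k (alt_delta N \<gamma>)) \<beta>)"
    proof (intro sum.mono_neutral_left ballI)
      fix k assume k: "k \<in> {1..n + stair N} - {1..n}"
      have "up N k (alt_delta N \<gamma>) (\<beta>(i := \<beta> i - k)) = 0" if "i < N" "k \<le> \<beta> i" for i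
        using sum_fun_upd_diff[of "{..<N}" i k \<beta>] sums that k
        by (intro alternating_low[OF alternating_up[OF alternating_alt_delta]]) auto
      then show "down N (\<lambda>_. True) k (up N k (alt_delta N \<gamma>)) \<beta> = 0"
        unfolding down_def by (intro sum.neutral) auto
    qed auto
    also have "\<dots> = of_nat n * alt_delta N \<gamma> \<beta>"
      by (rule energy[OF alternating_alt_delta sums(1)])
        (use weak_comps_le[OF _ less.prems(1)] in auto)
    finally show ?thesis using False by simp
  qed
qed

section \<open>Invariant colourings and the determinantal class functions\<close>

text \<open>If \<open>f\<close> is a word over the variables, this is the exponent of the \<open>k\<close>-th variable in its monomial.\<close>

definition content :: "'x set \<Rightarrow> ('x \<Rightarrow> 'k) \<Rightarrow> 'k \<Rightarrow> nat" where
  "content X f k = card {x\<in>X. f x = k}"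

definition colourings :: "nat \<Rightarrow> 'x set \<Rightarrow> ('x \<Rightarrow> 'x) \<Rightarrow> ('x \<Rightarrow> nat) set" where
  "colourings N X g = {f \<in> X \<rightarrow>\<^sub>E {..<N}. \<forall>x\<in>X. f (g x) = f x}"

text \<open>The sum of the monomials of all invariant colourings is the product of the power sums \<open>p\<^sub>l\<close> over the
  cycle lengths \<open>l\<close> of \<open>g\<close> on \<open>X\<close>, so \<open>Psi N X g \<beta>\<close> is the coefficient of \<open>x\<^sup>\<beta>\<close> in \<open>a\<^sub>\<delta> \<Prod> p\<^sub>l\<close>, as in
  Frobenius' character formula.\<close>

definition Psi :: "nat \<Rightarrow> 'x set \<Rightarrow> ('x \<Rightarrow> 'x) \<Rightarrow> (nat \<Rightarrow> nat) \<Rightarrow> complex" where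
  "Psi N X g \<beta> = (\<Sum>f\<in>colourings N X g. frob_coeff N (content X f) \<beta>)"

lemma finite_colourings [simp]: "finite X \<Longrightarrow> finite (colourings N X g)"
  unfolding colourings_def by (rule finite_subset[OF _ finite_PiE[of X "\<lambda>_. {..<N}"]]) auto

lemma restrict_comp_colouring:
  assumes "v permutes {..<N}" "g ` X \<subseteq> X" "f \<in> colourings N X g"
  shows "restrict (v \<circ> f) X \<in> colourings N X g"
  unfolding colourings_def
proof (intro CollectI conjI ballI)
  have "f x < N" if "x \<in> X" for x using that assms(3) by (auto simp: colourings_def)
  then show "restrict (v \<circ> f) X \<in> X \<rightarrow>\<^sub>E {..<N}"
    using permutes_in_image[OF assms(1)] by auto
  fix x assume "x \<in> X"
  then show "restrict (v \<circ> f) X (g x) = restrict (v \<circ> f) X x"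
    using assms by (auto simp: colourings_def image_subset_iff)
qed

lemma alternating_Psi:
  assumes g: "g ` X \<subseteq> X"
  shows "alternating N (Psi N X g)"
  unfolding alternating_def
proof (intro allI impI)
  fix v :: "nat \<Rightarrow> nat" and \<beta> assume v: "v permutes {..<N}"
  have content: "content X (restrict (v \<circ> f) X) \<circ> v = content X f" for f :: "'a \<Rightarrow> nat"
    using permutes_inj[OF v] by (auto simp: content_def fun_eq_iff inj_eq intro!: arg_cong[where f = card])
  have "of_int (sign v) * Psi N X g \<beta> = (\<Sum>f\<in>colourings N X g. frob_coeff N (content X f \<circ> v) (\<beta> \<circ> v))"
    unfolding Psi_def sum_distrib_left frob_coeff_comp[OF v] ..
  also have "\<dots> = (\<Sum>f\<in>colourings N X g. frob_coeff N (content X f) (\<beta> \<circ> v))"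
  proof (rule sum.reindex_bij_witness[where i = "\<lambda>f. restrict (v \<circ> f) X" and j = "\<lambda>f. restrict (inv_into UNIV v \<circ> f) X"])
    fix f assume f: "f \<in> colourings N X g"
    then have out: "f x = undefined" if "x \<notin> X" for x
      using that by (auto simp: colourings_def)
    show *: "restrict (v \<circ> restrict (inv_into UNIV v \<circ> f) X) X = f" "restrict (inv_into UNIV v \<circ> restrict (v \<circ> f) X) X = f"
      by (auto simp: fun_eq_iff permutes_inverses[OF v] out)
    show "restrict (v \<circ> f) X \<in> colourings N X g" "restrict (inv_into UNIV v \<circ> f) X \<in> colourings N X g"
      using restrict_comp_colouring v permutes_inv g f by blast+
    show "frob_coeff N (content X (restrict (inv_into UNIV v \<circ> f) X)) (\<beta> \<circ> v) = frob_coeff N (content X f \<circ> v) (\<beta> \<circ> v)"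
      using content[of "restrict (inv_into UNIV v \<circ> f) X"] unfolding * by simp
  qed
  finally show "Psi N X g (\<beta> \<circ> v) = of_int (sign v) * Psi N X g \<beta>"
    by (simp add: Psi_def)
qed

text \<open>The permutation \<open>g\<close> may move points outside \<open>X\<close>, so that cycles can be removed from \<open>X\<close> one by one
  without changing \<open>g\<close>.\<close>

definition orbit_closed :: "('x \<Rightarrow> 'x) \<Rightarrow> 'x set \<Rightarrow> bool" where
  "orbit_closed g X \<longleftrightarrow> permutation g \<and> (\<forall>x\<in>X. orbit g x \<subseteq> X)"

lemma orbit_closed_image: "orbit_closed g X \<Longrightarrow> g ` X \<subseteq> X"
  by (auto simp: orbit_closed_def intro: orbit.base)

lemma orbit_closed_permutes:
  assumes "finite X" "g permutes X"
  shows "orbit_closed g X"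
  using assms permutes_orbit_subset[OF assms(2)]
  by (auto simp: orbit_closed_def permutation_permutes)

lemma orbit_eq_of_mem: "permutation g \<Longrightarrow> y \<in> orbit g x \<Longrightarrow> orbit g y = orbit g x"
  by (rule orbit_cyclic_eq3[OF cyclic_on_orbit'])

lemma orbit_closed_Diff:
  assumes "orbit_closed g X"
  shows "orbit_closed g (X - orbit g x)"
proof -
  have p: "permutation g" using assms by (simp add: orbit_closed_def)
  have "orbit g y \<inter> orbit g x = {}" if "y \<notin> orbit g x" for y
    using orbit_eq_of_mem[OF p] permutation_self_in_orbit[OF p, of y] that by blast
  then show ?thesis using assms by (auto simp: orbit_closed_def)
qed

lemma invariant_on_orbit:
  assumes "orbit_closed g X" "x \<in> X" "\<forall>z\<in>X. f (g z) = f z" "y \<in> orbit g x"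
  shows "f y = f x"
  using assms(4)
proof induction
  case base
  then show ?case using assms by simp
next
  case (step y)
  then have "y \<in> X" using assms by (auto simp: orbit_closed_def)
  then show ?case using step assms by simp
qed

text \<open>The rule of Murnaghan and Nakayama in its simplest form: an invariant colouring is constant on each
  cycle, so a cycle of length \<open>l\<close> contributes the factor \<open>p\<^sub>l\<close>.\<close>

lemma Psi_remove_orbit:
  assumes fin: "finite X" and oc: "orbit_closed g X" and x: "x \<in> X"
  shows "Psi N X g = down N (\<lambda>_. True) (card (orbit g x)) (Psi N (X - orbit g x) g)"
proof
  fix \<beta>
  let ?C = "orbit g x" and ?Y = "X - orbit g x"
  have p: "permutation g" and CX: "?C \<subseteq> X" using oc x by (auto simp: orbit_closed_def)
  have xC: "x \<in> ?C" by (rule permutation_self_in_orbit[OF p])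
  have gY: "g z \<in> ?Y" if "z \<in> ?Y" for z
    using orbit_closed_image[OF orbit_closed_Diff[OF oc]] that by blast
  have gC: "g z \<in> ?C" if "z \<in> ?C" for z using that by (rule orbit.step)
  have finC: "finite ?C" using fin CX finite_subset by blast
  have "Psi N X g \<beta> = (\<Sum>(j, f)\<in>{..<N} \<times> colourings N ?Y g.
      frob_coeff N ((content ?Y f)(j := content ?Y f j + card ?C)) \<beta>)"
    unfolding Psi_def
  proof (rule sum.reindex_bij_witness[where i = "\<lambda>(j, f). \<lambda>z. if z \<in> ?C then j else f z"
        and j = "\<lambda>f. (f x, restrict f ?Y)"])
    fix f assume f: "f \<in> colourings N X g"
    then have inv: "\<forall>z\<in>X. f (g z) = f z" and fN: "\<And>z. z \<in> X \<Longrightarrow> f z < N" and out: "\<And>z. z \<notin> X \<Longrightarrow> f z = undefined"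
      by (auto simp: colourings_def)
    have const: "f z = f x" if "z \<in> ?C" for z
      by (rule invariant_on_orbit[OF oc x inv that])
    show "(case (f x, restrict f ?Y) of (j, f) \<Rightarrow> \<lambda>z. if z \<in> ?C then j else f z) = f"
      using const out CX by (auto simp: fun_eq_iff)
    show "(f x, restrict f ?Y) \<in> {..<N} \<times> colourings N ?Y g"
      using fN x inv gY by (auto simp: colourings_def)
    have "content X f = (content ?Y (restrict f ?Y))(f x := content ?Y (restrict f ?Y) (f x) + card ?C)"
    proof
      fix k
      have "{z\<in>X. f z = k} = {z\<in>?Y. restrict f ?Y z = k} \<union> {z\<in>?C. f z = k}" using CX by auto
      moreover have "card ({z\<in>?Y. restrict f ?Y z = k} \<union> {z\<in>?C. f z = k})
        = card {z\<in>?Y. restrict f ?Y z = k} + card {z\<in>?C. f z = k}"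
        using fin finC by (intro card_Un_disjoint) auto
      moreover have "{z\<in>?C. f z = k} = (if k = f x then ?C else {})" using const by auto
      ultimately show "content X f k = ((content ?Y (restrict f ?Y))(f x := content ?Y (restrict f ?Y) (f x) + card ?C)) k"
        by (simp add: content_def)
    qed
    then show "(case (f x, restrict f ?Y) of (j, f) \<Rightarrow>
       frob_coeff N ((content ?Y f)(j := content ?Y f j + card ?C)) \<beta>) = frob_coeff N (content X f) \<beta>"
      by simp
  next
    fix jf assume jf: "jf \<in> {..<N} \<times> colourings N ?Y g"
    obtain j f where [simp]: "jf = (j, f)" by (cases jf)
    have j: "j < N" and f: "\<And>z. z \<in> ?Y \<Longrightarrow> f (g z) = f z" "\<And>z. z \<in> ?Y \<Longrightarrow> f z < N" "\<And>z. z \<notin> ?Y \<Longrightarrow> f z = undefined"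
      using jf by (auto simp: colourings_def)
    show "(\<lambda>f. (f x, restrict f ?Y)) (case jf of (j, f) \<Rightarrow> \<lambda>z. if z \<in> ?C then j else f z) = jf"
      using xC f by (auto simp: fun_eq_iff)
    show "(case jf of (j, f) \<Rightarrow> \<lambda>z. if z \<in> ?C then j else f z) \<in> colourings N X g"
      using j f gC gY CX by (auto simp: colourings_def)
  qed
  also have "\<dots> = (\<Sum>j<N. \<Sum>f\<in>colourings N ?Y g.
      frob_coeff N ((content ?Y f)(j := content ?Y f j + card ?C)) \<beta>)"
    by (rule sum.cartesian_product[symmetric])
  also have "\<dots> = down N (\<lambda>_. True) (card ?C) (Psi N ?Y g) \<beta>"
    unfolding down_def Psi_def frob_coeff_shift by (intro sum.cong refl) simp
  finally show "Psi N X g \<beta> = down N (\<lambda>_. True) (card ?C) (Psi N ?Y g) \<beta>" .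
qed

text \<open>By the Heisenberg relation \<open>U\<^sub>k\<close> commutes with the operators \<open>D\<^sub>l\<close> that build \<open>Psi\<close> from the vacuum,
  since no cycle has length \<open>l = k\<close>, and it kills the vacuum for reasons of degree.\<close>

lemma up_Psi_eq_0:
  assumes "finite X" "orbit_closed g X" "\<forall>x\<in>X. card (orbit g x) \<noteq> k" "1 \<le> k" "2 * card X \<le> N"
    "sum \<beta> {..<N} + k = card X + stair N"
  shows "up N k (Psi N X g) \<beta> = 0"
proof -
  \<comment> \<open>\<open>X\<close> shrinks in the induction; the bound on \<open>N\<close> is kept in terms of a fixed \<open>n\<close>\<close>
  have "up N k (Psi N X g) \<beta> = 0"
    if "card X \<le> n" "2 * n \<le> N" for n
    using assms that
  proof (induction "card X" arbitrary: X \<beta> rule: less_induct)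
    case less
    note alt = alternating_Psi[OF orbit_closed_image]
    show ?case
    proof (cases "sum \<beta> {..<N} < stair N")
      case True
      then show ?thesis
        by (rule alternating_low[OF alternating_up[OF alt[OF less.prems(2)]]])
    next
      case False
      then have "k \<le> card X" using less.prems by simp
      then obtain x where x: "x \<in> X" using less.prems by fastforce
      let ?C = "orbit g x" and ?Y = "X - orbit g x"
      have CX: "?C \<subseteq> X" using less.prems(2) x by (auto simp: orbit_closed_def)
      have xC: "x \<in> ?C" using less.prems(2) permutation_self_in_orbit by (auto simp: orbit_closed_def)
      have finC: "finite ?C" using CX less.prems finite_subset by blast
      have cardY: "card ?Y = card X - card ?C" using finC CX by (simp add: card_Diff_subset)
      have lC: "card ?C \<le> card X" using CX less.prems by (simp add: card_mono)
      have pos: "card ?C > 0" using xC finC card_gt_0_iff by blast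
      note ocY = orbit_closed_Diff[OF less.prems(2), of x]
      have "up N k (Psi N X g) \<beta> = up N k (down N (\<lambda>_. True) (card ?C) (Psi N ?Y g)) \<beta>"
        by (subst Psi_remove_orbit[OF less.prems(1,2) x]) (rule refl)
      also have "\<dots> = down N (\<lambda>_. True) (card ?C) (up N k (Psi N ?Y g)) \<beta>"
        using less.prems x \<open>k \<le> card X\<close> lC
        by (subst up_down_commute[OF alt[OF ocY], where m = n]) auto
      also have "\<dots> = 0"
        unfolding down_def
      proof (intro sum.neutral ballI)
        fix j assume j: "j \<in> {..<N}"
        have "up N k (Psi N ?Y g) (\<beta>(j := \<beta> j - card ?C)) = 0" if "card ?C \<le> \<beta> j"
        proof (rule less.hyps)
          show "card ?Y < card X" using cardY lC pos by simp
          show "sum (\<beta>(j := \<beta> j - card ?C)) {..<N} + k = card ?Y + stair N"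
            using sum_fun_upd_diff[of "{..<N}" j "card ?C" \<beta>] member_le_sum[of j "{..<N}" \<beta>] j that less.prems lC cardY by simp
        qed (use less.prems ocY cardY in auto)
        then show "(if card ?C \<le> \<beta> j \<and> True then up N k (Psi N ?Y g) (\<beta>(j := \<beta> j - card ?C)) else 0) = 0"
          by simp
      qed
      finally show ?thesis .
    qed
  qed
  from this[of "card X"] assms show ?thesis by simp
qed

text \<open>Move the operator \<open>D\<^sub>l\<close> that adds the cycle to the other side of the pairing.\<close>

lemma sum_Psi_orbit_eq_0:
  assumes fin: "finite X" and oc: "orbit_closed g X" and x: "x \<in> X"
    and y: "\<And>\<gamma>. \<gamma> \<in> vecs N M \<Longrightarrow> up N (card (orbit g x)) y \<gamma> = 0"
  shows "(\<Sum>\<beta>\<in>vecs N (M + card (orbit g x)). y \<beta> * Psi N X g \<beta>) = 0"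
  unfolding Psi_remove_orbit[OF fin oc x] up_down_adjoint using y by simp

lemma ex_content:
  assumes "finite K" "finite X" "A \<in> weak_comps K (card X)"
  shows "\<exists>h\<in>X \<rightarrow>\<^sub>E K. content X h = A"
proof -
  have "card (SIGMA k:K. {..<A k}) = card X"
    using assms by (simp add: weak_comps_def)
  then obtain b where b: "bij_betw b X (SIGMA k:K. {..<A k})"
    using finite_same_card_bij[of X "SIGMA k:K. {..<A k}"] assms(1,2) by (auto simp: finite_SigmaI)
  have inj: "inj_on b X" and im: "b ` X = (SIGMA k:K. {..<A k})"
    using b by (auto simp: bij_betw_def)
  define h where "h = restrict (fst \<circ> b) X"
  have "content X h k = A k" for k
  proof (cases "k \<in> K")
    case True
    have "bij_betw b {x\<in>X. h x = k} ({k} \<times> {..<A k})"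
      unfolding bij_betw_def
    proof
      show "inj_on b {x\<in>X. h x = k}" by (rule inj_on_subset[OF inj]) auto
      have "b ` {x\<in>X. h x = k} = {z \<in> b ` X. fst z = k}" by (auto simp: h_def)
      then show "b ` {x\<in>X. h x = k} = {k} \<times> {..<A k}" using True by (auto simp: im)
    qed
    then show ?thesis unfolding content_def by (simp add: bij_betw_same_card card_cartesian_product)
  next
    case False
    then have "fst z \<noteq> k" if "z \<in> b ` X" for z using that unfolding im by auto
    then have "{x\<in>X. h x = k} = {}" by (auto simp: h_def)
    then have "content X h k = 0" unfolding content_def by (simp only: card.empty)
    then show ?thesis using False assms(3) by (simp add: weak_comps_def)
  qed
  then have "content X h = A" by (rule ext)
  moreover have "fst z \<in> K" if "z \<in> b ` X" for z using that unfolding im by auto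
  then have "h \<in> X \<rightarrow>\<^sub>E K" by (auto simp: h_def)
  ultimately show ?thesis by blast
qed

lemma content_in_weak_comps:
  assumes "finite K" "finite X" "h \<in> X \<rightarrow>\<^sub>E K"
  shows "content X h \<in> weak_comps K (card X)"
proof -
  have "(\<Sum>k\<in>K. card {x\<in>X. h x = k}) = card X"
    using sum.group[OF assms(2,1), of h "\<lambda>_. 1 :: nat"] assms(3) by auto
  then show ?thesis using assms by (auto simp: weak_comps_def content_def)
qed

lemma content_eq_imp_permutes:
  assumes "finite X" "content X h = content X h'"
  obtains \<sigma> where "\<sigma> permutes X" "\<forall>x\<in>X. h x = h' (\<sigma> x)"
proof -
  have "image_mset h (mset_set X) = image_mset h' (mset_set X)"
  proof (rule multiset_eqI)
    fix k
    have "card {x\<in>X. h x = k} = card {x\<in>X. h' x = k}"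
      using assms(2) by (auto simp: content_def fun_eq_iff)
    then show "count (image_mset h (mset_set X)) k = count (image_mset h' (mset_set X)) k"
      using assms(1) by (simp add: count_image_mset_eq_card_vimage)
  qed
  then show thesis using image_mset_eq_implies_permutes[OF assms(1)] that by blast
qed

text \<open>The colourings of given content form one orbit of the symmetric group, so the orders of their
  stabilisers add up to the order of the group.\<close>

lemma sum_stabilisers:
  fixes \<Phi> :: "('k \<Rightarrow> nat) \<Rightarrow> complex"
  assumes "finite K" "finite X"
  shows "(\<Sum>h\<in>X \<rightarrow>\<^sub>E K. of_nat (card {g. g permutes X \<and> (\<forall>x\<in>X. h (g x) = h x)}) * \<Phi> (content X h))
       = fact (card X) * (\<Sum>A\<in>weak_comps K (card X). \<Phi> A)"
proof -
  let ?st = "\<lambda>h. card {g. g permutes X \<and> (\<forall>x\<in>X. h (g x) = h x)}"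
  let ?E = "X \<rightarrow>\<^sub>E K"
  have finE: "finite ?E" using assms by (intro finite_PiE)
  have "(\<Sum>h | h \<in> ?E \<and> content X h = A. ?st h) = fact (card X)" if A: "A \<in> weak_comps K (card X)" for A
  proof -
    obtain h0 where h0: "h0 \<in> ?E" "content X h0 = A" using ex_content[OF assms A] by blast
    have "?st h = card {\<sigma>. \<sigma> permutes X \<and> restrict (h0 \<circ> \<sigma>) X = h}" if h: "h \<in> ?E" "content X h = A" for h
    proof -
      obtain \<sigma> where \<sigma>: "\<sigma> permutes X" "\<forall>x\<in>X. h x = h0 (\<sigma> x)"
        using content_eq_imp_permutes[OF assms(2), of h h0] h h0 by auto
      have in_X: "\<And>x. x \<in> X \<Longrightarrow> \<sigma> x \<in> X" "\<And>x. x \<in> X \<Longrightarrow> inv_into UNIV \<sigma> x \<in> X"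
        using permutes_in_image[OF \<sigma>(1)] permutes_in_image[OF permutes_inv[OF \<sigma>(1)]] by auto
      have "bij_betw (\<lambda>g. \<sigma> \<circ> g) {g. g permutes X \<and> (\<forall>x\<in>X. h (g x) = h x)}
          {\<tau>. \<tau> permutes X \<and> restrict (h0 \<circ> \<tau>) X = h}"
      proof (rule bij_betw_byWitness[where f' = "\<lambda>\<tau>. inv_into UNIV \<sigma> \<circ> \<tau>"])
        show "(\<lambda>g. \<sigma> \<circ> g) ` {g. g permutes X \<and> (\<forall>x\<in>X. h (g x) = h x)}
          \<subseteq> {\<tau>. \<tau> permutes X \<and> restrict (h0 \<circ> \<tau>) X = h}"
        proof (safe intro!: permutes_compose \<sigma>(1))
          fix g assume g: "g permutes X" "\<forall>x\<in>X. h (g x) = h x"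
          show "restrict (h0 \<circ> (\<sigma> \<circ> g)) X = h"
          proof
            fix x show "restrict (h0 \<circ> (\<sigma> \<circ> g)) X x = h x"
              using g h(1) \<sigma>(2) permutes_in_image[OF g(1), of x] by (cases "x \<in> X") (auto simp: PiE_def extensional_def)
          qed
        qed
        show "(\<lambda>\<tau>. inv_into UNIV \<sigma> \<circ> \<tau>) ` {\<tau>. \<tau> permutes X \<and> restrict (h0 \<circ> \<tau>) X = h}
          \<subseteq> {g. g permutes X \<and> (\<forall>x\<in>X. h (g x) = h x)}"
        proof (safe intro!: permutes_compose permutes_inv \<sigma>(1))
          fix \<tau> x assume t: "\<tau> permutes X" "h = restrict (h0 \<circ> \<tau>) X" "x \<in> X"
          have "\<tau> x \<in> X" using t(3) permutes_in_image[OF t(1)] by simp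
          then have "h (inv_into UNIV \<sigma> (\<tau> x)) = h0 (\<tau> x)"
            using in_X(2) \<sigma>(2) permutes_inverses(1)[OF \<sigma>(1)] by metis
          then show "restrict (h0 \<circ> \<tau>) X ((inv_into UNIV \<sigma> \<circ> \<tau>) x) = restrict (h0 \<circ> \<tau>) X x"
            using t by simp
        qed
      qed (auto simp: fun_eq_iff permutes_inverses[OF \<sigma>(1)])
      then show ?thesis by (rule bij_betw_same_card)
    qed
    then have "(\<Sum>h | h \<in> ?E \<and> content X h = A. ?st h)
      = (\<Sum>h | h \<in> ?E \<and> content X h = A. \<Sum>\<sigma> | \<sigma> \<in> {\<sigma>. \<sigma> permutes X} \<and> restrict (h0 \<circ> \<sigma>) X = h. 1)"
      by (intro sum.cong) auto
    also have "\<dots> = (\<Sum>\<sigma> | \<sigma> permutes X. 1)"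
    proof (rule sum.group)
      show "(\<lambda>\<sigma>. restrict (h0 \<circ> \<sigma>) X) ` {\<sigma>. \<sigma> permutes X} \<subseteq> {h \<in> ?E. content X h = A}"
      proof (intro image_subsetI CollectI conjI)
        fix \<sigma> assume "\<sigma> \<in> {\<sigma>. \<sigma> permutes X}"
        then have \<sigma>: "\<sigma> permutes X" by simp
        show "restrict (h0 \<circ> \<sigma>) X \<in> ?E" using h0(1) permutes_in_image[OF \<sigma>] by auto
        have "bij_betw \<sigma> {x\<in>X. h0 (\<sigma> x) = k} {x\<in>X. h0 x = k}" for k
          unfolding bij_betw_def
        proof
          show "inj_on \<sigma> {x\<in>X. h0 (\<sigma> x) = k}" using permutes_inj[OF \<sigma>] by (simp add: inj_on_def inj_def)
          have "\<sigma> ` {x\<in>X. h0 (\<sigma> x) = k} = {z \<in> \<sigma> ` X. h0 z = k}" by auto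
          then show "\<sigma> ` {x\<in>X. h0 (\<sigma> x) = k} = {x\<in>X. h0 x = k}"
            by (simp only: permutes_image[OF \<sigma>])
        qed
        then have "card {x\<in>X. h0 (\<sigma> x) = k} = card {x\<in>X. h0 x = k}" for k
          by (rule bij_betw_same_card)
        then show "content X (restrict (h0 \<circ> \<sigma>) X) = A"
          unfolding h0(2)[symmetric] by (auto simp: content_def fun_eq_iff cong: conj_cong)
      qed
    qed (use finE assms in \<open>auto simp: finite_permutations\<close>)
    also have "\<dots> = fact (card X)"
      using assms by (simp add: card_permutations)
    finally show ?thesis .
  qed
  note st = this
  have "(\<Sum>h\<in>?E. of_nat (?st h) * \<Phi> (content X h))
     = (\<Sum>A\<in>weak_comps K (card X). \<Sum>h | h \<in> ?E \<and> content X h = A. of_nat (?st h) * \<Phi> (content X h))"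
    by (rule sum.group[symmetric]) (use finE assms content_in_weak_comps in auto)
  also have "\<dots> = (\<Sum>A\<in>weak_comps K (card X). of_nat (\<Sum>h | h \<in> ?E \<and> content X h = A. ?st h) * \<Phi> A)"
    by (intro sum.cong) (auto simp: sum_distrib_right)
  also have "\<dots> = fact (card X) * (\<Sum>A\<in>weak_comps K (card X). \<Phi> A)"
    by (simp add: st sum_distrib_left)
  finally show ?thesis .
qed

lemma sum_PiE_pair:
  "(\<Sum>h\<in>X \<rightarrow>\<^sub>E A \<times> B. G (restrict (fst \<circ> h) X) (restrict (snd \<circ> h) X)) = (\<Sum>f\<in>X \<rightarrow>\<^sub>E A. \<Sum>f'\<in>X \<rightarrow>\<^sub>E B. G f f')"
  unfolding sum.cartesian_product
  by (rule sum.reindex_bij_witness[where j = "\<lambda>h. (restrict (fst \<circ> h) X, restrict (snd \<circ> h) X)"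
        and i = "\<lambda>(f, f'). restrict (\<lambda>x. (f x, f' x)) X"])
    (auto simp: fun_eq_iff PiE_def extensional_def Pi_def mem_Times_iff split: if_splits)

text \<open>Pairs of colourings up to the symmetric group are matrices of natural numbers, so that the inner
  product is a sum over matrices with the degrees of the two monomials given by row and column sums;
  Cauchy's identity evaluates it.\<close>

lemma sum_Psi_Psi:
  assumes fin: "finite X" and "\<beta> \<in> vecs N (card X + stair N)" "\<gamma> \<in> vecs N (card X + stair N)"
  shows "(\<Sum>g | g permutes X. Psi N X g \<beta> * Psi N X g \<gamma>) = fact (card X) * alt_delta N \<gamma> \<beta>"
proof -
  let ?E = "X \<rightarrow>\<^sub>E {..<N}" and ?P = "{g. g permutes X}"
  let ?D = "\<lambda>f f'. frob_coeff N (content X f) \<beta> * frob_coeff N (content X f') \<gamma>"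
  let ?st = "\<lambda>f f'. {g. g permutes X \<and> (\<forall>x\<in>X. f (g x) = f x) \<and> (\<forall>x\<in>X. f' (g x) = f' x)}"
  have finP: "finite ?P" and finE: "finite ?E" using fin by (auto simp: finite_permutations intro: finite_PiE)
  have "(\<Sum>g\<in>?P. Psi N X g \<beta> * Psi N X g \<gamma>)
      = (\<Sum>g\<in>?P. \<Sum>f\<in>?E. \<Sum>f'\<in>?E. if (\<forall>x\<in>X. f (g x) = f x) \<and> (\<forall>x\<in>X. f' (g x) = f' x) then ?D f f' else 0)"
  proof (rule sum.cong[OF refl])
    fix g
    have "Psi N X g \<beta>' = (\<Sum>f\<in>?E. if \<forall>x\<in>X. f (g x) = f x then frob_coeff N (content X f) \<beta>' else 0)" for \<beta>'
      unfolding Psi_def colourings_def using finE by (rule sum.inter_filter)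
    then show "Psi N X g \<beta> * Psi N X g \<gamma>
      = (\<Sum>f\<in>?E. \<Sum>f'\<in>?E. if (\<forall>x\<in>X. f (g x) = f x) \<and> (\<forall>x\<in>X. f' (g x) = f' x) then ?D f f' else 0)"
      by (simp only: sum_product) (intro sum.cong refl, auto)
  qed
  also have "\<dots> = (\<Sum>f\<in>?E. \<Sum>f'\<in>?E. \<Sum>g\<in>?P. if (\<forall>x\<in>X. f (g x) = f x) \<and> (\<forall>x\<in>X. f' (g x) = f' x) then ?D f f' else 0)"
    by (subst sum.swap, intro sum.cong[OF refl], rule sum.swap)
  also have "\<dots> = (\<Sum>f\<in>?E. \<Sum>f'\<in>?E. of_nat (card (?st f f')) * ?D f f')"
  proof (intro sum.cong[OF refl])
    fix f f'
    have "(\<Sum>g\<in>?P. if (\<forall>x\<in>X. f (g x) = f x) \<and> (\<forall>x\<in>X. f' (g x) = f' x) then ?D f f' else 0)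
       = (\<Sum>g\<in>?st f f'. ?D f f')"
      using sum.inter_filter[OF finP, of "\<lambda>_. ?D f f'" "\<lambda>g. (\<forall>x\<in>X. f (g x) = f x) \<and> (\<forall>x\<in>X. f' (g x) = f' x)"] by simp
    then show "(\<Sum>g\<in>?P. if (\<forall>x\<in>X. f (g x) = f x) \<and> (\<forall>x\<in>X. f' (g x) = f' x) then ?D f f' else 0)
       = of_nat (card (?st f f')) * ?D f f'" by simp
  qed
  also have "\<dots> = (\<Sum>h\<in>X \<rightarrow>\<^sub>E {..<N} \<times> {..<N}. of_nat (card (?st (restrict (fst \<circ> h) X) (restrict (snd \<circ> h) X)))
        * ?D (restrict (fst \<circ> h) X) (restrict (snd \<circ> h) X))"
    by (rule sum_PiE_pair[symmetric])
  also have "\<dots> = (\<Sum>h\<in>X \<rightarrow>\<^sub>E {..<N} \<times> {..<N}. of_nat (card {g. g permutes X \<and> (\<forall>x\<in>X. h (g x) = h x)})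
        * (frob_coeff N (row_sum N (content X h)) \<beta> * frob_coeff N (col_sum N (content X h)) \<gamma>))"
  proof (rule sum.cong[OF refl])
    fix h assume h: "h \<in> X \<rightarrow>\<^sub>E {..<N} \<times> {..<N}"
    have hN: "fst (h x) < N" "snd (h x) < N" if "x \<in> X" for x
      using h that by (auto simp: PiE_def Pi_def mem_Times_iff)
    have "?st (restrict (fst \<circ> h) X) (restrict (snd \<circ> h) X) = {g. g permutes X \<and> (\<forall>x\<in>X. h (g x) = h x)}"
      by (auto simp: permutes_in_image prod_eq_iff)
    moreover have "content X (restrict (fst \<circ> h) X) = row_sum N (content X h)"
    proof
      fix i
      have "{x\<in>X. restrict (fst \<circ> h) X x = i} = (\<Union>j<N. {x\<in>X. h x = (i, j)})"
        using hN by (auto simp: prod_eq_iff)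
      then show "content X (restrict (fst \<circ> h) X) i = row_sum N (content X h) i"
        unfolding content_def row_sum_def using fin by (simp only:) (subst card_UN_disjoint, auto)
    qed
    moreover have "content X (restrict (snd \<circ> h) X) = col_sum N (content X h)"
    proof
      fix j
      have "{x\<in>X. restrict (snd \<circ> h) X x = j} = (\<Union>i<N. {x\<in>X. h x = (i, j)})"
        using hN by (auto simp: prod_eq_iff)
      then show "content X (restrict (snd \<circ> h) X) j = col_sum N (content X h) j"
        unfolding content_def col_sum_def using fin by (simp only:) (subst card_UN_disjoint, auto)
    qed
    ultimately show "of_nat (card (?st (restrict (fst \<circ> h) X) (restrict (snd \<circ> h) X)))
        * ?D (restrict (fst \<circ> h) X) (restrict (snd \<circ> h) X)
      = of_nat (card {g. g permutes X \<and> (\<forall>x\<in>X. h (g x) = h x)})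
        * (frob_coeff N (row_sum N (content X h)) \<beta> * frob_coeff N (col_sum N (content X h)) \<gamma>)"
      by simp
  qed
  also have "\<dots> = fact (card X) * (\<Sum>A\<in>weak_comps ({..<N} \<times> {..<N}) (card X).
      frob_coeff N (row_sum N A) \<beta> * frob_coeff N (col_sum N A) \<gamma>)"
    by (rule sum_stabilisers[OF _ fin, of "{..<N} \<times> {..<N}"]) simp
  also have "\<dots> = fact (card X) * alt_delta N \<gamma> \<beta>"
    using cauchy_matrices[OF assms(2,3)] by simp
  finally show ?thesis .
qed

section \<open>Straightening onto configurations with a pushed-down runner\<close>

text \<open>Position \<open>c + p q\<close> is the \<open>q\<close>-th place of the runner \<open>c\<close> of the \<open>p\<close>-abacus.  The beads of this runner
  occupy its lowest places if and only if there is a bead directly below each one that is not at the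
  bottom.\<close>

definition flat :: "nat \<Rightarrow> nat \<Rightarrow> nat \<Rightarrow> (nat \<Rightarrow> nat) \<Rightarrow> bool" where
  "flat N p c \<beta> \<longleftrightarrow> (\<forall>i<N. \<beta> i mod p = c \<longrightarrow> p \<le> \<beta> i \<longrightarrow> (\<exists>j<N. \<beta> j = \<beta> i - p))"

text \<open>If \<open>y\<close> is read as the functional \<open>x\<^sup>\<beta> \<mapsto> y \<beta>\<close>, this is its value at \<open>h\<^sub>m(x\<^sub>i\<^sup>p : i \<in> I) x\<^sup>\<beta>\<close>.\<close>

definition comp_sum ::
  "nat \<Rightarrow> nat set \<Rightarrow> nat \<Rightarrow> ((nat \<Rightarrow> nat) \<Rightarrow> complex) \<Rightarrow> (nat \<Rightarrow> nat) \<Rightarrow> complex" where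
  "comp_sum p I m y \<beta> = (\<Sum>\<kappa>\<in>weak_comps I m. y (\<lambda>i. \<beta> i + p * \<kappa> i))"

text \<open>Only vectors \<open>\<gamma>\<close> are tested for which \<open>U\<^bsub>pk\<^esub> y \<gamma>\<close> depends on the degree \<open>n + stair N\<close> part of \<open>y\<close>.\<close>

definition killed_by_power_sums :: "nat \<Rightarrow> nat \<Rightarrow> nat \<Rightarrow> ((nat \<Rightarrow> nat) \<Rightarrow> complex) \<Rightarrow> bool" where
  "killed_by_power_sums N p n y \<longleftrightarrow> alternating N y \<and>
     (\<forall>k\<ge>1. \<forall>\<gamma>. sum \<gamma> {..<N} + p * k = n + stair N \<longrightarrow> up N (p * k) y \<gamma> = 0)"

lemma weak_comps_0: "finite I \<Longrightarrow> weak_comps I 0 = {\<lambda>_. 0}"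
  by (auto simp: weak_comps_def fun_eq_iff)

lemma comp_sum_0 [simp]: "finite I \<Longrightarrow> comp_sum p I 0 y \<beta> = y \<beta>"
  by (simp add: comp_sum_def weak_comps_0)

text \<open>\<open>h\<^sub>m(x, X) = h\<^sub>m(X) + x h\<^bsub>m-1\<^esub>(x, X)\<close>.\<close>

lemma comp_sum_insert:
  assumes "finite I" "j \<notin> I"
  shows "comp_sum p (insert j I) (Suc m) y \<beta>
       = comp_sum p I (Suc m) y \<beta> + comp_sum p (insert j I) m y (\<beta>(j := \<beta> j + p))"
proof -
  let ?W = "weak_comps (insert j I) (Suc m)" and ?f = "\<lambda>\<kappa>. y (\<lambda>i. \<beta> i + p * \<kappa> i)"
  have "comp_sum p (insert j I) (Suc m) y \<beta> = (\<Sum>\<kappa> | \<kappa> \<in> ?W \<and> \<not> 1 \<le> \<kappa> j. ?f \<kappa>) + (\<Sum>\<kappa> | \<kappa> \<in> ?W \<and> 1 \<le> \<kappa> j. ?f \<kappa>)"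
    unfolding comp_sum_def
    by (subst sum.union_disjoint[symmetric]) (use assms in \<open>auto intro!: sum.cong\<close>)
  also have "{\<kappa> \<in> ?W. \<not> 1 \<le> \<kappa> j} = weak_comps I (Suc m)"
    using assms by (auto simp: weak_comps_def Suc_le_eq) metis
  also have "(\<Sum>\<kappa> | \<kappa> \<in> ?W \<and> 1 \<le> \<kappa> j. ?f \<kappa>) = (\<Sum>\<kappa>\<in>weak_comps (insert j I) m. ?f (\<kappa>(j := \<kappa> j + 1)))"
    using assms by (subst sum_weak_comps_part) auto
  also have "\<dots> = comp_sum p (insert j I) m y (\<beta>(j := \<beta> j + p))"
    unfolding comp_sum_def by (intro sum.cong refl arg_cong[where f = y]) (auto simp: fun_eq_iff)
  finally show ?thesis by (simp add: comp_sum_def)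
qed

lemma comp_sum_insert_sum:
  assumes "finite I" "j \<notin> I"
  shows "comp_sum p (insert j I) m y \<beta> = (\<Sum>t\<le>m. comp_sum p I (m - t) y (\<beta>(j := \<beta> j + p * t)))"
proof (induction m arbitrary: \<beta>)
  case 0
  then show ?case using assms by simp
next
  case (Suc m)
  have "comp_sum p (insert j I) (Suc m) y \<beta> = comp_sum p I (Suc m) y \<beta> +
      (\<Sum>t\<le>m. comp_sum p I (m - t) y (\<beta>(j := \<beta> j + p * Suc t)))"
    unfolding comp_sum_insert[OF assms] Suc.IH by (simp add: add.assoc)
  also have "\<dots> = (\<Sum>t\<le>Suc m. comp_sum p I (Suc m - t) y (\<beta>(j := \<beta> j + p * t)))"
    unfolding sum.atMost_Suc_shift by simp
  finally show ?case .
qed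

lemma sum_shift: "finite I \<Longrightarrow> I \<subseteq> {..<N} \<Longrightarrow> \<kappa> \<in> weak_comps I m \<Longrightarrow>
  (\<Sum>i<N. \<beta> i + p * \<kappa> i) = sum \<beta> {..<N} + p * m"
  for \<beta> :: "nat \<Rightarrow> nat"
proof -
  assume I: "finite I" "I \<subseteq> {..<N}" and \<kappa>: "\<kappa> \<in> weak_comps I m"
  have "sum \<kappa> {..<N} = sum \<kappa> I"
    using I \<kappa> by (intro sum.mono_neutral_right) (auto simp: weak_comps_def)
  then show ?thesis using \<kappa> by (simp add: sum.distrib weak_comps_def flip: sum_distrib_left)
qed

text \<open>By Newton's identity \<open>m h\<^sub>m(x\<^sup>p)\<close> is a combination of multiples of the power sums \<open>p\<^bsub>pk\<^esub>(x)\<close> with \<open>k \<ge> 1\<close>.\<close>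

lemma comp_sum_full:
  assumes y: "killed_by_power_sums N p n y" and m: "1 \<le> m" and deg: "sum \<beta> {..<N} + p * m = n + stair N"
  shows "comp_sum p {..<N} m y \<beta> = 0"
proof -
  have "of_nat m * comp_sum p {..<N} m y \<beta>
     = (\<Sum>k=1..m. \<Sum>i<N. \<Sum>\<kappa>\<in>weak_comps {..<N} (m - k). y (\<lambda>i'. \<beta> i' + p * (\<kappa>(i := \<kappa> i + k)) i'))"
    unfolding comp_sum_def by (rule newton_weak_comps) simp
  also have "\<dots> = (\<Sum>k=1..m. \<Sum>\<kappa>\<in>weak_comps {..<N} (m - k). up N (p * k) y (\<lambda>i. \<beta> i + p * \<kappa> i))"
    unfolding up_def
    by (subst sum.swap, intro sum.cong refl arg_cong[where f = y]) (auto simp: fun_eq_iff algebra_simps)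
  also have "\<dots> = 0"
  proof (intro sum.neutral ballI)
    fix k \<kappa> assume k: "k \<in> {1..m}" and \<kappa>: "\<kappa> \<in> weak_comps {..<N} (m - k)"
    have "(\<Sum>i<N. \<beta> i + p * \<kappa> i) + p * k = sum \<beta> {..<N} + p * m"
      using sum_shift[OF _ _ \<kappa>, of N \<beta> p] k by (simp flip: distrib_left)
    then show "up N (p * k) y (\<lambda>i. \<beta> i + p * \<kappa> i) = 0"
      using y k deg by (simp add: killed_by_power_sums_def)
  qed
  finally show ?thesis using m by simp
qed

text \<open>Dropping a variable \<open>x\<close> multiplies the generating function \<open>\<Sum> h\<^sub>m(x\<^sup>p) t\<^sup>m\<close> by \<open>1 - x\<^sup>p t\<close>.  In all
  variables it acts as the constant \<open>1\<close>, so without \<open>r\<close> variables it acts as a polynomial in \<open>t\<close> of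
  degree at most \<open>r\<close>.\<close>

lemma comp_sum_cofinite:
  assumes y: "killed_by_power_sums N p n y" and "finite J" "J \<subseteq> {..<N}" "card J < m"
    "sum \<beta> {..<N} + p * m = n + stair N"
  shows "comp_sum p ({..<N} - J) m y \<beta> = 0"
  using assms(2-)
proof (induction J arbitrary: m \<beta> rule: finite_induct)
  case empty
  then show ?case using comp_sum_full[OF y] by simp
next
  case (insert j J)
  let ?I = "{..<N} - insert j J"
  obtain m' where m: "m = Suc m'" using insert.prems by (cases m) auto
  have I: "{..<N} - J = insert j ?I" using insert by auto
  have "comp_sum p (insert j ?I) m y \<beta> = comp_sum p ?I m y \<beta> + comp_sum p (insert j ?I) m' y (\<beta>(j := \<beta> j + p))"
    unfolding m by (rule comp_sum_insert) auto
  moreover have "comp_sum p (insert j ?I) m y \<beta> = 0"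
    unfolding I[symmetric] using insert by (intro insert.IH) auto
  moreover have "comp_sum p (insert j ?I) m' y (\<beta>(j := \<beta> j + p)) = 0"
    unfolding I[symmetric] using insert sum_fun_upd_add[of "{..<N}" j \<beta> p]
    by (intro insert.IH) (auto simp: m)
  ultimately show ?case by simp
qed

text \<open>Drop the variables of the other beads on the runner of \<open>i0\<close> and move the bead \<open>i0\<close> down to the bottom of
  the runner: then \<open>h\<^sub>m\<close> in the remaining variables acts as zero.  Its term \<open>x\<^bsub>i0\<^esub>\<^bsup>pm\<^esup>\<close> restores \<open>\<beta>\<close>; in all
  other terms \<open>i0\<close> ends at a lower place \<open>t < m\<close> and \<open>m - t\<close> steps are given to beads of other runners.\<close>

lemma straighten:
  assumes y: "killed_by_power_sums N p n y" and i0: "i0 < N" "\<beta> i0 mod p = c"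
    and m: "m = \<beta> i0 div p" and card: "card {i. i < N \<and> i \<noteq> i0 \<and> \<beta> i mod p = c} < m"
    and deg: "sum \<beta> {..<N} = n + stair N"
  shows "y \<beta> = - (\<Sum>t<m. comp_sum p {i. i < N \<and> \<beta> i mod p \<noteq> c} (m - t) y (\<beta>(i0 := c + p * t)))"
proof -
  let ?J = "{i. i < N \<and> i \<noteq> i0 \<and> \<beta> i mod p = c}" and ?O = "{i. i < N \<and> \<beta> i mod p \<noteq> c}"
  have b0: "\<beta> i0 = c + p * m" using i0 m by (metis mod_mult_div_eq)
  have "{..<N} - ?J = insert i0 ?O" using i0 by auto
  moreover have "comp_sum p ({..<N} - ?J) m y (\<beta>(i0 := c)) = 0"
  proof (rule comp_sum_cofinite[OF y])
    show "sum (\<beta>(i0 := c)) {..<N} + p * m = n + stair N"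
      using sum_fun_upd_diff[of "{..<N}" i0 "p * m" \<beta>] i0 deg b0 member_le_sum[of i0 "{..<N}" \<beta>] by simp
  qed (use card in auto)
  ultimately have "0 = comp_sum p (insert i0 ?O) m y (\<beta>(i0 := c))" by simp
  also have "\<dots> = (\<Sum>t\<le>m. comp_sum p ?O (m - t) y (\<beta>(i0 := c + p * t)))"
    using i0 by (subst comp_sum_insert_sum) auto
  also have "\<dots> = (\<Sum>t<m. comp_sum p ?O (m - t) y (\<beta>(i0 := c + p * t))) + y \<beta>"
    unfolding lessThan_Suc_atMost[symmetric] by (simp add: b0[symmetric])
  finally show ?thesis by (simp add: eq_neg_iff_add_eq_0 add.commute)
qed

lemma sorting_permutation:
  fixes \<beta> :: "nat \<Rightarrow> nat"
  obtains w where "w permutes {..<N}" "\<And>i j. i < j \<Longrightarrow> j < N \<Longrightarrow> \<beta> (w j) \<le> \<beta> (w i)"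
proof -
  define xs where "xs = map \<beta> [0..<N]"
  have "mset (rev (sort xs)) = mset xs" by simp
  then obtain w where w: "w permutes {..<length xs}" "permute_list w xs = rev (sort xs)"
    by (rule mset_eq_permutation)
  have nth: "\<beta> (w i) = rev (sort xs) ! i" if "i < N" for i
  proof -
    have "w i < N" using permutes_in_image[OF w(1), of i] that by (simp add: xs_def)
    moreover have "permute_list w xs ! i = xs ! w i"
      using that w(1) by (intro permute_list_nth) (auto simp: xs_def)
    ultimately show ?thesis using w(2) by (simp add: xs_def)
  qed
  have "\<beta> (w j) \<le> \<beta> (w i)" if "i < j" "j < N" for i j
    using sorted_rev_nth_mono[of "rev (sort xs)" i j] that nth by (simp add: xs_def)
  then show thesis using w(1) by (intro that) (auto simp: xs_def)
qed

lemma strict_sorting_permutation: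
  assumes "inj_on \<beta> {..<N}"
  obtains w where "w permutes {..<N}" "strict_dec N (\<beta> \<circ> w)"
proof -
  obtain w where w: "w permutes {..<N}" "\<And>i j. i < j \<Longrightarrow> j < N \<Longrightarrow> \<beta> (w j) \<le> \<beta> (w i)"
    using sorting_permutation[of N \<beta>] by blast
  have "\<beta> (w j) < \<beta> (w i)" if "i < j" "j < N" for i j
  proof -
    have "w i < N" "w j < N" "w i \<noteq> w j"
      using permutes_in_image[OF w(1)] permutes_inj[OF w(1)] that by (auto dest: injD)
    then have "\<beta> (w i) \<noteq> \<beta> (w j)" using assms by (auto simp: inj_on_def)
    then show ?thesis using w(2)[OF that] by simp
  qed
  then show thesis using w(1) by (intro that) (auto simp: strict_dec_def)
qed

lemma flat_comp:
  assumes "w permutes {..<N}" "flat N p c \<beta>"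
  shows "flat N p c (\<beta> \<circ> w)"
  unfolding flat_def
proof (intro allI impI)
  fix i assume i: "i < N" "(\<beta> \<circ> w) i mod p = c" "p \<le> (\<beta> \<circ> w) i"
  have "w i < N" using permutes_in_image[OF assms(1), of i] i by simp
  then obtain j where j: "j < N" "\<beta> j = \<beta> (w i) - p" using assms(2) i by (auto simp: flat_def)
  have "inv_into UNIV w j < N" using permutes_in_image[OF permutes_inv[OF assms(1)], of j] j by simp
  then show "\<exists>j<N. (\<beta> \<circ> w) j = (\<beta> \<circ> w) i - p"
    using j permutes_inverses(1)[OF assms(1)] by (intro exI[of _ "inv_into UNIV w j"]) simp
qed

text \<open>Otherwise each of the \<open>r\<close> beads of the runner is at one of the places \<open>0, \<dots>, r - 1\<close>, and they fill
  these places.\<close>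

lemma not_flat_high_bead:
  assumes inj: "inj_on \<beta> {..<N}" and nf: "\<not> flat N p c \<beta>" and p: "0 < p"
  shows "\<exists>i0<N. \<beta> i0 mod p = c \<and> card {i. i < N \<and> i \<noteq> i0 \<and> \<beta> i mod p = c} < \<beta> i0 div p"
proof (rule ccontr)
  assume no: "\<not> ?thesis"
  let ?R = "{i. i < N \<and> \<beta> i mod p = c}"
  have fin: "finite ?R" by simp
  have small: "\<beta> i div p < card ?R" if i: "i \<in> ?R" for i
  proof -
    have "\<not> card {j. j < N \<and> j \<noteq> i \<and> \<beta> j mod p = c} < \<beta> i div p" using no i by blast
    moreover have "{j. j < N \<and> j \<noteq> i \<and> \<beta> j mod p = c} = ?R - {i}" by auto
    moreover have "card ?R > 0" using i fin card_gt_0_iff by blast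
    ultimately show ?thesis using i fin by (simp add: card_Diff_singleton)
  qed
  have "inj_on (\<lambda>i. \<beta> i div p) ?R"
  proof (rule inj_onI)
    fix i j assume ij: "i \<in> ?R" "j \<in> ?R" "\<beta> i div p = \<beta> j div p"
    then have "\<beta> i = \<beta> j" by (metis (mono_tags, lifting) div_mod_decomp mem_Collect_eq)
    then show "i = j" using ij inj by (auto simp: inj_on_def)
  qed
  then have "card ((\<lambda>i. \<beta> i div p) ` ?R) = card {..<card ?R}" by (simp add: card_image)
  moreover have sub: "(\<lambda>i. \<beta> i div p) ` ?R \<subseteq> {..<card ?R}" using small by auto
  ultimately have im: "(\<lambda>i. \<beta> i div p) ` ?R = {..<card ?R}" by (intro card_subset_eq) auto
  have "flat N p c \<beta>"
    unfolding flat_def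
  proof (intro allI impI)
    fix i assume i: "i < N" "\<beta> i mod p = c" "p \<le> \<beta> i"
    have "\<beta> i div p - 1 \<in> (\<lambda>i. \<beta> i div p) ` ?R" using small[of i] i im by auto
    then obtain j where j: "j < N" "\<beta> j mod p = c" "\<beta> j div p = \<beta> i div p - 1" by auto
    have "\<beta> i div p \<ge> 1" using i p by (simp add: div_greater_zero_iff Suc_leI)
    then have "\<beta> j + p = \<beta> i"
      using j i div_mod_decomp[of "\<beta> j" p] div_mod_decomp[of "\<beta> i" p]
      by (metis Nat.add_diff_assoc2 add.commute add.left_commute le_add_diff_inverse2 mult.commute mult_Suc plus_1_eq_Suc add.assoc)
    then show "\<exists>j<N. \<beta> j = \<beta> i - p" using j by auto
  qed
  then show False using nf by simp
qed

text \<open>The bead positions of the partitions of \<open>n\<close> whose runner \<open>c\<close> is pushed down.\<close>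

abbreviation flat_vecs :: "nat \<Rightarrow> nat \<Rightarrow> nat \<Rightarrow> nat \<Rightarrow> (nat \<Rightarrow> nat) set" where
  "flat_vecs N p c n \<equiv> {\<gamma> \<in> vecs N (n + stair N). strict_dec N \<gamma> \<and> flat N p c \<gamma>}"

text \<open>The coefficients \<open>d\<close> are integers that do not depend on \<open>y\<close>: the functional \<open>\<phi>\<close> is an integer
  combination of evaluations at flat vectors, modulo the relations given by the power sums.\<close>

definition flat_combination :: "nat \<Rightarrow> nat \<Rightarrow> nat \<Rightarrow> nat \<Rightarrow> (((nat \<Rightarrow> nat) \<Rightarrow> complex) \<Rightarrow> complex) \<Rightarrow> bool" where
  "flat_combination N p c n \<phi> \<longleftrightarrow> (\<exists>d :: (nat \<Rightarrow> nat) \<Rightarrow> int. \<forall>y. killed_by_power_sums N p n y \<longrightarrow>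
     \<phi> y = (\<Sum>\<gamma>\<in>flat_vecs N p c n. of_int (d \<gamma>) * y \<gamma>))"

lemma flat_combination_sum:
  assumes "finite A" "\<And>a. a \<in> A \<Longrightarrow> flat_combination N p c n (\<phi> a)"
  shows "flat_combination N p c n (\<lambda>y. \<Sum>a\<in>A. \<phi> a y)"
proof -
  have "\<forall>a\<in>A. \<exists>d :: (nat \<Rightarrow> nat) \<Rightarrow> int. \<forall>y. killed_by_power_sums N p n y \<longrightarrow>
     \<phi> a y = (\<Sum>\<gamma>\<in>flat_vecs N p c n. of_int (d \<gamma>) * y \<gamma>)"
    using assms(2) by (simp add: flat_combination_def)
  from bchoice[OF this] obtain d :: "_ \<Rightarrow> (nat \<Rightarrow> nat) \<Rightarrow> int" where d: "\<And>a y. a \<in> A \<Longrightarrow> killed_by_power_sums N p n y \<Longrightarrow>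
     \<phi> a y = (\<Sum>\<gamma>\<in>flat_vecs N p c n. of_int (d a \<gamma>) * y \<gamma>)" by blast
  have "(\<Sum>a\<in>A. \<phi> a y) = (\<Sum>\<gamma>\<in>flat_vecs N p c n. of_int (\<Sum>a\<in>A. d a \<gamma>) * y \<gamma>)"
    if y: "killed_by_power_sums N p n y" for y
  proof -
    have "(\<Sum>a\<in>A. \<phi> a y) = (\<Sum>a\<in>A. \<Sum>\<gamma>\<in>flat_vecs N p c n. of_int (d a \<gamma>) * y \<gamma>)"
      by (intro sum.cong refl d y)
    also have "\<dots> = (\<Sum>\<gamma>\<in>flat_vecs N p c n. \<Sum>a\<in>A. of_int (d a \<gamma>) * y \<gamma>)"
      by (rule sum.swap)
    finally show ?thesis by (simp only: sum_distrib_right of_int_sum)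
  qed
  then show ?thesis unfolding flat_combination_def
    by (intro exI[of _ "\<lambda>\<gamma>. \<Sum>a\<in>A. d a \<gamma>"] allI impI)
qed

lemma flat_combination_scale:
  assumes "flat_combination N p c n \<phi>"
  shows "flat_combination N p c n (\<lambda>y. of_int k * \<phi> y)"
proof -
  obtain d :: "(nat \<Rightarrow> nat) \<Rightarrow> int" where "\<forall>y. killed_by_power_sums N p n y \<longrightarrow>
     \<phi> y = (\<Sum>\<gamma>\<in>flat_vecs N p c n. of_int (d \<gamma>) * y \<gamma>)"
    using assms by (auto simp: flat_combination_def)
  then show ?thesis unfolding flat_combination_def
    by (intro exI[of _ "\<lambda>\<gamma>. k * d \<gamma>"]) (simp add: sum_distrib_left mult.assoc)
qed

lemma flat_combination_cong:
  assumes "flat_combination N p c n \<phi>" "\<And>y. killed_by_power_sums N p n y \<Longrightarrow> \<psi> y = \<phi> y"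
  shows "flat_combination N p c n \<psi>"
  using assms by (simp add: flat_combination_def)

text \<open>Straightening decreases the sum of the positions of the beads on the runner \<open>c\<close>, because the steps
  taken from one of them are given to beads of other runners; so it ends at flat vectors.\<close>

theorem flat_combination_eval:
  assumes p: "0 < p" and "\<beta> \<in> vecs N (n + stair N)"
  shows "flat_combination N p c n (\<lambda>y. y \<beta>)"
  using assms(2)
proof (induction "\<Sum>i | i < N \<and> \<beta> i mod p = c. \<beta> i" arbitrary: \<beta> rule: less_induct)
  case (less \<beta>)
  have deg: "sum \<beta> {..<N} = n + stair N" using less.prems by (simp add: weak_comps_def)
  consider "\<not> inj_on \<beta> {..<N}" | "inj_on \<beta> {..<N}" "flat N p c \<beta>" | "inj_on \<beta> {..<N}" "\<not> flat N p c \<beta>"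
    by blast
  then show ?case
  proof cases
    case 1
    then have "y \<beta> = 0" if "killed_by_power_sums N p n y" for y
      using that alternating_not_inj by (auto simp: killed_by_power_sums_def)
    then show ?thesis unfolding flat_combination_def by (intro exI[of _ "\<lambda>_. 0"]) simp
  next
    case 2
    obtain w where w: "w permutes {..<N}" "strict_dec N (\<beta> \<circ> w)"
      using strict_sorting_permutation[OF 2(1)] .
    have mem: "\<beta> \<circ> w \<in> flat_vecs N p c n"
      using w flat_comp[OF w(1) 2(2)] less.prems by (simp add: vecs_comp[OF w(1)])
    have "y \<beta> = of_int (sign w) * y (\<beta> \<circ> w)" if "killed_by_power_sums N p n y" for y
      using that alternatingD[OF _ w(1), of y \<beta>] by (simp add: killed_by_power_sums_def flip: mult.assoc)
    moreover have "(\<Sum>\<gamma>\<in>flat_vecs N p c n. of_int (if \<gamma> = \<beta> \<circ> w then sign w else 0) * y \<gamma>)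
       = of_int (sign w) * y (\<beta> \<circ> w)" for y :: "_ \<Rightarrow> complex"
    proof -
      have "(\<Sum>\<gamma>\<in>flat_vecs N p c n. of_int (if \<gamma> = \<beta> \<circ> w then sign w else 0) * y \<gamma>)
        = (\<Sum>\<gamma>\<in>flat_vecs N p c n. if \<gamma> = \<beta> \<circ> w then of_int (sign w) * y (\<beta> \<circ> w) else 0)"
        by (intro sum.cong) auto
      then show ?thesis using mem by (simp add: sum.delta)
    qed
    ultimately show ?thesis unfolding flat_combination_def
      by (intro exI[of _ "\<lambda>\<gamma>. if \<gamma> = \<beta> \<circ> w then sign w else 0"]) simp
  next
    case 3
    obtain i0 where i0: "i0 < N" "\<beta> i0 mod p = c" "card {i. i < N \<and> i \<noteq> i0 \<and> \<beta> i mod p = c} < \<beta> i0 div p"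
      using not_flat_high_bead[OF 3 p] by blast
    let ?m = "\<beta> i0 div p" and ?O = "{i. i < N \<and> \<beta> i mod p \<noteq> c}"
    have b0: "\<beta> i0 = c + p * ?m" using i0(2) by (metis mod_mult_div_eq)
    have "flat_combination N p c n
      (\<lambda>y. of_int (-1) * (\<Sum>t<?m. comp_sum p ?O (?m - t) y (\<beta>(i0 := c + p * t))))"
      unfolding comp_sum_def
    proof (intro flat_combination_scale flat_combination_sum finite_weak_comps less.hyps)
      fix t \<kappa> assume t: "t \<in> {..<?m}" and \<kappa>: "\<kappa> \<in> weak_comps ?O (?m - t)"
      let ?\<gamma> = "\<lambda>i. (\<beta>(i0 := c + p * t)) i + p * \<kappa> i"
      have k0: "\<kappa> i = 0" if "i \<notin> ?O" for i using \<kappa> that unfolding weak_comps_def by blast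
      have cp: "c < p" using i0(2) p by auto
      have "?\<gamma> i mod p = \<beta> i mod p" for i using i0 cp by auto
      then have S: "(\<Sum>i | i < N \<and> ?\<gamma> i mod p = c. ?\<gamma> i) = (\<Sum>i | i < N \<and> \<beta> i mod p = c. (\<beta>(i0 := c + p * t)) i)"
        using k0 by (intro sum.cong) auto
      show "(\<Sum>i | i < N \<and> ?\<gamma> i mod p = c. ?\<gamma> i) < (\<Sum>i | i < N \<and> \<beta> i mod p = c. \<beta> i)"
        unfolding S
      proof (rule sum_strict_mono_ex1)
        have lt: "c + p * t < \<beta> i0" using t p by (subst b0) simp
        then show "\<forall>i\<in>{i. i < N \<and> \<beta> i mod p = c}. (\<beta>(i0 := c + p * t)) i \<le> \<beta> i" by simp
        show "\<exists>i\<in>{i. i < N \<and> \<beta> i mod p = c}. (\<beta>(i0 := c + p * t)) i < \<beta> i"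
          using lt i0 by (intro bexI[of _ i0]) auto
      qed simp
      have "\<beta>(i0 := c + p * t) = \<beta>(i0 := \<beta> i0 - p * (?m - t))"
        using b0 t by (auto simp: diff_mult_distrib2 fun_eq_iff)
      then have "sum (\<beta>(i0 := c + p * t)) {..<N} = n + stair N - p * (?m - t)"
        using sum_fun_upd_diff[of "{..<N}" i0 "p * (?m - t)" \<beta>] i0 b0 deg by (simp add: diff_mult_distrib2)
      moreover have "p * (?m - t) \<le> n + stair N"
        using member_le_sum[of i0 "{..<N}" \<beta>] i0 b0 deg by (simp add: diff_mult_distrib2)
      ultimately have "(\<Sum>i<N. ?\<gamma> i) = n + stair N"
        using sum_shift[of ?O N \<kappa> "?m - t" "\<beta>(i0 := c + p * t)" p] \<kappa> by auto
      moreover have "?\<gamma> i = 0" if "\<not> i < N" for i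
        using that k0[of i] less.prems i0 by (auto simp: weak_comps_def)
      ultimately show "?\<gamma> \<in> vecs N (n + stair N)" unfolding weak_comps_def by simp
    qed auto
    then show ?thesis
      by (rule flat_combination_cong) (use straighten[OF _ i0(1,2) refl i0(3) deg] in simp)
  qed
qed

section \<open>Independence on configurations with a pushed-down runner\<close>

lemma card_residues:
  assumes "c < (p::nat)"
  shows "card {v. v < p * k \<and> v mod p = c} = k"
proof -
  have "bij_betw (\<lambda>q. p * q + c) {..<k} {v. v < p * k \<and> v mod p = c}"
    unfolding bij_betw_def
  proof
    show "inj_on (\<lambda>q. p * q + c) {..<k}" using assms by (auto simp: inj_on_def)
    show "(\<lambda>q. p * q + c) ` {..<k} = {v. v < p * k \<and> v mod p = c}"
    proof (intro equalityI subsetI)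
      fix v assume "v \<in> (\<lambda>q. p * q + c) ` {..<k}"
      then obtain q where q: "q < k" "v = p * q + c" by auto
      have "p * q + c < p * Suc q" using assms by simp
      also have "\<dots> \<le> p * k" using q by (intro mult_le_mono2) simp
      finally show "v \<in> {v. v < p * k \<and> v mod p = c}" using q assms by simp
    next
      fix v assume v: "v \<in> {v. v < p * k \<and> v mod p = c}"
      then have "v = p * (v div p) + c" by (metis (mono_tags, lifting) mem_Collect_eq mult_div_mod_eq)
      moreover have "v div p < k" using v by (simp add: less_mult_imp_div_less mult.commute)
      ultimately show "v \<in> (\<lambda>q. p * q + c) ` {..<k}" by blast
    qed
  qed
  from bij_betw_same_card[OF this] show ?thesis by simp
qed

text \<open>The operator \<open>E = \<Sum>\<^sub>k D\<^sub>k\<^sup>c U\<^bsub>pk\<^esub>\<close>, where \<open>D\<^sub>k\<^sup>c\<close> lowers beads of the runner \<open>c\<close> by \<open>k\<close> places.  On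
  the degree \<open>n\<close> part only \<open>p k \<le> n\<close> matters.\<close>

definition runner_energy ::
  "nat \<Rightarrow> nat \<Rightarrow> nat \<Rightarrow> nat \<Rightarrow> ((nat \<Rightarrow> nat) \<Rightarrow> complex) \<Rightarrow> (nat \<Rightarrow> nat) \<Rightarrow> complex" where
  "runner_energy N p c n y \<beta> = (\<Sum>k | 1 \<le> k \<and> p * k \<le> n. down N (\<lambda>v. v mod p = c) (p * k) (up N (p * k) y) \<beta>)"

text \<open>The product of the operators \<open>E - a\<close> for \<open>a\<close> in the list, applied to \<open>y\<close>.\<close>

fun energy_poly ::
  "nat \<Rightarrow> nat \<Rightarrow> nat \<Rightarrow> nat \<Rightarrow> complex list \<Rightarrow> ((nat \<Rightarrow> nat) \<Rightarrow> complex) \<Rightarrow> (nat \<Rightarrow> nat) \<Rightarrow> complex" where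
  "energy_poly N p c n [] y = y"
| "energy_poly N p c n (a # L) y =
     (\<lambda>\<beta>. runner_energy N p c n (energy_poly N p c n L y) \<beta> - a * energy_poly N p c n L y \<beta>)"

lemma finite_multiples: "0 < p \<Longrightarrow> finite {k. 1 \<le> k \<and> p * k \<le> (n::nat)}"
  by (rule finite_subset[of _ "{..n}"]) (auto intro: order_trans[rotated])

lemma up_diff: "up N k (\<lambda>\<beta>. f \<beta> - a * g \<beta>) \<gamma> = up N k f \<gamma> - a * up N k g \<gamma>"
  by (simp add: up_def sum_subtractf sum_distrib_left)

lemma down_diff: "down N P k (\<lambda>\<beta>. f \<beta> - a * g \<beta>) \<gamma> = down N P k f \<gamma> - a * down N P k g \<gamma>"
  unfolding down_def sum_distrib_left sum_subtractf[symmetric] by (intro sum.cong) auto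

lemma runner_energy_diff:
  "runner_energy N p c n (\<lambda>\<beta>. f \<beta> - a * g \<beta>) \<gamma> = runner_energy N p c n f \<gamma> - a * runner_energy N p c n g \<gamma>"
  unfolding runner_energy_def up_diff[abs_def] down_diff by (simp add: sum_subtractf sum_distrib_left)

lemma alternating_runner_energy:
  assumes "alternating N y"
  shows "alternating N (runner_energy N p c n y)"
  unfolding alternating_def runner_energy_def
  using alternatingD[OF alternating_down[OF alternating_up[OF assms]]] by (simp add: sum_distrib_left)

lemma alternating_energy_poly: "alternating N y \<Longrightarrow> alternating N (energy_poly N p c n L y)"
proof (induction L)
  case (Cons a L)
  then show ?case
    using alternating_runner_energy[of N "energy_poly N p c n L y" p c n]
    by (simp add: alternating_def algebra_simps)
qed simp

lemma down_cong_degree: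
  assumes "\<And>\<gamma>. sum \<gamma> {..<N} + k = sum \<beta> {..<N} \<Longrightarrow> f \<gamma> = g \<gamma>"
  shows "down N P k f \<beta> = down N P k g \<beta>"
  unfolding down_def
proof (intro sum.cong refl)
  fix j assume j: "j \<in> {..<N}"
  have "f (\<beta>(j := \<beta> j - k)) = g (\<beta>(j := \<beta> j - k))" if "k \<le> \<beta> j"
    using sum_fun_upd_diff[of "{..<N}" j k \<beta>] member_le_sum[of j "{..<N}" \<beta>] j that by (intro assms) auto
  then show "(if k \<le> \<beta> j \<and> P (\<beta> j) then f (\<beta>(j := \<beta> j - k)) else 0)
    = (if k \<le> \<beta> j \<and> P (\<beta> j) then g (\<beta>(j := \<beta> j - k)) else 0)" by auto
qed

lemma up_cong_degree:
  assumes "\<And>\<gamma>. sum \<gamma> {..<N} = sum \<beta> {..<N} + k \<Longrightarrow> f \<gamma> = g \<gamma>"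
  shows "up N k f \<beta> = up N k g \<beta>"
  unfolding up_def
proof (intro sum.cong refl assms)
  fix i assume "i \<in> {..<N}"
  then show "sum (\<beta>(i := \<beta> i + k)) {..<N} = sum \<beta> {..<N} + k"
    by (rule sum_fun_upd_add[OF finite_lessThan])
qed

lemma runner_energy_cong_degree:
  assumes "\<And>\<gamma>. sum \<gamma> {..<N} = sum \<beta> {..<N} \<Longrightarrow> f \<gamma> = g \<gamma>"
  shows "runner_energy N p c n f \<beta> = runner_energy N p c n g \<beta>"
  unfolding runner_energy_def
  by (rule sum.cong[OF refl], rule down_cong_degree, rule up_cong_degree, rule assms) simp

text \<open>\<open>U\<^bsub>pl\<^esub> E = (E + l) U\<^bsub>pl\<^esub>\<close>: moving \<open>U\<^bsub>pl\<^esub>\<close> past \<open>D\<^sub>k\<^sup>c\<close> produces an extra term only for \<open>k = l\<close>, with the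
  factor \<open>l\<close> because the runner \<open>c\<close> has \<open>l\<close> places below the position \<open>p l\<close>.\<close>

lemma up_runner_energy:
  assumes y: "alternating N y" and N: "2 * n \<le> N" and p: "0 < p" and c: "c < p" and l: "1 \<le> l"
    and deg: "sum \<beta> {..<N} + p * l \<le> n + stair N" and low: "stair N \<le> sum \<beta> {..<N}"
  shows "up N (p * l) (runner_energy N p c n y) \<beta>
       = runner_energy N p c n (up N (p * l) y) \<beta> + of_nat l * up N (p * l) y \<beta>"
proof -
  let ?K = "{k. 1 \<le> k \<and> p * k \<le> n}" and ?D = "\<lambda>k. down N (\<lambda>v. v mod p = c) (p * k)"
  let ?U = "\<lambda>k. up N (p * k)"
  have pl: "p * l \<le> n" using deg low by simp
  have comm: "?U l (?U k y) = ?U k (?U l y)" for k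
    unfolding up_def by (rule ext, subst sum.swap, intro sum.cong refl arg_cong[where f = y]) (auto simp: fun_eq_iff)
  have "?U l (runner_energy N p c n y) \<beta> = (\<Sum>k\<in>?K. ?U l (?D k (?U k y)) \<beta>)"
    unfolding runner_energy_def[abs_def] up_def[of N "p * l"] by (rule sum.swap)
  also have "\<dots> = (\<Sum>k\<in>?K. ?D k (?U l (?U k y)) \<beta> + (if k = l then of_nat l * ?U k y \<beta> else 0))"
  proof (intro sum.cong refl)
    fix k assume k: "k \<in> ?K"
    show "?U l (?D k (?U k y)) \<beta> = ?D k (?U l (?U k y)) \<beta> + (if k = l then of_nat l * ?U k y \<beta> else 0)"
      using up_down_commute[OF alternating_up[OF y], of "\<lambda>v. v mod p = c" "p * l" \<beta> n "p * k" "p * k"]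
        k deg N pl p card_residues[OF c, of l] by auto
  qed
  also have "\<dots> = runner_energy N p c n (?U l y) \<beta> + of_nat l * ?U l y \<beta>"
    using finite_multiples[OF p, of n] l pl by (simp add: sum.distrib runner_energy_def comm)
  finally show ?thesis .
qed

lemma up_energy_poly:
  assumes y: "alternating N y" and N: "2 * n \<le> N" and p: "0 < p" and c: "c < p" and l: "1 \<le> l"
    and "sum \<beta> {..<N} + p * l \<le> n + stair N" "stair N \<le> sum \<beta> {..<N}"
  shows "up N (p * l) (energy_poly N p c n L y) \<beta>
       = energy_poly N p c n (map (\<lambda>a. a - of_nat l) L) (up N (p * l) y) \<beta>"
  using assms(6-)
proof (induction L arbitrary: \<beta>)
  case (Cons a L)
  let ?z = "energy_poly N p c n L y" and ?w = "energy_poly N p c n (map (\<lambda>a. a - of_nat l) L) (up N (p * l) y)"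
  have "up N (p * l) (energy_poly N p c n (a # L) y) \<beta>
      = runner_energy N p c n (up N (p * l) ?z) \<beta> + of_nat l * up N (p * l) ?z \<beta> - a * up N (p * l) ?z \<beta>"
    using up_runner_energy[OF alternating_energy_poly[OF y] N p c l Cons.prems] by (simp add: up_diff)
  also have "runner_energy N p c n (up N (p * l) ?z) \<beta> = runner_energy N p c n ?w \<beta>"
    using Cons by (intro runner_energy_cong_degree) simp
  also have "up N (p * l) ?z \<beta> = ?w \<beta>" using Cons by simp
  finally show ?case by (simp add: algebra_simps)
qed simp

text \<open>The factors commute, so the factor \<open>E\<close> that belongs to the root \<open>0\<close> can be moved to the front.\<close>

lemma energy_poly_root:
  "0 \<in> set L \<Longrightarrow> energy_poly N p c n L y = runner_energy N p c n (energy_poly N p c n (remove1 0 L) y)"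
proof (induction L)
  case (Cons a L)
  show ?case
  proof (cases "a = 0")
    case False
    then have "0 \<in> set L" using Cons.prems by auto
    note IH = Cons.IH[OF this]
    let ?E = "runner_energy N p c n" and ?z = "energy_poly N p c n (remove1 0 L) y"
    have "energy_poly N p c n (a # L) y = (\<lambda>\<beta>. ?E (?E ?z) \<beta> - a * ?E ?z \<beta>)"
      unfolding energy_poly.simps IH ..
    also have "\<dots> = ?E (\<lambda>\<beta>. ?E ?z \<beta> - a * ?z \<beta>)"
      by (rule ext) (simp only: runner_energy_diff)
    also have "\<dots> = ?E (energy_poly N p c n (remove1 0 (a # L)) y)"
      using False by simp
    finally show ?thesis .
  qed (simp add: fun_eq_iff)
qed simp

text \<open>The operator \<open>E\<close> on the degree \<open>m\<close> part has no eigenvalues but \<open>0, \<dots>, m\<close>: after the factor \<open>E = \<Sum>\<^sub>k D\<^sub>k\<^sup>c U\<^bsub>pk\<^esub>\<close>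
  for the root \<open>0\<close> is put in front, \<open>U\<^bsub>pk\<^esub>\<close> shifts the other roots by \<open>k\<close> and lowers the degree to
  \<open>m - p k\<close>, and the roots \<open>k, \<dots>, m\<close> suffice for the new degree.\<close>

lemma energy_spectrum:
  assumes "alternating N y" and N: "2 * n \<le> N" and p: "0 < p" and c: "c < p" and "m \<le> n"
    "sum \<beta> {..<N} = m + stair N" "of_nat ` {..m} \<subseteq> set L"
  shows "energy_poly N p c n L y \<beta> = 0"
  using assms(1,5-)
proof (induction m arbitrary: y \<beta> L rule: less_induct)
  case (less m)
  let ?L = "remove1 0 L" and ?U = "\<lambda>k. up N (p * k)"
  have "0 \<in> set L" using less.prems(4) by (force simp: image_subset_iff)
  then have "energy_poly N p c n L y \<beta> = runner_energy N p c n (energy_poly N p c n ?L y) \<beta>"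
    by (simp add: energy_poly_root)
  also have "\<dots> = 0"
    unfolding runner_energy_def
  proof (intro sum.neutral ballI)
    fix k assume "k \<in> {k. 1 \<le> k \<and> p * k \<le> n}"
    then have k: "1 \<le> k" "p * k \<le> n" "1 \<le> p * k" using p by auto
    have "?U k (energy_poly N p c n ?L y) \<gamma> = 0" if \<gamma>: "sum \<gamma> {..<N} + p * k = sum \<beta> {..<N}" for \<gamma>
    proof (cases "sum \<gamma> {..<N} < stair N")
      case True
      then show ?thesis
        by (rule alternating_low[OF alternating_up[OF alternating_energy_poly[OF less.prems(1)]]])
    next
      case False
      have "?U k (energy_poly N p c n ?L y) \<gamma> = energy_poly N p c n (map (\<lambda>a. a - of_nat k) ?L) (?U k y) \<gamma>"
        using \<gamma> less.prems False k by (intro up_energy_poly[OF less.prems(1) N p c]) auto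
      also have "\<dots> = 0"
      proof (rule less.IH[of "m - p * k"])
        show "m - p * k < m" using \<gamma> less.prems False k(3) by linarith
        show "of_nat ` {..m - p * k} \<subseteq> set (map (\<lambda>a. a - of_nat k) ?L)"
        proof safe
          fix e assume e: "e \<le> m - p * k"
          have "k \<le> p * k" using p by simp
          then have "e + k \<le> m" using e \<gamma> less.prems False by linarith
          then have "of_nat (e + k) \<in> set L" using less.prems(4) by blast
          moreover have "of_nat (e + k) \<noteq> (0::complex)" using k by (metis add_is_0 not_one_le_zero of_nat_eq_0_iff)
          ultimately have "of_nat (e + k) \<in> set ?L" by (simp add: in_set_remove1)
          then have "(\<lambda>a. a - of_nat k) (of_nat (e + k)) \<in> set (map (\<lambda>a. a - of_nat k) ?L)" unfolding set_map by (rule imageI)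
          then show "complex_of_nat e \<in> set (map (\<lambda>a. a - of_nat k) ?L)" by simp
        qed
      qed (use k \<gamma> less.prems False in \<open>auto intro: alternating_up\<close>)
      finally show ?thesis .
    qed
    then show "down N (\<lambda>v. v mod p = c) (p * k) (?U k (energy_poly N p c n ?L y)) \<beta> = 0"
      by (subst down_cong_degree[where g = "\<lambda>_. 0"]) (simp_all add: down_def)
  qed
  finally show ?case .
qed

lemma flat_iter:
  assumes "flat N p c \<gamma>" "i < N" "\<gamma> i mod p = c" "p * k \<le> \<gamma> i"
  shows "\<exists>j<N. \<gamma> j = \<gamma> i - p * k"
  using assms(4)
proof (induction k)
  case (Suc k)
  then obtain j where j: "j < N" "\<gamma> j = \<gamma> i - p * k" by auto
  have "\<gamma> i = \<gamma> j + p * k" using j Suc.prems by simp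
  then have "\<gamma> j mod p = c" using assms(3) by simp
  moreover have "p \<le> \<gamma> j" using j Suc.prems by simp
  ultimately obtain j' where "j' < N" "\<gamma> j' = \<gamma> j - p" using assms(1) j by (auto simp: flat_def)
  then show ?case using j by (intro exI[of _ j']) simp
qed (use assms in auto)

text \<open>Lowering a bead of a flat runner puts it on top of another bead, so \<open>E\<close> gives zero on flat vectors and
  \<open>E - a\<close> is multiplication by \<open>- a\<close>.\<close>

lemma energy_poly_flat:
  assumes y: "alternating N y" and fl: "flat N p c \<gamma>" and p: "0 < p"
  shows "energy_poly N p c n L y \<gamma> = (\<Prod>a\<leftarrow>L. - a) * y \<gamma>"
proof (induction L)
  case (Cons a L)
  let ?z = "energy_poly N p c n L y"
  have "down N (\<lambda>v. v mod p = c) (p * k) (up N (p * k) ?z) \<gamma> = 0" if k: "1 \<le> k" for k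
    unfolding down_def
  proof (intro sum.neutral ballI)
    fix j assume j: "j \<in> {..<N}"
    have "up N (p * k) ?z (\<gamma>(j := \<gamma> j - p * k)) = 0" if pj: "p * k \<le> \<gamma> j" "\<gamma> j mod p = c"
    proof -
      obtain i where i: "i < N" "\<gamma> i = \<gamma> j - p * k" using flat_iter[OF fl] j pj by blast
      have "0 < p * k" using p k by simp
      then have "\<gamma> i \<noteq> \<gamma> j" using i(2) pj by linarith
      then have "i \<noteq> j" by blast
      then show ?thesis
        using i j by (intro alternating_repeat[OF alternating_up[OF alternating_energy_poly[OF y]], of i j]) auto
    qed
    then show "(if p * k \<le> \<gamma> j \<and> \<gamma> j mod p = c then up N (p * k) ?z (\<gamma>(j := \<gamma> j - p * k)) else 0) = 0"
      by auto
  qed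
  then have "runner_energy N p c n ?z \<gamma> = 0"
    unfolding runner_energy_def by (intro sum.neutral) auto
  then show ?case by (simp add: Cons.IH)
qed simp

text \<open>Apply \<open>\<Prod>\<^bsub>1 \<le> e \<le> n\<^esub> (E - e)\<close> to the delta function of \<open>\<gamma>0\<close>.  Behind \<open>U\<^bsub>pk\<^esub>\<close> the roots become
  \<open>1 - k, \<dots>, n - k\<close>, which contain the spectrum \<open>0, \<dots>, n - p k\<close> of the lower degree; on flat vectors the
  product is the nonzero scalar \<open>(-1)\<^sup>n n!\<close>.\<close>

theorem ex_killed_dual:
  assumes N: "2 * n \<le> N" and p: "0 < p" and c: "c < p" and \<gamma>0: "\<gamma>0 \<in> flat_vecs N p c n"
  obtains y C where "killed_by_power_sums N p n y" "C \<noteq> 0"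
    "\<And>\<gamma>. \<gamma> \<in> flat_vecs N p c n \<Longrightarrow> y \<gamma> = (if \<gamma> = \<gamma>0 then C else 0)"
proof -
  let ?L = "map of_nat [1..<Suc n] :: complex list"
  let ?y = "energy_poly N p c n ?L (alt_delta N \<gamma>0)"
  have alt: "alternating N ?y" by (rule alternating_energy_poly[OF alternating_alt_delta])
  have "up N (p * k) ?y \<gamma> = 0" if k: "1 \<le> k" and \<gamma>: "sum \<gamma> {..<N} + p * k = n + stair N" for k \<gamma>
  proof (cases "sum \<gamma> {..<N} < stair N")
    case True
    then show ?thesis by (rule alternating_low[OF alternating_up[OF alt]])
  next
    case False
    have "up N (p * k) ?y \<gamma> = energy_poly N p c n (map (\<lambda>a. a - of_nat k) ?L) (up N (p * k) (alt_delta N \<gamma>0)) \<gamma>"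
      using \<gamma> False k by (intro up_energy_poly[OF alternating_alt_delta N p c]) auto
    also have "\<dots> = 0"
    proof (rule energy_spectrum[OF alternating_up[OF alternating_alt_delta] N p c, of "n - p * k"])
      show "of_nat ` {..n - p * k} \<subseteq> set (map (\<lambda>a. a - of_nat k) ?L)"
      proof safe
        fix e assume e: "e \<le> n - p * k"
        have "k \<le> p * k" using p by simp
        then have "e + k \<le> n" using e \<gamma> False by linarith
        then have "e + k \<in> set [1..<Suc n]" using k unfolding set_upt by simp
        then have "of_nat (e + k) \<in> set ?L" unfolding set_map by (rule imageI)
        then have "(\<lambda>a. a - of_nat k) (of_nat (e + k)) \<in> set (map (\<lambda>a. a - of_nat k) ?L)" unfolding set_map by (rule imageI)
        then show "complex_of_nat e \<in> set (map (\<lambda>a. a - of_nat k) ?L)" by simp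
      qed
    qed (use \<gamma> False in auto)
    finally show ?thesis .
  qed
  then have "killed_by_power_sums N p n ?y" using alt by (simp add: killed_by_power_sums_def)
  moreover have "(\<Prod>a\<leftarrow>?L. - a) \<noteq> 0" by (auto simp: prod_list_zero_iff)
  moreover have "?y \<gamma> = (if \<gamma> = \<gamma>0 then \<Prod>a\<leftarrow>?L. - a else 0)" if "\<gamma> \<in> flat_vecs N p c n" for \<gamma>
    using that \<gamma>0 energy_poly_flat[OF alternating_alt_delta, of N p c \<gamma> n ?L \<gamma>0] p
    by (simp add: alt_delta_same_dec)
  ultimately show thesis by (rule that)
qed

section \<open>Partitions, conjugation and bead configurations\<close>

lemma part_eq_nth: "i < length \<mu> \<Longrightarrow> part \<mu> (Suc i) = \<mu> ! i"
  by (simp add: part_def)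

lemma part_beyond: "length \<mu> < i \<Longrightarrow> part \<mu> i = 0"
  by (simp add: part_def)

lemma part_antimono:
  assumes "\<mu> \<in> partitions n" "1 \<le> i" "i \<le> j"
  shows "part \<mu> j \<le> part \<mu> i"
proof (cases "i = j \<or> length \<mu> < j")
  case False
  then have "i - 1 < j - 1" "j - 1 < length \<mu>" using assms by auto
  moreover have "sorted_wrt (\<ge>) \<mu>" using assms(1) by (simp add: partitions_def)
  ultimately have "\<mu> ! (j - 1) \<le> \<mu> ! (i - 1)"
    using sorted_wrt_nth_less[of "(\<ge>)" \<mu> "i - 1" "j - 1"] by blast
  then show ?thesis using assms False by (simp add: part_def)
qed (use assms in \<open>auto simp: part_beyond\<close>)

lemma part_pos:
  assumes "\<mu> \<in> partitions n" "1 \<le> i" "i \<le> length \<mu>"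
  shows "0 < part \<mu> i"
proof -
  have "\<mu> ! (i - 1) \<in> set \<mu>" using assms by simp
  moreover have "0 \<notin> set \<mu>" using assms(1) by (simp add: partitions_def)
  ultimately have "\<mu> ! (i - 1) \<noteq> 0" by metis
  then show ?thesis using assms by (simp add: part_def)
qed

lemma sum_part_eq:
  assumes "\<mu> \<in> partitions n" "length \<mu> \<le> N"
  shows "(\<Sum>i<N. part \<mu> (Suc i)) = n"
proof -
  have "(\<Sum>i<N. part \<mu> (Suc i)) = (\<Sum>i<length \<mu>. part \<mu> (Suc i))"
    using assms by (intro sum.mono_neutral_right) (auto simp: part_beyond)
  also have "\<dots> = (\<Sum>i<length \<mu>. \<mu> ! i)" by (intro sum.cong) (auto simp: part_eq_nth)
  also have "\<dots> = n" using assms by (simp add: partitions_def sum_list_sum_nth atLeast0LessThan)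
  finally show ?thesis .
qed

lemma length_partition_le:
  assumes "\<mu> \<in> partitions n"
  shows "length \<mu> \<le> n"
proof -
  have "(\<Sum>i<length \<mu>. 1) \<le> (\<Sum>i<length \<mu>. part \<mu> (Suc i))"
    using part_pos[OF assms] by (intro sum_mono) (simp add: Suc_leI)
  then show ?thesis using sum_part_eq[OF assms order_refl] by simp
qed

lemma partition_eqI:
  assumes "\<mu> \<in> partitions n" "\<nu> \<in> partitions m" "\<And>i. 1 \<le> i \<Longrightarrow> part \<mu> i = part \<nu> i"
  shows "\<mu> = \<nu>"
proof -
  have le: "length \<alpha> \<le> length \<beta>" if "\<alpha> \<in> partitions k" "\<And>i. 1 \<le> i \<Longrightarrow> part \<alpha> i = part \<beta> i" for \<alpha> \<beta> k
    using part_pos[OF that(1), of "length \<alpha>"] that(2)[of "length \<alpha>"] part_beyond[of \<beta> "length \<alpha>"]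
    by (cases "length \<alpha>") (auto intro: leI)
  have "length \<mu> = length \<nu>" using le[OF assms(1,3)] le[OF assms(2)] assms(3) by (simp add: le_antisym)
  then show ?thesis
    using assms(3)[of "Suc _"] by (intro nth_equalityI) (auto simp flip: part_eq_nth)
qed

lemma partition_of_vec:
  assumes a: "a \<in> vecs N n" and anti: "\<And>i j. i < j \<Longrightarrow> j < N \<Longrightarrow> a j \<le> a i"
  obtains \<mu> where "\<mu> \<in> partitions n" "\<And>i. part \<mu> (Suc i) = a i" "length \<mu> \<le> N"
proof -
  have z: "a i = 0" if "N \<le> i" for i using a that by (simp add: weak_comps_def)
  then have anti': "a j \<le> a i" if "i \<le> j" for i j
    using anti[of i j] that by (cases "j < N"; cases "i = j") auto
  define k where "k = (LEAST i. a i = 0)"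
  have kN: "k \<le> N" unfolding k_def by (rule Least_le) (simp add: z)
  have k0: "a k = 0" unfolding k_def by (rule LeastI[of _ N]) (simp add: z)
  have pos: "0 < a i" if "i < k" for i using not_less_Least[of i "\<lambda>i. a i = 0"] that by (simp add: k_def)
  have zero: "a i = 0" if "k \<le> i" for i using anti'[OF that] k0 by simp
  define \<mu> where "\<mu> = map a [0..<k]"
  have "sum_list \<mu> = (\<Sum>i<k. a i)" by (simp add: \<mu>_def interv_sum_list_conv_sum_set_nat atLeast0LessThan)
  also have "\<dots> = (\<Sum>i<N. a i)" using kN zero by (intro sum.mono_neutral_left) auto
  also have "\<dots> = n" using a by (simp add: weak_comps_def)
  finally have "\<mu> \<in> partitions n"
    using pos anti' by (force simp: partitions_def \<mu>_def sorted_wrt_iff_nth_less)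
  moreover have "part \<mu> (Suc i) = a i" for i using zero[of i] by (auto simp: part_def \<mu>_def)
  ultimately show thesis using that kN by (simp add: \<mu>_def)
qed

definition part_vec :: "nat list \<Rightarrow> nat \<Rightarrow> nat" where
  "part_vec \<mu> i = part \<mu> (Suc i)"

text \<open>The beads of \<open>\<mu>\<close> from the \<open>N\<close> first parts, shifted by \<open>N\<close>: the entry at \<open>i\<close> is \<open>\<mu>\<^bsub>i+1\<^esub> - (i + 1) + N\<close>.\<close>

definition beta_vec :: "nat \<Rightarrow> nat list \<Rightarrow> nat \<Rightarrow> nat" where
  "beta_vec N \<mu> i = part_vec \<mu> i + staircase N i"

lemma part_vec_in: "\<mu> \<in> partitions n \<Longrightarrow> n \<le> N \<Longrightarrow> part_vec \<mu> \<in> vecs N n"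
  using sum_part_eq[of \<mu> n N] length_partition_le[of \<mu> n]
  by (auto simp: weak_comps_def part_vec_def part_beyond)

lemma beta_vec_in: "\<mu> \<in> partitions n \<Longrightarrow> n \<le> N \<Longrightarrow> beta_vec N \<mu> \<in> vecs N (n + stair N)"
  using part_vec_in[of \<mu> n N] staircase_in[of N]
  by (auto simp: weak_comps_def beta_vec_def sum.distrib)

lemma strict_dec_beta_vec:
  assumes "\<mu> \<in> partitions n"
  shows "strict_dec N (beta_vec N \<mu>)"
  unfolding strict_dec_def
proof (intro allI impI)
  fix i j assume "i < j" "j < N"
  then have "part \<mu> (Suc j) \<le> part \<mu> (Suc i)" "N - 1 - j < N - 1 - i"
    using part_antimono[OF assms, of "Suc i" "Suc j"] by auto
  then show "beta_vec N \<mu> j < beta_vec N \<mu> i"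
    unfolding beta_vec_def part_vec_def staircase_def by (rule add_le_less_mono)
qed

lemma beta_vec_inj:
  assumes "\<mu> \<in> partitions n" "\<nu> \<in> partitions m" "beta_vec N \<mu> = beta_vec N \<nu>"
  shows "\<mu> = \<nu>"
proof (rule partition_eqI[OF assms(1,2)])
  fix i :: nat assume "1 \<le> i"
  then show "part \<mu> i = part \<nu> i"
    using fun_cong[OF assms(3), of "i - 1"] by (simp add: beta_vec_def part_vec_def)
qed

lemma beta_vec_surj:
  assumes \<gamma>: "\<gamma> \<in> vecs N (n + stair N)" and dec: "strict_dec N \<gamma>"
  obtains \<mu> where "\<mu> \<in> partitions n" "\<gamma> = beta_vec N \<mu>"
proof -
  have step: "\<gamma> j + (j - i) \<le> \<gamma> i" if "i \<le> j" "j < N" for i j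
    using that
  proof (induction j)
    case (Suc j)
    show ?case
    proof (cases "i = Suc j")
      case False
      then have "\<gamma> (Suc j) < \<gamma> j" "\<gamma> j + (j - i) \<le> \<gamma> i" using dec Suc by (auto simp: strict_dec_def)
      then show ?thesis using Suc.prems False by simp
    qed simp
  qed simp
  have ge: "staircase N i \<le> \<gamma> i" for i
  proof (cases "i < N")
    case True
    then have "i \<le> N - 1" "N - 1 < N" by auto
    from step[OF this] show ?thesis by (simp add: staircase_def)
  qed (simp add: staircase_def)
  define a where "a i = \<gamma> i - staircase N i" for i
  have a: "\<gamma> i = a i + staircase N i" for i using ge[of i] by (simp add: a_def)
  have "sum a {..<N} = n"
  proof -
    have "sum \<gamma> {..<N} = sum a {..<N} + stair N"
      by (simp add: a sum.distrib flip: sum_staircase)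
    then show ?thesis using \<gamma> by (simp add: weak_comps_def)
  qed
  moreover have "a i = 0" if "N \<le> i" for i using \<gamma> that by (simp add: a_def weak_comps_def)
  ultimately have av: "a \<in> vecs N n" by (simp add: weak_comps_def)
  have anti: "a j \<le> a i" if "i < j" "j < N" for i j
    using step[of i j] that by (simp add: a_def staircase_def)
  obtain \<mu> where \<mu>: "\<mu> \<in> partitions n" "\<And>i. part \<mu> (Suc i) = a i"
    using partition_of_vec[OF av anti] by blast
  then have "\<gamma> = beta_vec N \<mu>" by (auto simp: fun_eq_iff beta_vec_def part_vec_def a)
  with \<mu>(1) show thesis by (rule that)
qed

lemma down_closed_eq_lessThan:
  assumes "finite D" "\<And>i j. j \<in> D \<Longrightarrow> i \<le> j \<Longrightarrow> i \<in> D"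
  shows "D = {..<card (D :: nat set)}"
proof (cases "D = {}")
  case False
  then have "D = {..Max D}" using assms(2)[OF Max_in[OF assms(1) False]] Max_ge[OF assms(1)] by auto
  then have "D = {..<Suc (Max D)}" by (simp add: lessThan_Suc_atMost)
  then show ?thesis by (metis card_lessThan)
qed simp

lemma part_conj_eq:
  assumes \<mu>: "\<mu> \<in> partitions n" and j: "1 \<le> j"
  shows "part (conj_part \<mu>) j = length (filter (\<lambda>a. j \<le> a) \<mu>)"
proof (cases "j \<le> part \<mu> 1")
  case False
  have "a < j" if a: "a \<in> set \<mu>" for a
  proof -
    obtain i where i: "i < length \<mu>" "\<mu> ! i = a" using a by (auto simp: in_set_conv_nth)
    then have "a \<le> part \<mu> 1" using part_antimono[OF \<mu>, of 1 "Suc i"] by (simp add: part_eq_nth)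
    then show ?thesis using False by simp
  qed
  then have "filter (\<lambda>a. j \<le> a) \<mu> = []" by (auto simp: filter_empty_conv not_le)
  moreover have "length (conj_part \<mu>) = part \<mu> 1" by (simp add: conj_part_def del: upt_Suc)
  ultimately show ?thesis using False by (simp add: part_beyond)
next
  case True
  then have "j \<le> length (conj_part \<mu>)" by (simp add: conj_part_def del: upt_Suc)
  moreover have "[1..<Suc (part \<mu> 1)] ! (j - 1) = j" using True j by (subst nth_upt) auto
  ultimately show ?thesis
    using j True unfolding part_def[of "conj_part \<mu>"] by (simp add: conj_part_def del: upt_Suc)
qed

text \<open>Both sides say that the box \<open>(i, j)\<close> lies in the diagram of \<open>\<mu>\<close>.\<close>

lemma conj_part_galois:
  assumes \<mu>: "\<mu> \<in> partitions n" and ij: "1 \<le> i" "1 \<le> j"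
  shows "i \<le> part (conj_part \<mu>) j \<longleftrightarrow> j \<le> part \<mu> i"
proof -
  let ?D = "{k. k < length \<mu> \<and> j \<le> \<mu> ! k}"
  have "?D = {..<card ?D}"
  proof (rule down_closed_eq_lessThan)
    fix i' k assume "k \<in> ?D" "i' \<le> k"
    then show "i' \<in> ?D" using part_antimono[OF \<mu>, of "Suc i'" "Suc k"] by (auto simp: part_eq_nth)
  qed simp
  then have "i - 1 \<in> ?D \<longleftrightarrow> i - 1 < card ?D" by (metis lessThan_iff)
  moreover have "card ?D = part (conj_part \<mu>) j" by (simp add: part_conj_eq[OF \<mu> ij(2)] length_filter_conv_card)
  moreover have "i - 1 \<in> ?D \<longleftrightarrow> j \<le> part \<mu> i" using ij by (auto simp: part_def)
  ultimately show ?thesis using ij by auto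
qed

lemma conj_part_in:
  assumes \<mu>: "\<mu> \<in> partitions n"
  shows "conj_part \<mu> \<in> partitions n"
proof -
  let ?\<nu> = "conj_part \<mu>" and ?M = "part \<mu> 1"
  have len: "length ?\<nu> = ?M" by (simp add: conj_part_def del: upt_Suc)
  have nth: "?\<nu> ! k = part ?\<nu> (Suc k)" if "k < ?M" for k using that len by (simp add: part_eq_nth)
  have anti: "part ?\<nu> j \<le> part ?\<nu> i" if "1 \<le> i" "i \<le> j" for i j
  proof (cases "part ?\<nu> j = 0")
    case False
    then show ?thesis
      using conj_part_galois[OF \<mu>, of "part ?\<nu> j" j] conj_part_galois[OF \<mu>, of "part ?\<nu> j" i] that by auto
  qed simp
  have "sorted_wrt (\<ge>) ?\<nu>"
    unfolding sorted_wrt_iff_nth_less by (simp add: len nth anti)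
  moreover have "0 \<notin> set ?\<nu>"
  proof
    assume "0 \<in> set ?\<nu>"
    then obtain k where "k < ?M" "part ?\<nu> (Suc k) = 0" using nth len by (auto simp: in_set_conv_nth)
    then show False using conj_part_galois[OF \<mu>, of 1 "Suc k"] by simp
  qed
  moreover have "sum_list ?\<nu> = n"
  proof -
    have "sum_list ?\<nu> = (\<Sum>k<?M. part ?\<nu> (Suc k))"
      by (simp add: sum_list_sum_nth len nth atLeast0LessThan)
    also have "\<dots> = (\<Sum>k<?M. \<Sum>i<length \<mu>. if Suc k \<le> part \<mu> (Suc i) then 1 else 0)"
    proof (intro sum.cong refl)
      fix k
      have "part ?\<nu> (Suc k) = card {i. i < length \<mu> \<and> Suc k \<le> \<mu> ! i}"
        using part_conj_eq[OF \<mu>, of "Suc k"] by (simp add: length_filter_conv_card)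
      also have "{i. i < length \<mu> \<and> Suc k \<le> \<mu> ! i} = {i\<in>{..<length \<mu>}. Suc k \<le> part \<mu> (Suc i)}"
        by (auto simp: part_eq_nth)
      finally show "part ?\<nu> (Suc k) = (\<Sum>i<length \<mu>. if Suc k \<le> part \<mu> (Suc i) then 1 else 0)"
        by (simp add: sum.If_cases Int_def)
    qed
    also have "\<dots> = (\<Sum>i<length \<mu>. \<Sum>k<?M. if Suc k \<le> part \<mu> (Suc i) then 1 else 0)" by (rule sum.swap)
    also have "\<dots> = (\<Sum>i<length \<mu>. part \<mu> (Suc i))"
    proof (intro sum.cong refl)
      fix i
      have "{k. k < ?M \<and> Suc k \<le> part \<mu> (Suc i)} = {..<part \<mu> (Suc i)}"
        using part_antimono[OF \<mu>, of 1 "Suc i"] by auto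
      then show "(\<Sum>k<?M. if Suc k \<le> part \<mu> (Suc i) then 1 else 0) = part \<mu> (Suc i)"
        by (simp add: sum.If_cases Int_def)
    qed
    finally show ?thesis using sum_part_eq[OF \<mu> order_refl] by simp
  qed
  ultimately show ?thesis by (simp add: partitions_def)
qed

text \<open>The boundary of the diagram is a sequence of vertical steps (beads) and horizontal steps (gaps);
  transposing the diagram reverses it and exchanges the two kinds.\<close>

lemma beads_conj:
  assumes \<mu>: "\<mu> \<in> partitions n"
  shows "x \<in> beads (conj_part \<mu>) \<longleftrightarrow> - 1 - x \<notin> beads \<mu>"
proof
  assume "x \<in> beads (conj_part \<mu>)"
  then obtain j where j: "1 \<le> j" "x = int (part (conj_part \<mu>) j) - int j" by (auto simp: beads_def)
  show "- 1 - x \<notin> beads \<mu>"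
  proof
    assume "- 1 - x \<in> beads \<mu>"
    then obtain i where i: "1 \<le> i" "- 1 - x = int (part \<mu> i) - int i" by (auto simp: beads_def)
    show False using conj_part_galois[OF \<mu> i(1) j(1)] i(2) j(2) by linarith
  qed
next
  assume nb: "- 1 - x \<notin> beads \<mu>"
  define y where "y = - 1 - x"
  have nb: "int (part \<mu> (Suc i)) - int (Suc i) \<noteq> y" for i
  proof
    assume "int (part \<mu> (Suc i)) - int (Suc i) = y"
    then have "y \<in> beads \<mu>" unfolding beads_def by (intro CollectI exI[of _ "Suc i"]) simp
    then show False using nb by (simp add: y_def)
  qed
  let ?Q = "\<lambda>i. int (part \<mu> (Suc i)) - int (Suc i) < y"
  have "?Q (length \<mu> + nat \<bar>y\<bar>)" by (simp add: part_beyond)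
  define i0 where "i0 = (LEAST i. ?Q i)"
  have Q: "?Q i0" unfolding i0_def by (rule LeastI) (rule \<open>?Q (length \<mu> + nat \<bar>y\<bar>)\<close>)
  have nQ: "\<not> ?Q i" if "i < i0" for i using that unfolding i0_def by (rule not_less_Least)
  define j where "j = nat (y + int i0 + 1)"
  have j: "int j = y + int i0 + 1" "1 \<le> j" using Q by (auto simp: j_def)
  have "part (conj_part \<mu>) j = i0"
  proof (rule antisym)
    show "part (conj_part \<mu>) j \<le> i0"
      using conj_part_galois[OF \<mu>, of "Suc i0" j] j Q by linarith
    show "i0 \<le> part (conj_part \<mu>) j"
    proof (cases i0)
      case (Suc i)
      then show ?thesis using conj_part_galois[OF \<mu>, of i0 j] j nQ[of i] nb[of i] by simp
    qed simp
  qed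
  then have "x = int (part (conj_part \<mu>) j) - int j" using j by (simp add: y_def)
  then show "x \<in> beads (conj_part \<mu>)" unfolding beads_def using j(2) by blast
qed

definition runner_bead :: "nat \<Rightarrow> nat \<Rightarrow> nat list \<Rightarrow> int \<Rightarrow> bool" where
  "runner_bead p j \<mu> m \<longleftrightarrow> int p * m + (int j - 1) \<in> beads \<mu>"

lemma bead_low: "y < - int (length \<mu>) \<Longrightarrow> y \<in> beads \<mu>"
  unfolding beads_def by (intro CollectI exI[of _ "nat (- y)"]) (auto simp: part_beyond)

lemma bead_le:
  assumes "\<mu> \<in> partitions n" "y \<in> beads \<mu>"
  shows "y \<le> int (part \<mu> 1)"
proof -
  obtain i where "1 \<le> i" "y = int (part \<mu> i) - int i" using assms(2) by (auto simp: beads_def)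
  then show ?thesis using part_antimono[OF assms(1), of 1 i] by simp
qed

text \<open>The runner contributes no part if no bead has a gap below it; the set listed by the \<open>p\<close>-quotient is
  finite since all low positions are beads and all high ones gaps.\<close>

lemma p_quotient_empty_iff:
  assumes \<mu>: "\<mu> \<in> partitions n" and p: "0 < p" and j: "1 \<le> j"
  shows "p_quotient p \<mu> j = [] \<longleftrightarrow> (\<forall>m m'. runner_bead p j \<mu> m \<longrightarrow> m' < m \<longrightarrow> runner_bead p j \<mu> m')"
proof -
  have low: "- int (length \<mu>) - int j \<le> m'" if "\<not> runner_bead p j \<mu> m'" for m'
  proof (rule ccontr)
    assume "\<not> ?thesis"
    then have "m' < - int (length \<mu>) - int j" by simp
    moreover from this have "int p * m' \<le> m'" using p mult_right_mono_neg[of 1 "int p" m'] by simp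
    ultimately have "int p * m' + (int j - 1) < - int (length \<mu>)" by linarith
    then show False using bead_low that by (auto simp: runner_bead_def)
  qed
  have fin: "finite {m'. m' < m \<and> int p * m' + (int j - 1) \<notin> beads \<mu>}" for m
    by (rule finite_subset[of _ "{- int (length \<mu>) - int j..m}"]) (use low in \<open>auto simp: runner_bead_def\<close>)
  have gaps: "gaps_below p \<mu> j m = 0 \<longleftrightarrow> (\<forall>m'<m. runner_bead p j \<mu> m')" for m
    using fin[of m] by (auto simp: gaps_below_def runner_bead_def)
  let ?S = "{m. int p * m + (int j - 1) \<in> beads \<mu> \<and> gaps_below p \<mu> j m \<noteq> 0}"
  have "?S \<subseteq> {- int (length \<mu>) - int j..int (part \<mu> 1)}"
  proof
    fix m assume m: "m \<in> ?S"
    then have "\<not> (\<forall>m'<m. runner_bead p j \<mu> m')" unfolding gaps[symmetric] by simp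
    then obtain m' where "m' < m" "\<not> runner_bead p j \<mu> m'" by auto
    then have "- int (length \<mu>) - int j \<le> m" using low by fastforce
    moreover have "m \<le> int (part \<mu> 1)"
    proof (cases "0 \<le> m")
      case True
      then have "m \<le> int p * m" using p mult_right_mono[of 1 "int p" m] by simp
      then show ?thesis using bead_le[OF \<mu>, of "int p * m + (int j - 1)"] m j by simp
    qed simp
    ultimately show "m \<in> {- int (length \<mu>) - int j..int (part \<mu> 1)}" by simp
  qed
  then have "finite ?S" by (rule finite_subset) simp
  then have "p_quotient p \<mu> j = [] \<longleftrightarrow> ?S = {}"
    by (simp add: p_quotient_def)
  also have "\<dots> \<longleftrightarrow> (\<forall>m. runner_bead p j \<mu> m \<longrightarrow> (\<forall>m'<m. runner_bead p j \<mu> m'))"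
    using gaps by (auto simp: runner_bead_def)
  finally show ?thesis by blast
qed

lemma down_closed_int_iff:
  "(\<forall>m m'. B m \<longrightarrow> m' < m \<longrightarrow> B m') \<longleftrightarrow> (\<forall>m :: int. B m \<longrightarrow> B (m - 1))"
proof
  assume step: "\<forall>m. B m \<longrightarrow> B (m - 1)"
  have "B (m - int k)" if "B m" for m k
  proof (induction k)
    case (Suc k)
    have "m - int (Suc k) = (m - int k) - 1" by simp
    then show ?case using step Suc by metis
  qed (simp add: that)
  from this[of _ "nat (_ - _)"] show "\<forall>m m'. B m \<longrightarrow> m' < m \<longrightarrow> B m'"
    by (metis diff_diff_eq2 add_diff_cancel_left' int_nat_eq less_imp_le zle_diff1_eq diff_ge_0_iff_ge)
qed auto

text \<open>With a number of beads divisible by \<open>p\<close>, positions on the runners are shifted by a multiple of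
  \<open>p\<close> only, so runner \<open>j\<close> consists of the entries of \<open>beta_vec\<close> congruent to \<open>j - 1\<close>.\<close>

lemma p_quotient_empty_iff_flat:
  assumes \<mu>: "\<mu> \<in> partitions n" and p: "0 < p" and j: "1 \<le> j" "j \<le> p" and N: "n \<le> N" "N = p * N'"
  shows "p_quotient p \<mu> j = [] \<longleftrightarrow> flat N p (j - 1) (beta_vec N \<mu>)"
proof -
  let ?\<beta> = "beta_vec N \<mu>"
  have len: "length \<mu> \<le> N" using length_partition_le[OF \<mu>] N by simp
  have \<beta>: "int (?\<beta> i) = int (part \<mu> (Suc i)) - int (Suc i) + int N" if "i < N" for i
    using that by (simp add: beta_vec_def part_vec_def staircase_def)
  have bead: "y \<in> beads \<mu> \<longleftrightarrow> y < - int N \<or> (\<exists>i<N. int (?\<beta> i) = y + int N)" for y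
  proof
    assume "y \<in> beads \<mu>"
    then obtain i where i: "1 \<le> i" "y = int (part \<mu> i) - int i" by (auto simp: beads_def)
    show "y < - int N \<or> (\<exists>i<N. int (?\<beta> i) = y + int N)"
    proof (cases "i \<le> N")
      case True
      then show ?thesis using i \<beta>[of "i - 1"] by (intro disjI2 exI[of _ "i - 1"]) auto
    next
      case False
      then show ?thesis using i len by (simp add: part_beyond)
    qed
  next
    assume "y < - int N \<or> (\<exists>i<N. int (?\<beta> i) = y + int N)"
    then show "y \<in> beads \<mu>"
    proof
      assume "y < - int N"
      then show ?thesis using len by (intro bead_low) simp
    next
      assume "\<exists>i<N. int (?\<beta> i) = y + int N"
      then obtain i where "i < N" "int (?\<beta> i) = y + int N" by blast
      then show ?thesis using \<beta>[of i] unfolding beads_def by (intro CollectI exI[of _ "Suc i"]) simp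
    qed
  qed
  have rb: "runner_bead p j \<mu> m \<longleftrightarrow> m + int N' < 0 \<or> (\<exists>i<N. int (?\<beta> i) = int p * (m + int N') + int (j - 1))" for m
  proof -
    have "int p * m + (int j - 1) < - int N \<longleftrightarrow> int p * (m + int N') + int (j - 1) < 0"
      using j N by (simp add: algebra_simps of_nat_diff)
    also have "\<dots> \<longleftrightarrow> m + int N' < 0"
    proof
      assume "int p * (m + int N') + int (j - 1) < 0"
      then show "m + int N' < 0" using p by (metis add_nonneg_nonneg mult_nonneg_nonneg not_le of_nat_0_le_iff)
    next
      assume "m + int N' < 0"
      then have "int p * (m + int N') \<le> int p * (- 1)" by (intro mult_left_mono) auto
      then show "int p * (m + int N') + int (j - 1) < 0" using j by (simp add: of_nat_diff)
    qed
    finally show ?thesis unfolding runner_bead_def bead using j N by (simp add: algebra_simps of_nat_diff)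
  qed
  have "(\<forall>m. runner_bead p j \<mu> m \<longrightarrow> runner_bead p j \<mu> (m - 1)) \<longleftrightarrow> flat N p (j - 1) ?\<beta>"
  proof
    assume step: "\<forall>m. runner_bead p j \<mu> m \<longrightarrow> runner_bead p j \<mu> (m - 1)"
    show "flat N p (j - 1) ?\<beta>"
      unfolding flat_def
    proof (intro allI impI)
      fix i assume i: "i < N" "?\<beta> i mod p = j - 1" "p \<le> ?\<beta> i"
      define q where "q = ?\<beta> i div p"
      have q: "?\<beta> i = p * q + (j - 1)" using i(2) by (metis mult_div_mod_eq q_def)
      have q1: "1 \<le> q" using i(3) p by (simp add: q_def div_greater_zero_iff Suc_leI)
      have "runner_bead p j \<mu> (int q - int N')" unfolding rb using i(1) q by (intro disjI2 exI[of _ i]) simp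
      then have "runner_bead p j \<mu> (int q - int N' - 1)" using step by blast
      then obtain k where k: "k < N" "int (?\<beta> k) = int p * (int q - 1) + int (j - 1)" unfolding rb using q1 by auto
      have "int (?\<beta> k) = int (?\<beta> i - p)" using k(2) q i(3) by (simp add: algebra_simps of_nat_diff)
      then show "\<exists>j<N. ?\<beta> j = ?\<beta> i - p" using k(1) by (metis of_nat_eq_iff)
    qed
  next
    assume fl: "flat N p (j - 1) ?\<beta>"
    show "\<forall>m. runner_bead p j \<mu> m \<longrightarrow> runner_bead p j \<mu> (m - 1)"
    proof (intro allI impI)
      fix m assume m: "runner_bead p j \<mu> m"
      show "runner_bead p j \<mu> (m - 1)"
      proof (cases "m + int N' \<le> 0")
        case False
        then obtain q where q: "m + int N' = int (Suc q)" by (metis not_le pos_int_cases Suc_pred)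
        obtain i where i: "i < N" "int (?\<beta> i) = int p * int (Suc q) + int (j - 1)" using m q unfolding rb by auto
        have bi: "?\<beta> i = p * Suc q + (j - 1)" using i(2) by (metis of_nat_add of_nat_mult of_nat_eq_iff)
        have "?\<beta> i mod p = (j - 1) mod p" unfolding bi by (rule mod_mult_self4)
        then have "?\<beta> i mod p = j - 1" using j p by simp
        moreover have "p \<le> ?\<beta> i" unfolding bi by simp
        ultimately obtain k where k: "k < N" "?\<beta> k = ?\<beta> i - p" using fl i(1) by (auto simp: flat_def)
        have "?\<beta> k = p * q + (j - 1)" using k(2) bi by simp
        moreover have "m - 1 + int N' = int q" using q by simp
        ultimately show ?thesis unfolding rb using k(1) by (intro disjI2 exI[of _ k]) simp
      qed (simp add: rb)
    qed
  qed
  then show ?thesis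
    unfolding p_quotient_empty_iff[OF \<mu> p j(1)] down_closed_int_iff .
qed

text \<open>The reflection \<open>x \<mapsto> -1 - x\<close> maps the runner \<open>j\<close> to the runner \<open>p + 1 - j\<close>, and so the middle one to
  itself; the place \<open>m\<close> goes to \<open>- m - 1\<close>.\<close>

lemma runner_bead_conj:
  assumes "\<mu> \<in> partitions n" "odd p"
  shows "runner_bead p ((p + 1) div 2) (conj_part \<mu>) m \<longleftrightarrow> \<not> runner_bead p ((p + 1) div 2) \<mu> (- m - 1)"
proof -
  obtain k where k: "p = 2 * k + 1" using assms(2) by (rule oddE)
  have *: "- 1 - (int p * m + (int ((p + 1) div 2) - 1)) = int p * (- m - 1) + (int ((p + 1) div 2) - 1)"
    by (simp add: k algebra_simps)
  show ?thesis unfolding runner_bead_def beads_conj[OF assms(1)] * ..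
qed

lemma p_quotient_conj_empty:
  assumes \<mu>: "\<mu> \<in> partitions n" and p: "odd p" and e: "p_quotient p \<mu> ((p + 1) div 2) = []"
  shows "p_quotient p (conj_part \<mu>) ((p + 1) div 2) = []"
proof -
  have p0: "0 < p" "1 \<le> (p + 1) div 2" using p by (auto elim!: oddE)
  show ?thesis
    using e unfolding p_quotient_empty_iff[OF \<mu> p0] p_quotient_empty_iff[OF conj_part_in[OF \<mu>] p0]
      runner_bead_conj[OF \<mu> p] by (metis diff_strict_right_mono neg_less_iff_less)
qed

text \<open>The diagonal hooks have the lengths \<open>2 x + 1\<close> for the beads \<open>x = \<mu>\<^sub>i - i \<ge> 0\<close>, and for \<open>p = 2 k + 1\<close> this is
  divisible by \<open>p\<close> if and only if \<open>x\<close> is congruent to \<open>k\<close>, that is, on the middle runner.\<close>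

lemma p_regular_diag_hooks_iff:
  assumes \<mu>: "\<mu> \<in> partitions n" and p: "odd p"
  shows "p_regular_partition p (diag_hooks \<mu>) \<longleftrightarrow> (\<forall>m\<ge>0. \<not> runner_bead p ((p + 1) div 2) \<mu> m)"
proof -
  obtain k where k: "p = 2 * k + 1" using p by (rule oddE)
  have c: "int ((p + 1) div 2) - 1 = int k" by (simp add: k)
  have dvd: "p dvd 2 * x + 1 \<longleftrightarrow> (\<exists>m\<ge>0. int x = int p * m + int k)" for x
  proof
    assume "p dvd 2 * x + 1"
    then obtain q where q: "2 * x + 1 = p * q" by (auto elim: dvdE)
    have "odd (p * q)" by (simp flip: q)
    then have "odd q" by simp
    then obtain m where m: "q = 2 * m + 1" by (rule oddE)
    have "2 * x + 1 = 2 * (p * m + k) + 1" using q by (simp add: m k algebra_simps)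
    then have "int x = int p * int m + int k" by (metis add_right_cancel mult_cancel1 of_nat_add of_nat_mult zero_neq_numeral)
    then show "\<exists>m\<ge>0. int x = int p * m + int k" by (intro exI[of _ "int m"]) simp
  next
    assume "\<exists>m\<ge>0. int x = int p * m + int k"
    then obtain m where "int x = int p * m + int k" by blast
    then have "int (2 * x + 1) = int p * (2 * m + 1)" by (simp add: k algebra_simps)
    then have "int p dvd int (2 * x + 1)" by (metis dvd_triv_left)
    then show "p dvd 2 * x + 1" by (simp only: int_dvd_int_iff)
  qed
  have set: "set (diag_hooks \<mu>) = {2 * (part \<mu> i - i) + 1 | i. 1 \<le> i \<and> i \<le> part \<mu> i}"
  proof -
    have "set (diag_hooks \<mu>) = {2 * part \<mu> i - (2 * i - 1) | i. 1 \<le> i \<and> i \<le> length \<mu> \<and> i \<le> part \<mu> i}"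
      by (auto simp: diag_hooks_def)
    also have "\<dots> = {2 * (part \<mu> i - i) + 1 | i. 1 \<le> i \<and> i \<le> part \<mu> i}"
    proof -
      have "i \<le> length \<mu>" if "1 \<le> i" "i \<le> part \<mu> i" for i using that part_beyond[of \<mu> i] by (cases "i \<le> length \<mu>") auto
      moreover have "2 * part \<mu> i - (2 * i - 1) = 2 * (part \<mu> i - i) + 1" if "1 \<le> i" "i \<le> part \<mu> i" for i
        using that by auto
      ultimately show ?thesis by (intro Collect_cong ex_cong1) metis
    qed
    finally show ?thesis .
  qed
  have "\<not> p_regular_partition p (diag_hooks \<mu>) \<longleftrightarrow> (\<exists>i. 1 \<le> i \<and> i \<le> part \<mu> i \<and> p dvd 2 * (part \<mu> i - i) + 1)"
    unfolding p_regular_partition_def set by blast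
  also have "\<dots> \<longleftrightarrow> (\<exists>i. 1 \<le> i \<and> i \<le> part \<mu> i \<and> (\<exists>m\<ge>0. int (part \<mu> i - i) = int p * m + int k))"
    unfolding dvd ..
  also have "\<dots> \<longleftrightarrow> (\<exists>m\<ge>0. runner_bead p ((p + 1) div 2) \<mu> m)"
  proof
    assume "\<exists>i. 1 \<le> i \<and> i \<le> part \<mu> i \<and> (\<exists>m\<ge>0. int (part \<mu> i - i) = int p * m + int k)"
    then obtain i m where "1 \<le> i" "i \<le> part \<mu> i" "0 \<le> m" "int (part \<mu> i - i) = int p * m + int k" by blast
    then show "\<exists>m\<ge>0. runner_bead p ((p + 1) div 2) \<mu> m"
      unfolding runner_bead_def c beads_def by (intro exI[of _ m]) (auto simp: of_nat_diff intro!: exI[of _ i])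
  next
    assume "\<exists>m\<ge>0. runner_bead p ((p + 1) div 2) \<mu> m"
    then obtain m i where m: "0 \<le> m" "1 \<le> i" "int p * m + int k = int (part \<mu> i) - int i"
      unfolding runner_bead_def c beads_def by blast
    have "0 \<le> int p * m + int k" using m(1) by simp
    then have "i \<le> part \<mu> i" using m(3) by simp
    then show "\<exists>i. 1 \<le> i \<and> i \<le> part \<mu> i \<and> (\<exists>m\<ge>0. int (part \<mu> i - i) = int p * m + int k)"
      using m by (intro exI[of _ i] conjI exI[of _ m]) (auto simp: of_nat_diff)
  qed
  finally show ?thesis by blast
qed

text \<open>On the middle runner of a self-conjugate partition exactly one of the places \<open>m\<close> and \<open>- m - 1\<close> carries
  a bead, so its beads are pushed down if and only if they are the negative places.\<close>

lemma self_conjugate_empty_iff: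
  assumes \<mu>: "\<mu> \<in> partitions n" and p: "odd p" and self: "\<mu> = conj_part \<mu>"
  shows "p_quotient p \<mu> ((p + 1) div 2) = [] \<longleftrightarrow> p_regular_partition p (diag_hooks \<mu>)"
proof -
  have p0: "0 < p" "1 \<le> (p + 1) div 2" using p by (auto elim!: oddE)
  let ?B = "runner_bead p ((p + 1) div 2) \<mu>"
  have sym: "?B m \<longleftrightarrow> \<not> ?B (- m - 1)" for m
    using runner_bead_conj[OF \<mu> p, of m] self by simp
  show ?thesis
    unfolding p_quotient_empty_iff[OF \<mu> p0] p_regular_diag_hooks_iff[OF \<mu> p]
  proof
    assume down: "\<forall>m m'. ?B m \<longrightarrow> m' < m \<longrightarrow> ?B m'"
    show "\<forall>m\<ge>0. \<not> ?B m"
    proof (intro allI impI notI)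
      fix m :: int assume "0 \<le> m" "?B m"
      moreover from \<open>0 \<le> m\<close> have "- m - 1 < m" by simp
      ultimately have "?B (- m - 1)" using down by blast
      then show False using sym \<open>?B m\<close> by blast
    qed
  next
    assume none: "\<forall>m\<ge>0. \<not> ?B m"
    have neg: "?B m" if "m < 0" for m using sym[of m] none that by simp
    show "\<forall>m m'. ?B m \<longrightarrow> m' < m \<longrightarrow> ?B m'"
    proof (intro allI impI)
      fix m m' assume "?B m" "m' < m"
      then have "m < 0" using none not_le by blast
      then show "?B m'" using neg \<open>m' < m\<close> by simp
    qed
  qed
qed

section \<open>Permutation characters of the symmetric group\<close>

text \<open>The permutation matrices scaled by \<open>s\<close> form a representation, and its trace counts fixed points.\<close>

lemma is_character_action:
  fixes G (structure)
  assumes G: "group G" and fin: "finite \<Omega>"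
    and act: "\<And>g f. g \<in> carrier G \<Longrightarrow> f \<in> \<Omega> \<Longrightarrow> act g f \<in> \<Omega>"
    and act_mult: "\<And>g h f. g \<in> carrier G \<Longrightarrow> h \<in> carrier G \<Longrightarrow> f \<in> \<Omega> \<Longrightarrow> act (g \<otimes> h) f = act g (act h f)"
    and act_one: "\<And>f. f \<in> \<Omega> \<Longrightarrow> act \<one> f = f"
    and s_mult: "\<And>g h. g \<in> carrier G \<Longrightarrow> h \<in> carrier G \<Longrightarrow> s (g \<otimes> h) = s g * s h" and s_one: "s \<one> = 1"
  shows "is_character G (\<lambda>g. if g \<in> carrier G then s g * of_nat (card {f \<in> \<Omega>. act g f = f}) else 0)"
proof -
  define d where "d = card \<Omega>"
  obtain e where e: "bij_betw e {..<d} \<Omega>"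
    using ex_bij_betw_nat_finite[OF fin] by (auto simp: d_def atLeast0LessThan)
  have eI: "e i \<in> \<Omega>" if "i < d" for i using e that by (auto simp: bij_betw_def)
  have einj: "e i = e j \<longleftrightarrow> i = j" if "i < d" "j < d" for i j
    using e that by (auto simp: bij_betw_def inj_on_def)
  define \<rho> where "\<rho> g = mat d d (\<lambda>(i, j). if e i = act g (e j) then s g else 0)" for g
  have \<rho>C: "\<rho> g \<in> carrier_mat d d" for g by (simp add: \<rho>_def)
  have "matrix_rep G d \<rho>"
  proof (rule matrix_repI[OF G])
    fix g h assume g: "g \<in> carrier G" and h: "h \<in> carrier G"
    show "\<rho> (g \<otimes> h) = \<rho> g * \<rho> h"
    proof (rule eq_matI)
      fix i j assume "i < dim_row (\<rho> g * \<rho> h)" "j < dim_col (\<rho> g * \<rho> h)"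
      then have ij: "i < d" "j < d" by (auto simp: \<rho>_def)
      have "act h (e j) \<in> e ` {..<d}" using act[OF h eI[OF ij(2)]] e by (simp add: bij_betw_def)
      then obtain k where k: "k < d" "e k = act h (e j)" by auto
      have "(\<rho> g * \<rho> h) $$ (i, j) = (\<Sum>l<d. \<rho> g $$ (i, l) * \<rho> h $$ (l, j))"
        by (rule mult_entry[OF \<rho>C \<rho>C ij])
      also have "\<dots> = (\<Sum>l<d. if l = k then (if e i = act g (e k) then s g * s h else 0) else 0)"
        using ij k by (intro sum.cong) (auto simp: \<rho>_def einj simp flip: k(2))
      also have "\<dots> = (if e i = act g (e k) then s g * s h else 0)" using k by simp
      also have "\<dots> = \<rho> (g \<otimes> h) $$ (i, j)"
        using ij k g h by (simp add: \<rho>_def act_mult eI s_mult)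
      finally show "\<rho> (g \<otimes> h) $$ (i, j) = (\<rho> g * \<rho> h) $$ (i, j)" ..
    qed (auto simp: \<rho>_def)
  next
    show "\<rho> \<one> = 1\<^sub>m d" by (rule eq_matI) (auto simp: \<rho>_def act_one eI einj s_one)
  qed (rule \<rho>C)
  then have "is_character G (rep_character G d \<rho>)"
    unfolding is_character_def by (rule character_decomposition[OF G])
  also have "rep_character G d \<rho> = (\<lambda>g. if g \<in> carrier G then s g * of_nat (card {f \<in> \<Omega>. act g f = f}) else 0)"
  proof
    fix g
    have "bij_betw e {i\<in>{..<d}. e i = act g (e i)} {f \<in> \<Omega>. act g f = f}"
      using e unfolding bij_betw_def by (auto simp: inj_on_def image_iff eq_commute)
    then have "card {i\<in>{..<d}. e i = act g (e i)} = card {f \<in> \<Omega>. act g f = f}" by (rule bij_betw_same_card)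
    moreover have "(\<Sum>i<d. \<rho> g $$ (i, i)) = (\<Sum>i<d. if e i = act g (e i) then s g else 0)"
      by (intro sum.cong) (auto simp: \<rho>_def)
    ultimately show "rep_character G d \<rho> g = (if g \<in> carrier G then s g * of_nat (card {f \<in> \<Omega>. act g f = f}) else 0)"
      by (simp add: rep_character_def sum.If_cases Int_def)
  qed
  finally show ?thesis .
qed

lemma sym_carrier [simp]: "carrier (sym_group n) = {g. g permutes {1..n}}"
  by (simp add: sym_group_def)

lemma finite_sym_carrier: "finite (carrier (sym_group n))"
  by (simp add: finite_permutations)

lemma card_sym_carrier: "card (carrier (sym_group n)) = fact n"
  by (simp add: card_permutations)

lemma sym_inv: "g permutes {1..n} \<Longrightarrow> inv\<^bsub>sym_group n\<^esub> g = inv_into UNIV g"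
  by simp

text \<open>The colourings with \<open>a i\<close> points of colour \<open>i\<close>: for a partition \<open>a\<close>, a model of the cosets of the
  Young subgroup.\<close>

definition colourings_of :: "nat \<Rightarrow> nat \<Rightarrow> (nat \<Rightarrow> nat) \<Rightarrow> (nat \<Rightarrow> nat) set" where
  "colourings_of N n a = {f \<in> {1..n} \<rightarrow>\<^sub>E {..<N}. content {1..n} f = a}"

definition twisted_perm_char ::
  "((nat \<Rightarrow> nat) \<Rightarrow> complex) \<Rightarrow> nat \<Rightarrow> nat \<Rightarrow> (nat \<Rightarrow> nat) \<Rightarrow> (nat \<Rightarrow> nat) \<Rightarrow> complex" where
  "twisted_perm_char s N n a = (\<lambda>g. if g permutes {1..n}
     then s g * of_nat (card {f \<in> colourings_of N n a. \<forall>x\<in>{1..n}. f (g x) = f x}) else 0)"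

abbreviation perm_char :: "nat \<Rightarrow> nat \<Rightarrow> (nat \<Rightarrow> nat) \<Rightarrow> (nat \<Rightarrow> nat) \<Rightarrow> complex" where
  "perm_char \<equiv> twisted_perm_char (\<lambda>_. 1)"

abbreviation sign_perm_char :: "nat \<Rightarrow> nat \<Rightarrow> (nat \<Rightarrow> nat) \<Rightarrow> (nat \<Rightarrow> nat) \<Rightarrow> complex" where
  "sign_perm_char \<equiv> twisted_perm_char (\<lambda>g. of_int (sign g))"

lemma finite_colourings_of [simp]: "finite (colourings_of N n a)"
  unfolding colourings_of_def by (rule finite_subset[OF _ finite_PiE[of "{1..n}" "\<lambda>_. {..<N}"]]) auto

lemma content_comp_perm:
  assumes "\<sigma> permutes X"
  shows "content X (restrict (f \<circ> \<sigma>) X) = content X f"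
proof
  fix k
  have "bij_betw \<sigma> {x\<in>X. f (\<sigma> x) = k} {x\<in>X. f x = k}"
    unfolding bij_betw_def
  proof
    show "inj_on \<sigma> {x\<in>X. f (\<sigma> x) = k}" using permutes_inj[OF assms] by (simp add: inj_on_def inj_def)
    have "\<sigma> ` {x\<in>X. f (\<sigma> x) = k} = {z \<in> \<sigma> ` X. f z = k}" by auto
    then show "\<sigma> ` {x\<in>X. f (\<sigma> x) = k} = {x\<in>X. f x = k}" by (simp only: permutes_image[OF assms])
  qed
  then show "content X (restrict (f \<circ> \<sigma>) X) k = content X f k"
    by (simp add: content_def bij_betw_same_card cong: conj_cong)
qed

lemma colourings_of_comp:
  assumes "\<sigma> permutes {1..n}" "f \<in> colourings_of N n a"
  shows "restrict (f \<circ> \<sigma>) {1..n} \<in> colourings_of N n a"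
  using assms content_comp_perm[OF assms(1), of f] permutes_in_image[OF assms(1)]
  by (auto simp: colourings_of_def)

lemma is_character_twisted:
  assumes s: "\<And>g h. g permutes {1..n} \<Longrightarrow> h permutes {1..n} \<Longrightarrow> s (g \<circ> h) = s g * s h" and s1: "s id = 1"
  shows "is_character (sym_group n) (twisted_perm_char s N n a)"
proof -
  let ?X = "{1..n}" and ?i = "inv_into UNIV :: (nat \<Rightarrow> nat) \<Rightarrow> nat \<Rightarrow> nat"
  define act where "act g f = restrict (f \<circ> ?i g) ?X" for g and f :: "nat \<Rightarrow> nat"
  have out: "f x = undefined" if "f \<in> colourings_of N n a" "x \<notin> ?X" for f x
    using that by (auto simp: colourings_of_def PiE_def extensional_def)
  have "is_character (sym_group n) (\<lambda>g. if g \<in> carrier (sym_group n)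
      then s g * of_nat (card {f \<in> colourings_of N n a. act g f = f}) else 0)"
  proof (rule is_character_action[OF sym_group_is_group])
    fix g f assume "g \<in> carrier (sym_group n)" "f \<in> colourings_of N n a"
    then show "act g f \<in> colourings_of N n a"
      unfolding act_def by (intro colourings_of_comp) (auto intro: permutes_inv)
  next
    fix g h f assume gh: "g \<in> carrier (sym_group n)" "h \<in> carrier (sym_group n)" and f: "f \<in> colourings_of N n a"
    have "?i (g \<circ> h) = ?i h \<circ> ?i g" using gh by (intro o_inv_distrib) (auto intro: permutes_bij)
    moreover have "?i g x \<in> ?X" if "x \<in> ?X" for x
      using that gh permutes_in_image[OF permutes_inv[of g ?X], of x] by simp
    ultimately show "act (g \<otimes>\<^bsub>sym_group n\<^esub> h) f = act g (act h f)"
      by (auto simp: act_def sym_group_mult fun_eq_iff)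
  next
    fix f assume f: "f \<in> colourings_of N n a"
    show "act \<one>\<^bsub>sym_group n\<^esub> f = f"
      using out[OF f] by (auto simp: act_def sym_group_one fun_eq_iff)
  qed (use s s1 in \<open>auto simp: sym_group_mult sym_group_one\<close>)
  also have "(\<lambda>g. if g \<in> carrier (sym_group n)
      then s g * of_nat (card {f \<in> colourings_of N n a. act g f = f}) else 0) = twisted_perm_char s N n a"
  proof
    fix g
    show "(if g \<in> carrier (sym_group n) then s g * of_nat (card {f \<in> colourings_of N n a. act g f = f}) else 0)
      = twisted_perm_char s N n a g"
    proof (cases "g permutes ?X")
      case g: True
      have "act g f = f \<longleftrightarrow> (\<forall>x\<in>?X. f (g x) = f x)" if f: "f \<in> colourings_of N n a" for f
      proof
        assume *: "act g f = f"
        show "\<forall>x\<in>?X. f (g x) = f x"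
        proof
          fix x assume "x \<in> ?X"
          then have "g x \<in> ?X" using permutes_in_image[OF g] by simp
          then have "act g f (g x) = f x" using permutes_inverses(2)[OF g] by (simp add: act_def)
          then show "f (g x) = f x" using * by simp
        qed
      next
        assume *: "\<forall>x\<in>?X. f (g x) = f x"
        show "act g f = f"
        proof
          fix x show "act g f x = f x"
          proof (cases "x \<in> ?X")
            case True
            then have "?i g x \<in> ?X" using permutes_in_image[OF permutes_inv[OF g], of x] by simp
            then have "f (g (?i g x)) = f (?i g x)" using * by blast
            then show ?thesis using True permutes_inverses(1)[OF g] by (simp add: act_def)
          qed (use out[OF f] in \<open>auto simp: act_def\<close>)
        qed
      qed
      then have "{f \<in> colourings_of N n a. act g f = f} = {f \<in> colourings_of N n a. \<forall>x\<in>?X. f (g x) = f x}" by blast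
      then show ?thesis using g by (simp add: twisted_perm_char_def)
    qed (simp add: twisted_perm_char_def)
  qed
  finally show ?thesis .
qed

lemma sign_comp_sym:
  "g permutes {1..n :: nat} \<Longrightarrow> h permutes {1..n} \<Longrightarrow> sign (g \<circ> h) = sign g * sign h"
  using permutation_permutes finite_atLeastAtMost by (intro sign_compose) blast+

lemma is_character_perm_char: "is_character (sym_group n) (perm_char N n a)"
  by (rule is_character_twisted) simp_all

lemma is_character_sign_perm_char: "is_character (sym_group n) (sign_perm_char N n a)"
  by (rule is_character_twisted) (simp_all add: sign_comp_sym sign_id)

text \<open>The value at a partition shifted by the staircase is Frobenius' formula for the irreducible character;
  by \<open>det_char_expand\<close> it is also the determinantal form \<open>\<Sum>\<^sub>w sgn w \<xi>\<^bsup>\<beta> - \<delta> w\<^esup>\<close> in the permutation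
  characters \<open>\<xi>\<close>.\<close>

definition det_char :: "nat \<Rightarrow> nat \<Rightarrow> (nat \<Rightarrow> nat) \<Rightarrow> (nat \<Rightarrow> nat) \<Rightarrow> complex" where
  "det_char N n \<beta> = (\<lambda>g. if g permutes {1..n} then Psi N {1..n} g \<beta> else 0)"

lemma det_char_expand:
  "det_char N n \<beta> g = (\<Sum>w | w permutes {..<N}. of_int (sign w) *
     (if \<forall>i. staircase N (w i) \<le> \<beta> i then perm_char N n (\<lambda>i. \<beta> i - staircase N (w i)) g else 0))"
proof (cases "g permutes {1..n}")
  case g: True
  let ?X = "{1..n}"
  have "det_char N n \<beta> g = (\<Sum>w | w permutes {..<N}. \<Sum>f\<in>colourings N ?X g.
      of_int (sign w) * (if \<beta> = (\<lambda>i. content ?X f i + staircase N (w i)) then 1 else 0))"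
    unfolding det_char_def if_P[OF g] Psi_def frob_coeff_def by (rule sum.swap)
  also have "\<dots> = (\<Sum>w | w permutes {..<N}. of_int (sign w) *
     (if \<forall>i. staircase N (w i) \<le> \<beta> i then perm_char N n (\<lambda>i. \<beta> i - staircase N (w i)) g else 0))"
  proof (rule sum.cong[OF refl])
    fix w
    let ?a = "\<lambda>i. \<beta> i - staircase N (w i)"
    have "(\<Sum>f\<in>colourings N ?X g. of_int (sign w) * (if \<beta> = (\<lambda>i. content ?X f i + staircase N (w i)) then 1 else 0))
       = (of_int (sign w) * of_nat (card {f \<in> colourings N ?X g. \<beta> = (\<lambda>i. content ?X f i + staircase N (w i))}) :: complex)"
      by (simp add: sum.If_cases Int_def flip: sum_distrib_left)
    also have "{f \<in> colourings N ?X g. \<beta> = (\<lambda>i. content ?X f i + staircase N (w i))}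
       = (if \<forall>i. staircase N (w i) \<le> \<beta> i then {f \<in> colourings_of N n ?a. \<forall>x\<in>?X. f (g x) = f x} else {})"
    proof (cases "\<forall>i. staircase N (w i) \<le> \<beta> i")
      case True
      then have "\<beta> = (\<lambda>i. c i + staircase N (w i)) \<longleftrightarrow> c = ?a" for c
        by (auto simp: fun_eq_iff le_diff_conv2 intro!: le_add_diff_inverse2[symmetric])
      then show ?thesis using True by (auto simp: colourings_def colourings_of_def)
    next
      case False
      then have "\<beta> \<noteq> (\<lambda>i. c i + staircase N (w i))" for c by auto
      then show ?thesis using False by auto
    qed
    finally show "(\<Sum>f\<in>colourings N ?X g. of_int (sign w) * (if \<beta> = (\<lambda>i. content ?X f i + staircase N (w i)) then 1 else 0))
      = of_int (sign w) * (if \<forall>i. staircase N (w i) \<le> \<beta> i then perm_char N n ?a g else 0)"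
      using g by (simp add: twisted_perm_char_def)
  qed
  finally show ?thesis .
qed (simp add: det_char_def twisted_perm_char_def)

lemma Psi_inv:
  assumes "g permutes X"
  shows "Psi N X (inv_into UNIV g) \<beta> = Psi N X g \<beta>"
proof -
  have "colourings N X h \<subseteq> colourings N X (inv_into UNIV h)" if h: "h permutes X" for h
  proof
    fix f assume f: "f \<in> colourings N X h"
    have "f (inv_into UNIV h x) = f x" if "x \<in> X" for x
    proof -
      have "inv_into UNIV h x \<in> X" using that permutes_in_image[OF permutes_inv[OF h], of x] by simp
      then have "f (h (inv_into UNIV h x)) = f (inv_into UNIV h x)" using f by (simp add: colourings_def)
      then show ?thesis by (simp add: permutes_inverses(1)[OF h])
    qed
    then show "f \<in> colourings N X (inv_into UNIV h)" using f by (simp add: colourings_def)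
  qed
  from this[OF assms] this[OF permutes_inv[OF assms]] show ?thesis
    unfolding Psi_def permutes_inv_inv[OF assms] by (metis subset_antisym)
qed

lemma bilin_det_char:
  assumes "\<beta> \<in> vecs N (n + stair N)" "\<gamma> \<in> vecs N (n + stair N)"
  shows "bilin (sym_group n) (det_char N n \<beta>) (det_char N n \<gamma>) = alt_delta N \<gamma> \<beta>"
proof -
  have "(\<Sum>g\<in>carrier (sym_group n). det_char N n \<beta> g * det_char N n \<gamma> (inv\<^bsub>sym_group n\<^esub> g))
      = (\<Sum>g | g permutes {1..n}. Psi N {1..n} g \<beta> * Psi N {1..n} g \<gamma>)"
    by (intro sum.cong) (auto simp: det_char_def sym_inv permutes_inv Psi_inv)
  also have "\<dots> = fact n * alt_delta N \<gamma> \<beta>"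
    using sum_Psi_Psi[of "{1..n}" \<beta> N \<gamma>] assms by simp
  finally show ?thesis unfolding bilin_def card_sym_carrier by simp
qed

lemma cnj_det_char: "cnj (det_char N n \<beta> g) = det_char N n \<beta> g"
  by (simp add: det_char_def Psi_def frob_coeff_def if_distrib cong: if_cong)

lemma det_char_inv: "g permutes {1..n} \<Longrightarrow> det_char N n \<beta> (inv_into UNIV g) = det_char N n \<beta> g"
  by (simp add: det_char_def Psi_inv permutes_inv)

lemma char_inner_det_char: "char_inner (sym_group n) \<phi> (det_char N n \<beta>) = bilin (sym_group n) \<phi> (det_char N n \<beta>)"
  unfolding char_inner_def bilin_def
  by (intro arg_cong[where f = "\<lambda>x. x / _"] sum.cong) (auto simp: cnj_det_char sym_inv det_char_inv)

abbreviation part_char :: "nat \<Rightarrow> nat \<Rightarrow> nat list \<Rightarrow> (nat \<Rightarrow> nat) \<Rightarrow> complex" where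
  "part_char N n \<mu> \<equiv> det_char N n (beta_vec N \<mu>)"

lemma bilin_part_char:
  assumes "\<mu> \<in> partitions n" "\<nu> \<in> partitions n" "n \<le> N"
  shows "bilin (sym_group n) (part_char N n \<mu>) (part_char N n \<nu>) = (if \<mu> = \<nu> then 1 else 0)"
  using bilin_det_char[OF beta_vec_in[OF assms(1,3)] beta_vec_in[OF assms(2,3)]]
    alt_delta_same_dec[OF strict_dec_beta_vec[OF assms(1)] strict_dec_beta_vec[OF assms(2)], of N]
    beta_vec_inj[OF assms(1,2)] by auto

section \<open>Identification of the irreducible characters\<close>

definition sq_norm :: "nat \<Rightarrow> (nat \<Rightarrow> nat) \<Rightarrow> nat" where
  "sq_norm N a = (\<Sum>i<N. (a i)\<^sup>2)"

lemma sq_norm_comp: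
  assumes "w permutes {..<N}"
  shows "sq_norm N (a \<circ> w) = sq_norm N a"
  unfolding sq_norm_def using sum.reindex_bij_betw[OF permutes_imp_bij[OF assms], of "\<lambda>i. (a i)\<^sup>2"] by simp

text \<open>Permuting the names of the colours.\<close>

lemma perm_char_comp:
  assumes w: "w permutes {..<N}"
  shows "twisted_perm_char s N n (a \<circ> w) = twisted_perm_char s N n a"
proof -
  let ?X = "{1..n}"
  have "bij_betw (\<lambda>f. restrict (w \<circ> f) ?X) {f \<in> colourings_of N n (a \<circ> w). \<forall>x\<in>?X. f (g x) = f x}
     {f \<in> colourings_of N n a. \<forall>x\<in>?X. f (g x) = f x}" if g: "g permutes ?X" for g
  proof -
    have gX: "g x \<in> ?X" if "x \<in> ?X" for x using that permutes_in_image[OF g] by simp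
    have c: "content ?X (restrict (v \<circ> f) ?X) = content ?X f \<circ> inv_into UNIV v" if v: "v permutes {..<N}"
      for v :: "nat \<Rightarrow> nat" and f
    proof
      fix k
      have "v (f x) = k \<longleftrightarrow> f x = inv_into UNIV v k" for x
        using permutes_inverses[OF v] by metis
      then show "content ?X (restrict (v \<circ> f) ?X) k = (content ?X f \<circ> inv_into UNIV v) k"
        by (auto simp: content_def intro!: arg_cong[where f = card])
    qed
    have lt: "v i < N" if "v permutes {..<N}" "i < N" for v i
      using that permutes_in_image[of v "{..<N}" i] by simp
    have mem: "restrict (v \<circ> f) ?X \<in> {f \<in> colourings_of N n b. \<forall>x\<in>?X. f (g x) = f x}"
      if "v permutes {..<N}" "f \<in> {f \<in> colourings_of N n (b \<circ> v). \<forall>x\<in>?X. f (g x) = f x}" for v f b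
    proof -
      have "content ?X f \<circ> inv_into UNIV v = b"
        using that(2) permutes_inverses[OF that(1)] by (auto simp: colourings_of_def fun_eq_iff)
      then have "content ?X (restrict (v \<circ> f) ?X) = b" using c[OF that(1)] by metis
      then show ?thesis using that lt[OF that(1)] gX
        by (auto simp: colourings_of_def PiE_def Pi_def)
    qed
    show ?thesis
    proof (rule bij_betw_byWitness[where f' = "\<lambda>f. restrict (inv_into UNIV w \<circ> f) ?X"])
      show "(\<lambda>f. restrict (w \<circ> f) ?X) ` {f \<in> colourings_of N n (a \<circ> w). \<forall>x\<in>?X. f (g x) = f x}
        \<subseteq> {f \<in> colourings_of N n a. \<forall>x\<in>?X. f (g x) = f x}"
        using mem[OF w] by blast
      have "a \<circ> w \<circ> inv_into UNIV w = a" by (simp add: o_assoc[symmetric] permutes_inv_o[OF w])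
      then show "(\<lambda>f. restrict (inv_into UNIV w \<circ> f) ?X) ` {f \<in> colourings_of N n a. \<forall>x\<in>?X. f (g x) = f x}
        \<subseteq> {f \<in> colourings_of N n (a \<circ> w). \<forall>x\<in>?X. f (g x) = f x}"
        using mem[OF permutes_inv[OF w], of _ "a \<circ> w"] by auto
    qed (auto simp: fun_eq_iff permutes_inverses[OF w] colourings_of_def PiE_def extensional_def)
  qed
  then show ?thesis by (auto simp: twisted_perm_char_def fun_eq_iff dest: bij_betw_same_card)
qed

text \<open>Layer by layer: each set \<open>{i. t < a i}\<close> is an initial segment, on which the sum of the distinct values
  of \<open>w\<close> is at least the sum of the indices.\<close>

lemma rearrangement:
  assumes w: "w permutes {..<N}" and anti: "\<And>i j. i \<le> j \<Longrightarrow> a j \<le> (a i :: nat)"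
  shows "0 \<le> (\<Sum>i<N. int (a i) * (int (w i) - int i))"
proof -
  have "(\<Sum>i<N. int (a i) * (int (w i) - int i)) = (\<Sum>t<a 0. \<Sum>i | i < N \<and> t < a i. int (w i) - int i)"
  proof -
    have "(\<Sum>i<N. int (a i) * (int (w i) - int i)) = (\<Sum>i<N. \<Sum>t | t < a 0 \<and> t < a i. int (w i) - int i)"
    proof (rule sum.cong[OF refl])
      fix i
      have "{t. t < a 0 \<and> t < a i} = {..<a i}" using anti[of 0 i] by auto
      then show "int (a i) * (int (w i) - int i) = (\<Sum>t | t < a 0 \<and> t < a i. int (w i) - int i)" by simp
    qed
    also have "\<dots> = (\<Sum>t<a 0. \<Sum>i | i < N \<and> t < a i. int (w i) - int i)"
      using sum.swap_restrict[of "{..<N}" "{..<a 0}" "\<lambda>i t. int (w i) - int i" "\<lambda>i t. t < a i"] by simp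
    finally show ?thesis .
  qed
  also have "0 \<le> \<dots>"
  proof (rule sum_nonneg)
    fix t
    let ?D = "{i. i < N \<and> t < a i}"
    have fin: "finite ?D" by simp
    have D: "?D = {..<card ?D}" by (rule down_closed_eq_lessThan) (use anti le_less_trans less_le_trans in \<open>auto, blast\<close>)
    have inj: "inj_on w ?D" using permutes_inj[OF w] by (simp add: inj_on_def inj_def)
    have "\<Sum>{0..<card (w ` ?D)} \<le> \<Sum>(w ` ?D)" by (rule card_sum_le_nat_sum)
    also have "\<Sum>(w ` ?D) = sum w ?D" using inj by (simp add: sum.reindex)
    finally have "(\<Sum>i\<in>?D. i) \<le> sum w ?D" using card_image[OF inj] D by (simp add: atLeast0LessThan)
    then have "int (\<Sum>i\<in>?D. i) \<le> int (sum w ?D)" by (simp only: of_nat_le_iff)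
    then show "0 \<le> (\<Sum>i\<in>?D. int (w i) - int i)" by (simp add: sum_subtractf)
  qed
  finally show ?thesis .
qed

text \<open>The vector changes by \<open>w i - i\<close>.  In the expansion of the squares the cross term is nonnegative by the
  rearrangement inequality, and the sum of the squared differences is positive.\<close>

lemma sq_norm_increases:
  assumes \<mu>: "\<mu> \<in> partitions n" and w: "w permutes {..<N}" "w \<noteq> id"
    and le: "\<forall>i. staircase N (w i) \<le> beta_vec N \<mu> i"
  shows "sq_norm N (part_vec \<mu>) < sq_norm N (\<lambda>i. beta_vec N \<mu> i - staircase N (w i))"
proof -
  let ?a = "part_vec \<mu>" and ?b = "\<lambda>i. beta_vec N \<mu> i - staircase N (w i)"
  have b: "int (?b i) = int (?a i) + (int (w i) - int i)" if "i < N" for i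
  proof -
    have "w i < N" using that permutes_in_image[OF w(1), of i] by simp
    then have "int (staircase N (w i)) = int N - 1 - int (w i)" "int (staircase N i) = int N - 1 - int i"
      using that by (auto simp: staircase_def)
    then show ?thesis using le by (simp add: of_nat_diff) (simp add: beta_vec_def)
  qed
  have "int (sq_norm N ?b) = (\<Sum>i<N. (int (?a i) + (int (w i) - int i))\<^sup>2)"
    unfolding sq_norm_def using b by simp
  also have "\<dots> = (\<Sum>i<N. (int (?a i))\<^sup>2 + 2 * (int (?a i) * (int (w i) - int i)) + (int (w i) - int i)\<^sup>2)"
    by (intro sum.cong) (auto simp: power2_eq_square algebra_simps)
  also have "\<dots> = int (sq_norm N ?a) + 2 * (\<Sum>i<N. int (?a i) * (int (w i) - int i)) + (\<Sum>i<N. (int (w i) - int i)\<^sup>2)"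
    by (simp add: sum.distrib sq_norm_def sum_distrib_left)
  finally have eq: "int (sq_norm N ?b) = int (sq_norm N ?a) + 2 * (\<Sum>i<N. int (?a i) * (int (w i) - int i)) + (\<Sum>i<N. (int (w i) - int i)\<^sup>2)" .
  have "0 \<le> (\<Sum>i<N. int (?a i) * (int (w i) - int i))"
    using part_antimono[OF \<mu>] by (intro rearrangement[OF w(1)]) (simp add: part_vec_def)
  moreover have "0 < (\<Sum>i<N. (int (w i) - int i)\<^sup>2)"
  proof -
    obtain i where i: "w i \<noteq> i" using w(2) by (auto simp: fun_eq_iff)
    then have "i < N" using permutes_not_in[OF w(1), of i] by auto
    then show ?thesis using i by (intro sum_pos2[of _ i]) auto
  qed
  ultimately show ?thesis using eq by linarith
qed

lemma sorted_vec:
  assumes "a \<in> vecs N n"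
  obtains \<mu> w where "\<mu> \<in> partitions n" "w permutes {..<N}" "part_vec \<mu> = a \<circ> w"
proof -
  obtain w where w: "w permutes {..<N}" "\<And>i j. i < j \<Longrightarrow> j < N \<Longrightarrow> a (w j) \<le> a (w i)"
    using sorting_permutation[of N a] by blast
  have "a \<circ> w \<in> vecs N n" using assms by (simp add: vecs_comp[OF w(1)])
  moreover have "(a \<circ> w) j \<le> (a \<circ> w) i" if "i < j" "j < N" for i j using w(2)[OF that] by simp
  ultimately obtain \<mu> where "\<mu> \<in> partitions n" "\<And>i. part \<mu> (Suc i) = (a \<circ> w) i"
    using partition_of_vec[of "a \<circ> w" N n] by blast
  then show thesis using that[of \<mu> w] w(1) by (auto simp: part_vec_def fun_eq_iff)
qed

lemma sq_norm_le: "a \<in> vecs N n \<Longrightarrow> sq_norm N a \<le> n * n"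
proof -
  assume a: "a \<in> vecs N n"
  have "sq_norm N a \<le> (\<Sum>i<N. n * a i)"
    unfolding sq_norm_def power2_eq_square using weak_comps_le[OF _ a] by (intro sum_mono mult_right_mono) auto
  also have "\<dots> = n * n" using a by (simp add: weak_comps_def flip: sum_distrib_left)
  finally show ?thesis .
qed

text \<open>In the determinantal expansion the identity gives the permutation character of \<open>\<mu>\<close>, and all other terms
  belong to vectors with a larger sum of squares, which induction expresses through the class
  functions of larger partitions.\<close>

lemma perm_char_triangular:
  assumes "\<mu> \<in> partitions n" and N: "n \<le> N"
  shows "perm_char N n (part_vec \<mu>) - part_char N n \<mu>
    \<in> int_fun.span (part_char N n ` {\<nu> \<in> partitions n. sq_norm N (part_vec \<mu>) < sq_norm N (part_vec \<nu>)})"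
  using assms(1)
proof (induction "n * n - sq_norm N (part_vec \<mu>)" arbitrary: \<mu> rule: less_induct)
  case (less \<mu>)
  let ?S = "\<lambda>\<mu>. {\<nu> \<in> partitions n. sq_norm N (part_vec \<mu>) < sq_norm N (part_vec \<nu>)}"
  let ?a = "\<lambda>w i. beta_vec N \<mu> i - staircase N (w i)"
  let ?ok = "\<lambda>w. \<forall>i. staircase N (w i) \<le> beta_vec N \<mu> i"
  let ?T = "\<lambda>w. int_scale (sign w) (if ?ok w then perm_char N n (?a w) else 0)"
  have id: "?ok id" "?a id = part_vec \<mu>" by (auto simp: beta_vec_def)
  have "part_char N n \<mu> = (\<Sum>w | w permutes {..<N}. ?T w)"
    by (auto simp: fun_eq_iff det_char_expand sum_fun_apply int_scale_def intro!: sum.cong)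
  also have "\<dots> = ?T id + (\<Sum>w\<in>{w. w permutes {..<N}} - {id}. ?T w)"
    by (subst sum.remove[of _ id]) (auto simp: permutes_id)
  also have "?T id = perm_char N n (part_vec \<mu>)"
    using id by (simp add: int_scale_def sign_id fun_eq_iff)
  finally have eq: "part_char N n \<mu> = perm_char N n (part_vec \<mu>) + (\<Sum>w\<in>{w. w permutes {..<N}} - {id}. ?T w)" .
  have "perm_char N n (part_vec \<mu>) - part_char N n \<mu> = - (\<Sum>w\<in>{w. w permutes {..<N}} - {id}. ?T w)"
    unfolding eq by (simp only: diff_diff_eq[symmetric] diff_self diff_0)
  also have "\<dots> \<in> int_fun.span (part_char N n ` ?S \<mu>)"
  proof (intro int_fun.span_neg int_fun.span_sum int_fun.span_scale)
    fix w assume "w \<in> {w. w permutes {..<N}} - {id}"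
    then have w: "w permutes {..<N}" "w \<noteq> id" by auto
    show "(if ?ok w then perm_char N n (?a w) else 0) \<in> int_fun.span (part_char N n ` ?S \<mu>)"
    proof (cases "?ok w")
      case True
      have "sum (\<lambda>i. ?a w i + staircase N (w i)) {..<N} = n + stair N"
        using True beta_vec_in[OF less.prems N] by (simp add: weak_comps_def)
      moreover have "sum (\<lambda>i. staircase N (w i)) {..<N} = stair N"
        using sum.reindex_bij_betw[OF permutes_imp_bij[OF w(1)], of "staircase N"] by (simp add: sum_staircase)
      ultimately have "sum (?a w) {..<N} = n" by (simp add: sum.distrib)
      moreover have "?a w i = 0" if "i \<notin> {..<N}" for i
        using that beta_vec_in[OF less.prems N] by (simp add: weak_comps_def)
      ultimately have av: "?a w \<in> vecs N n" by (simp add: weak_comps_def)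
      obtain \<nu> v where \<nu>: "\<nu> \<in> partitions n" "v permutes {..<N}" "part_vec \<nu> = ?a w \<circ> v"
        using sorted_vec[OF av] .
      have pc: "perm_char N n (part_vec \<nu>) = perm_char N n (?a w)" unfolding \<nu>(3) by (rule perm_char_comp[OF \<nu>(2)])
      have lt: "sq_norm N (part_vec \<mu>) < sq_norm N (part_vec \<nu>)"
        unfolding \<nu>(3) sq_norm_comp[OF \<nu>(2)] by (rule sq_norm_increases[OF less.prems w True])
      then have "n * n - sq_norm N (part_vec \<nu>) < n * n - sq_norm N (part_vec \<mu>)"
        using sq_norm_le[OF part_vec_in[OF \<nu>(1) N]] by simp
      from less.hyps[OF this \<nu>(1)]
      have "perm_char N n (part_vec \<nu>) - part_char N n \<nu> \<in> int_fun.span (part_char N n ` ?S \<nu>)" .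
      also have "\<dots> \<subseteq> int_fun.span (part_char N n ` ?S \<mu>)"
        by (intro int_fun.span_mono image_mono) (use lt in auto)
      finally have 1: "perm_char N n (part_vec \<nu>) - part_char N n \<nu> \<in> int_fun.span (part_char N n ` ?S \<mu>)" .
      have 2: "part_char N n \<nu> \<in> int_fun.span (part_char N n ` ?S \<mu>)"
        by (rule int_fun.span_base) (use lt \<nu>(1) in auto)
      from int_fun.span_add[OF 1 2] show ?thesis using True by (simp add: pc)
    next
      case False
      then show ?thesis unfolding if_not_P[OF False] by (intro int_fun.span_zero)
    qed
  qed
  finally show ?case .
qed

lemma bilin_eq_0_span:
  assumes "F \<in> int_fun.span S" "\<And>\<psi>. \<psi> \<in> S \<Longrightarrow> bilin G \<psi> \<chi> = 0"
  shows "bilin G F \<chi> = 0"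
  using assms(1)
proof (induction rule: int_fun.span_induct_alt)
  case base
  then show ?case by (simp add: bilin_def)
next
  case (step c \<psi> F)
  have eq: "bilin G (int_scale c \<psi> + F) \<chi> = of_int c * bilin G \<psi> \<chi> + bilin G F \<chi>"
    by (simp add: bilin_def int_scale_def sum.distrib algebra_simps add_divide_distrib sum_distrib_left)
  show ?case unfolding eq using step assms(2) by simp
qed

lemma bilin_diff_left: "bilin G (\<phi> - \<phi>') \<chi> = bilin G \<phi> \<chi> - bilin G \<phi>' \<chi>"
  by (simp add: bilin_def sum_subtractf algebra_simps diff_divide_distrib)

lemma bilin_uminus_right: "bilin G \<phi> (\<lambda>g. - \<chi> g) = - bilin G \<phi> \<chi>"
  by (simp add: bilin_def sum_negf)

lemma bilin_perm_part_char:
  assumes \<mu>: "\<mu> \<in> partitions n" and \<nu>: "\<nu> \<in> partitions n" and N: "n \<le> N"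
    and small: "sq_norm N (part_vec \<nu>) \<le> sq_norm N (part_vec \<mu>)"
  shows "bilin (sym_group n) (perm_char N n (part_vec \<mu>)) (part_char N n \<nu>) = (if \<mu> = \<nu> then 1 else 0)"
proof -
  have "bilin (sym_group n) (perm_char N n (part_vec \<mu>) - part_char N n \<mu>) (part_char N n \<nu>) = 0"
  proof (rule bilin_eq_0_span[OF perm_char_triangular[OF \<mu> N]])
    fix \<psi> assume "\<psi> \<in> part_char N n ` {\<nu> \<in> partitions n. sq_norm N (part_vec \<mu>) < sq_norm N (part_vec \<nu>)}"
    then show "bilin (sym_group n) \<psi> (part_char N n \<nu>) = 0"
      using small bilin_part_char[OF _ \<nu> N] by auto
  qed
  then show ?thesis using bilin_part_char[OF \<mu> \<nu> N] by (simp add: bilin_diff_left)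
qed

lemma det_char_in_span: "det_char N n \<beta> \<in> int_fun.span (Irr (sym_group n))"
proof -
  let ?T = "\<lambda>w. int_scale (sign w) (if \<forall>i. staircase N (w i) \<le> \<beta> i then perm_char N n (\<lambda>i. \<beta> i - staircase N (w i)) else 0)"
  have "det_char N n \<beta> = (\<Sum>w | w permutes {..<N}. ?T w)"
    by (auto simp: fun_eq_iff det_char_expand sum_fun_apply int_scale_def intro!: sum.cong)
  also have "\<dots> \<in> int_fun.span (Irr (sym_group n))"
  proof (intro int_fun.span_sum int_fun.span_scale)
    fix w
    show "(if \<forall>i. staircase N (w i) \<le> \<beta> i then perm_char N n (\<lambda>i. \<beta> i - staircase N (w i)) else 0)
      \<in> int_fun.span (Irr (sym_group n))"
    proof (cases "\<forall>i. staircase N (w i) \<le> \<beta> i")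
      case True
      show ?thesis unfolding if_P[OF True] by (rule is_character_in_span[OF is_character_perm_char])
    next
      case False
      show ?thesis unfolding if_not_P[OF False] by (rule int_fun.span_zero)
    qed
  qed
  finally show ?thesis .
qed

text \<open>Its norm is one, so it is irreducible up to sign; the sign is right because its multiplicity in the
  permutation character of \<open>\<mu>\<close> is \<open>1\<close>.\<close>

lemma part_char_Irr:
  assumes \<mu>: "\<mu> \<in> partitions n" and N: "n \<le> N"
  shows "part_char N n \<mu> \<in> Irr (sym_group n)"
proof (rule ccontr)
  assume no: "part_char N n \<mu> \<notin> Irr (sym_group n)"
  let ?G = "sym_group n"
  have "bilin ?G (part_char N n \<mu>) (part_char N n \<mu>) = 1"
    using bilin_part_char[OF \<mu> \<mu> N] by simp
  then have neg: "(\<lambda>g. - part_char N n \<mu> g) \<in> Irr ?G"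
    using norm_one_irreducible[OF sym_group_is_group finite_sym_carrier det_char_in_span] no by blast
  obtain m :: nat where "bilin ?G (perm_char N n (part_vec \<mu>)) (\<lambda>g. - part_char N n \<mu> g) = of_nat m"
    using is_character_multiplicity[OF sym_group_is_group finite_sym_carrier is_character_perm_char neg] .
  moreover have "bilin ?G (perm_char N n (part_vec \<mu>)) (\<lambda>g. - part_char N n \<mu> g) = -1"
    using bilin_perm_part_char[OF \<mu> \<mu> N] by (simp add: bilin_uminus_right)
  ultimately have "of_nat m = (-1 :: complex)" by simp
  then have "of_nat (m + 1) = (0 :: complex)" unfolding of_nat_add by simp
  then show False by (simp only: of_nat_eq_0_iff)
qed

text \<open>The permutation character of \<open>(1, \<dots>, 1)\<close> vanishes outside the identity, so it contains every irreducible
  character; on the other hand it is a combination of the class functions of partitions.\<close>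

lemma Irr_sym_group:
  assumes N: "n \<le> N"
  shows "Irr (sym_group n) = part_char N n ` partitions n"
proof (intro equalityI subsetI)
  fix \<chi> assume "\<chi> \<in> part_char N n ` partitions n"
  then show "\<chi> \<in> Irr (sym_group n)" using part_char_Irr N by blast
next
  let ?G = "sym_group n" and ?X = "{1..n}"
  fix \<chi> assume \<chi>: "\<chi> \<in> Irr ?G"
  then obtain d \<rho> where d: "irreducible_rep ?G d \<rho>" "\<chi> = rep_character ?G d \<rho>" by (auto simp: Irr_def)
  interpret mat_rep ?G d \<rho> using d(1) sym_group_is_group by (simp add: irreducible_rep_def mat_rep_def mat_rep_axioms_def)
  have "\<chi> id = of_nat d"
    using rep_one by (simp add: d(2) rep_character_def permutes_id sym_group_one)
  then have \<chi>1: "\<chi> id \<noteq> 0" using d(1) by (simp add: irreducible_rep_def)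
  define \<mu> where "\<mu> = replicate n (1 :: nat)"
  have \<mu>: "\<mu> \<in> partitions n" by (auto simp: \<mu>_def partitions_def sorted_wrt_iff_nth_less sum_list_replicate)
  have a: "part_vec \<mu> i \<le> 1" for i by (simp add: part_vec_def part_def \<mu>_def)
  let ?\<xi> = "perm_char N n (part_vec \<mu>)"
  have zero: "?\<xi> g = 0" if g: "g permutes ?X" "g \<noteq> id" for g
  proof -
    obtain x where x: "g x \<noteq> x" using g(2) by (auto simp: fun_eq_iff)
    then have xX: "x \<in> ?X" "g x \<in> ?X" using g(1) permutes_not_in[OF g(1)] permutes_in_image[OF g(1)] by blast+
    have "f (g x) \<noteq> f x" if f: "f \<in> colourings_of N n (part_vec \<mu>)" for f
    proof
      assume "f (g x) = f x"
      then have "card {x, g x} \<le> content ?X f (f x)"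
        unfolding content_def using xX by (intro card_mono) auto
      then have "2 \<le> content ?X f (f x)" using x by simp
      moreover have "content ?X f = part_vec \<mu>" using f by (simp add: colourings_of_def)
      ultimately show False using a[of "f x"] by simp
    qed
    then have "{f \<in> colourings_of N n (part_vec \<mu>). \<forall>x\<in>?X. f (g x) = f x} = {}" using xX by blast
    then show ?thesis by (simp only: twisted_perm_char_def card.empty) simp
  qed
  have "bilin ?G ?\<xi> \<chi> \<noteq> 0"
  proof -
    have "(\<Sum>g\<in>carrier ?G. ?\<xi> g * \<chi> (inv\<^bsub>?G\<^esub> g)) = (\<Sum>g\<in>{id}. ?\<xi> g * \<chi> (inv\<^bsub>?G\<^esub> g))"
      using zero by (intro sum.mono_neutral_right) (auto simp: finite_permutations permutes_id)
    also have "\<dots> = ?\<xi> id * \<chi> id" using sym_inv[OF permutes_id] by (simp add: inv_id)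
    also have "?\<xi> id = of_nat (card (colourings_of N n (part_vec \<mu>)))"
      by (simp add: twisted_perm_char_def permutes_id)
    finally have "(\<Sum>g\<in>carrier ?G. ?\<xi> g * \<chi> (inv\<^bsub>?G\<^esub> g)) = of_nat (card (colourings_of N n (part_vec \<mu>))) * \<chi> id" .
    moreover have "colourings_of N n (part_vec \<mu>) \<noteq> {}"
      using ex_content[of "{..<N}" ?X "part_vec \<mu>"] part_vec_in[OF \<mu> N] by (auto simp: colourings_of_def)
    then have "card (colourings_of N n (part_vec \<mu>)) \<noteq> 0" by (simp only: card_eq_0_iff) simp
    ultimately show ?thesis using \<chi>1 unfolding bilin_def card_sym_carrier by simp
  qed
  moreover have "?\<xi> \<in> int_fun.span (part_char N n ` partitions n)"
  proof -
    let ?S = "part_char N n ` partitions n"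
    have 1: "?\<xi> - part_char N n \<mu> \<in> int_fun.span ?S"
      by (rule subsetD[OF int_fun.span_mono perm_char_triangular[OF \<mu> N]]) auto
    have 2: "part_char N n \<mu> \<in> int_fun.span ?S" using \<mu> by (intro int_fun.span_base imageI)
    show ?thesis using int_fun.span_add[OF 1 2] by (simp only: diff_add_cancel)
  qed
  ultimately obtain \<psi> where \<psi>: "\<psi> \<in> part_char N n ` partitions n" "bilin ?G \<psi> \<chi> \<noteq> 0"
    using bilin_eq_0_span[of ?\<xi> "part_char N n ` partitions n" ?G \<chi>] by blast
  then have "\<psi> = \<chi>"
    using bilin_Irr[OF sym_group_is_group finite_sym_carrier _ \<chi>, of \<psi>] part_char_Irr[OF _ N] by (auto split: if_splits)
  then show "\<chi> \<in> part_char N n ` partitions n" using \<psi>(1) by simp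
qed

text \<open>Sum the signs over the stabiliser of a pair of colourings.  If the pair coincides at two points, their
  transposition lies in the stabiliser and the signs cancel; if the pair separates all points, the
  stabiliser is trivial.\<close>

lemma bilin_perm_sign_char:
  "bilin (sym_group n) (perm_char N n a) (sign_perm_char N n b) =
     of_nat (card {(f, f') \<in> colourings_of N n a \<times> colourings_of N n b. inj_on (\<lambda>x. (f x, f' x)) {1..n}}) / fact n"
proof -
  let ?X = "{1..n}" and ?A = "colourings_of N n a" and ?B = "colourings_of N n b"
  let ?P = "{g. g permutes ?X}"
  let ?fix = "\<lambda>g f f'. (\<forall>x\<in>?X. f (g x) = f x) \<and> (\<forall>x\<in>?X. f' (g x) = f' x)"
  have inv: "sign_perm_char N n b (inv_into UNIV g) = sign_perm_char N n b g" if g: "g permutes ?X" for g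
  proof -
    have gX: "g x \<in> ?X" "inv_into UNIV g x \<in> ?X" if "x \<in> ?X" for x
      using that permutes_in_image[OF g] permutes_in_image[OF permutes_inv[OF g]] by auto
    have "(\<forall>x\<in>?X. f (inv_into UNIV g x) = f x) \<longleftrightarrow> (\<forall>x\<in>?X. f (g x) = f x)" for f :: "nat \<Rightarrow> nat"
      using gX permutes_inverses[OF g] by metis
    moreover have "sign (inv_into UNIV g) = sign g"
      using g permutation_permutes by (intro sign_inverse) blast
    ultimately show ?thesis using g by (simp add: twisted_perm_char_def permutes_inv)
  qed
  have "(\<Sum>g\<in>carrier (sym_group n). perm_char N n a g * sign_perm_char N n b (inv\<^bsub>sym_group n\<^esub> g))
      = (\<Sum>g\<in>?P. perm_char N n a g * sign_perm_char N n b g)"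
    by (intro sum.cong) (auto simp: inv sym_inv)
  also have "\<dots> = (\<Sum>g\<in>?P. \<Sum>(f, f')\<in>?A \<times> ?B. if ?fix g f f' then of_int (sign g) else 0)"
  proof (rule sum.cong[OF refl])
    fix g assume "g \<in> ?P"
    then have "perm_char N n a g * sign_perm_char N n b g
      = of_int (sign g) * of_nat (card ({f \<in> ?A. \<forall>x\<in>?X. f (g x) = f x} \<times> {f \<in> ?B. \<forall>x\<in>?X. f (g x) = f x}))"
      by (simp add: twisted_perm_char_def card_cartesian_product)
    also have "{f \<in> ?A. \<forall>x\<in>?X. f (g x) = f x} \<times> {f \<in> ?B. \<forall>x\<in>?X. f (g x) = f x} = {z \<in> ?A \<times> ?B. ?fix g (fst z) (snd z)}"
      by auto
    also have "(of_int (sign g) * of_nat (card \<dots>) :: complex) = (\<Sum>z\<in>?A \<times> ?B. if ?fix g (fst z) (snd z) then of_int (sign g) else 0)"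
      by (simp add: sum.If_cases Int_def)
    finally show "perm_char N n a g * sign_perm_char N n b g = (\<Sum>(f, f')\<in>?A \<times> ?B. if ?fix g f f' then of_int (sign g) else 0)"
      by (simp add: case_prod_unfold)
  qed
  also have "\<dots> = (\<Sum>(f, f')\<in>?A \<times> ?B. \<Sum>g\<in>?P. if ?fix g f f' then of_int (sign g) else 0)"
    unfolding case_prod_unfold by (rule sum.swap)
  also have "\<dots> = (\<Sum>(f, f')\<in>?A \<times> ?B. if inj_on (\<lambda>x. (f x, f' x)) ?X then 1 else 0)"
  proof (intro sum.cong refl, safe)
    fix f f' :: "nat \<Rightarrow> nat"
    let ?S = "\<Sum>g\<in>?P. if ?fix g f f' then of_int (sign g) else (0 :: complex)"
    show "?S = (if inj_on (\<lambda>x. (f x, f' x)) ?X then 1 else 0)"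
    proof (cases "inj_on (\<lambda>x. (f x, f' x)) ?X")
      case inj: True
      have "g = id" if g: "g permutes ?X" "?fix g f f'" for g
      proof
        fix x show "g x = id x"
        proof (cases "x \<in> ?X")
          case True
          then have "g x \<in> ?X" using permutes_in_image[OF g(1)] by simp
          moreover have "(f (g x), f' (g x)) = (f x, f' x)" using g(2) True by simp
          ultimately show ?thesis using inj_onD[OF inj _ _ True, of "g x"] by simp
        qed (use permutes_not_in[OF g(1)] in simp)
      qed
      then have "?S = (\<Sum>g\<in>{id}. if ?fix g f f' then of_int (sign g) else 0)"
        by (intro sum.mono_neutral_right) (auto simp: finite_permutations permutes_id)
      then show ?thesis using inj by (simp add: sign_id)
    next
      case False
      then obtain x y where xy: "x \<in> ?X" "y \<in> ?X" "x \<noteq> y" "f x = f y" "f' x = f' y" by (auto simp: inj_on_def)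
      let ?t = "Transposition.transpose x y"
      have t: "?t permutes ?X" using xy by (intro permutes_swap_id)
      have ft: "f (?t z) = f z" "f' (?t z) = f' z" for z using xy by (auto simp: Transposition.transpose_def)
      have "?S = (\<Sum>g\<in>?P. if ?fix (?t \<circ> g) f f' then of_int (sign (?t \<circ> g)) else 0)"
        by (rule setum_permutations_compose_left[OF t])
      also have "\<dots> = - ?S"
        unfolding sum_negf[symmetric]
        by (intro sum.cong refl) (use xy(3) in \<open>auto simp: ft sign_comp_sym[OF t] sign_swap_id\<close>)
      finally show ?thesis using False by simp
    qed
  qed
  also have "\<dots> = of_nat (card {(f, f') \<in> ?A \<times> ?B. inj_on (\<lambda>x. (f x, f' x)) ?X})"
  proof -
    have "{(f, f') \<in> ?A \<times> ?B. inj_on (\<lambda>x. (f x, f' x)) ?X} = {z \<in> ?A \<times> ?B. inj_on (\<lambda>x. (fst z x, snd z x)) ?X}" by auto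
    then show ?thesis by (simp add: case_prod_unfold sum.If_cases Int_def)
  qed
  finally show ?thesis unfolding bilin_def card_sym_carrier by simp
qed

text \<open>The box \<open>(i, j)\<close> of the diagram contributes to the square of the \<open>i\<close>-th part once for every pair of
  columns that reach the \<open>i\<close>-th row.\<close>

lemma sq_norm_eq_sum_min:
  assumes \<mu>: "\<mu> \<in> partitions n" and N: "n \<le> N"
  shows "sq_norm N (part_vec \<mu>) = (\<Sum>j<N. \<Sum>j'<N. min (part_vec (conj_part \<mu>) j) (part_vec (conj_part \<mu>) j'))"
proof -
  have gal: "j < part_vec \<mu> i \<longleftrightarrow> i < part_vec (conj_part \<mu>) j" for i j
    using conj_part_galois[OF \<mu>, of "Suc i" "Suc j"] by (auto simp: part_vec_def)
  have le: "part_vec \<mu> i \<le> N" "part_vec (conj_part \<mu>) i \<le> N" for i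
    using weak_comps_le[OF _ part_vec_in[OF \<mu> N], of i] weak_comps_le[OF _ part_vec_in[OF conj_part_in[OF \<mu>] N], of i] N by auto
  have "sq_norm N (part_vec \<mu>) = (\<Sum>i<N. \<Sum>j<N. \<Sum>j'<N. if j < part_vec \<mu> i \<and> j' < part_vec \<mu> i then 1 else 0)"
    unfolding sq_norm_def
  proof (rule sum.cong[OF refl])
    fix i
    have "(\<Sum>j<N. if j < part_vec \<mu> i then 1 else 0) = part_vec \<mu> i"
    proof -
      have "{j\<in>{..<N}. j < part_vec \<mu> i} = {..<part_vec \<mu> i}" using le[of i] by auto
      then show ?thesis by (simp add: sum.If_cases Int_def)
    qed
    then have "(part_vec \<mu> i)\<^sup>2 = (\<Sum>j<N. if j < part_vec \<mu> i then 1 else 0) * (\<Sum>j<N. if j < part_vec \<mu> i then 1 else 0)"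
      by (simp add: power2_eq_square)
    also have "\<dots> = (\<Sum>j<N. \<Sum>j'<N. if j < part_vec \<mu> i \<and> j' < part_vec \<mu> i then 1 else 0)"
      unfolding sum_product by (intro sum.cong) auto
    finally show "(part_vec \<mu> i)\<^sup>2 = (\<Sum>j<N. \<Sum>j'<N. if j < part_vec \<mu> i \<and> j' < part_vec \<mu> i then 1 else 0)" .
  qed
  also have "\<dots> = (\<Sum>j<N. \<Sum>j'<N. \<Sum>i<N. if j < part_vec \<mu> i \<and> j' < part_vec \<mu> i then 1 else 0)"
    by (subst sum.swap, rule sum.cong[OF refl], rule sum.swap)
  also have "\<dots> = (\<Sum>j<N. \<Sum>j'<N. min (part_vec (conj_part \<mu>) j) (part_vec (conj_part \<mu>) j'))"
  proof (intro sum.cong[OF refl])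
    fix j j'
    have "{i\<in>{..<N}. j < part_vec \<mu> i \<and> j' < part_vec \<mu> i} = {..<min (part_vec (conj_part \<mu>) j) (part_vec (conj_part \<mu>) j')}"
      unfolding gal using le(2)[of j] by auto
    then show "(\<Sum>i<N. if j < part_vec \<mu> i \<and> j' < part_vec \<mu> i then 1 else 0) = min (part_vec (conj_part \<mu>) j) (part_vec (conj_part \<mu>) j')"
      by (simp add: sum.If_cases Int_def)
  qed
  finally show ?thesis .
qed

text \<open>Sort the pairs of points with equal \<open>f\<close>-colour by their two \<open>f'\<close>-colours \<open>j\<close> and \<open>j'\<close>.  As the colourings
  separate points, either member of such a pair determines the other one, so that there are at most
  \<open>min (b j) (b j')\<close> pairs.\<close>

lemma sq_norm_le_sum_min:
  assumes f: "f \<in> colourings_of N n a" and f': "f' \<in> colourings_of N n b"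
    and inj: "inj_on (\<lambda>x. (f x, f' x)) {1..n}"
  shows "sq_norm N a \<le> (\<Sum>j<N. \<Sum>j'<N. min (b j) (b j'))"
proof -
  let ?X = "{1..n}"
  have a: "a i = card {x\<in>?X. f x = i}" and b: "b j = card {x\<in>?X. f' x = j}" for i j
    using f f' by (auto simp: colourings_of_def content_def)
  have lt: "f x < N" "f' x < N" if "x \<in> ?X" for x using f f' that by (auto simp: colourings_of_def)
  have sep: "x = y" if "x \<in> ?X" "y \<in> ?X" "f x = f y" "f' x = f' y" for x y
    using inj_onD[OF inj, of x y] that by simp
  let ?P = "{(x, y) \<in> ?X \<times> ?X. f x = f y}"
  have finP: "finite ?P" by (rule finite_subset[of _ "?X \<times> ?X"]) auto
  have "sq_norm N a = (\<Sum>i<N. card ({x\<in>?X. f x = i} \<times> {x\<in>?X. f x = i}))"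
    by (simp add: sq_norm_def a card_cartesian_product power2_eq_square)
  also have "\<dots> = card (\<Union>i<N. {x\<in>?X. f x = i} \<times> {x\<in>?X. f x = i})"
    by (rule card_UN_disjoint[symmetric]) auto
  also have "(\<Union>i<N. {x\<in>?X. f x = i} \<times> {x\<in>?X. f x = i}) = ?P" using lt by auto
  also have "card ?P = (\<Sum>z\<in>{..<N} \<times> {..<N}. card {q \<in> ?P. (f' (fst q), f' (snd q)) = z})"
  proof -
    have "(\<lambda>q. (f' (fst q), f' (snd q))) ` ?P \<subseteq> {..<N} \<times> {..<N}" using lt by auto
    from sum.group[OF finP _ this, of "\<lambda>_. 1 :: nat"] show ?thesis by simp
  qed
  also have "\<dots> \<le> (\<Sum>z\<in>{..<N} \<times> {..<N}. min (b (fst z)) (b (snd z)))"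
  proof (rule sum_mono)
    fix z :: "nat \<times> nat"
    let ?Q = "{q \<in> ?P. (f' (fst q), f' (snd q)) = z}"
    have "card ?Q \<le> card {x\<in>?X. f' x = fst z}"
    proof (rule card_inj_on_le[of fst])
      show "inj_on fst ?Q"
      proof (rule inj_onI)
        fix q r assume "q \<in> ?Q" "r \<in> ?Q" "fst q = fst r"
        then show "q = r" using sep[of "snd q" "snd r"] by (auto simp: prod_eq_iff)
      qed
    qed auto
    moreover have "card ?Q \<le> card {x\<in>?X. f' x = snd z}"
    proof (rule card_inj_on_le[of snd])
      show "inj_on snd ?Q"
      proof (rule inj_onI)
        fix q r assume "q \<in> ?Q" "r \<in> ?Q" "snd q = snd r"
        then show "q = r" using sep[of "fst q" "fst r"] by (auto simp: prod_eq_iff)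
      qed
    qed auto
    ultimately show "card ?Q \<le> min (b (fst z)) (b (snd z))" by (simp add: b)
  qed
  finally show ?thesis by (simp add: sum.cartesian_product case_prod_unfold)
qed

text \<open>Place the points in the boxes of the diagram and colour them by row and by column.\<close>

lemma ex_separating_colourings:
  assumes \<mu>: "\<mu> \<in> partitions n" and N: "n \<le> N"
  shows "\<exists>f\<in>colourings_of N n (part_vec \<mu>). \<exists>f'\<in>colourings_of N n (part_vec (conj_part \<mu>)).
     inj_on (\<lambda>x. (f x, f' x)) {1..n}"
proof -
  let ?X = "{1..n}" and ?D = "SIGMA i:{..<N}. {..<part_vec \<mu> i}"
  have gal: "j < part_vec \<mu> i \<longleftrightarrow> i < part_vec (conj_part \<mu>) j" for i j
    using conj_part_galois[OF \<mu>, of "Suc i" "Suc j"] by (auto simp: part_vec_def)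
  have le: "part_vec \<mu> i \<le> n" "part_vec (conj_part \<mu>) i \<le> n" for i
    using weak_comps_le[OF _ part_vec_in[OF \<mu> N], of i] weak_comps_le[OF _ part_vec_in[OF conj_part_in[OF \<mu>] N], of i] by auto
  have "card ?X = card ?D" using part_vec_in[OF \<mu> N] by (simp add: weak_comps_def)
  then obtain b where b: "bij_betw b ?X ?D" using finite_same_card_bij[of ?X ?D] by (auto simp: finite_SigmaI)
  have im: "b ` ?X = ?D" and inj: "inj_on b ?X" using b by (auto simp: bij_betw_def)
  define f where "f = restrict (fst \<circ> b) ?X"
  define f' where "f' = restrict (snd \<circ> b) ?X"
  have bD: "b x \<in> ?D" if "x \<in> ?X" for x using im that by blast
  have cf: "content ?X f i = part_vec \<mu> i" for i
  proof -
    have "card {x\<in>?X. f x = i} = card (b ` {x\<in>?X. f x = i})"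
      by (rule card_image[symmetric]) (rule inj_on_subset[OF inj], auto)
    also have "b ` {x\<in>?X. f x = i} = {z \<in> b ` ?X. fst z = i}" by (auto simp: f_def)
    also have "\<dots> = {i} \<times> {..<part_vec \<mu> i}"
    proof -
      have "i < N \<or> part_vec \<mu> i = 0" using part_vec_in[OF \<mu> N] by (auto simp: weak_comps_def)
      then show ?thesis unfolding im by auto
    qed
    finally show ?thesis by (simp add: content_def card_cartesian_product)
  qed
  have cf': "content ?X f' j = part_vec (conj_part \<mu>) j" for j
  proof -
    have "card {x\<in>?X. f' x = j} = card (b ` {x\<in>?X. f' x = j})"
      by (rule card_image[symmetric]) (rule inj_on_subset[OF inj], auto)
    also have "b ` {x\<in>?X. f' x = j} = {z \<in> b ` ?X. snd z = j}" by (auto simp: f'_def)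
    also have "\<dots> = {..<part_vec (conj_part \<mu>) j} \<times> {j}" unfolding im
      using le(2)[of j] N by (auto simp: gal)
    finally show ?thesis by (simp add: content_def card_cartesian_product)
  qed
  have "f x < N" "f' x < N" if "x \<in> ?X" for x
    using bD[OF that] that le(1)[of "fst (b x)"] N by (auto simp: f_def f'_def mem_Sigma_iff)
  then have "f \<in> colourings_of N n (part_vec \<mu>)" "f' \<in> colourings_of N n (part_vec (conj_part \<mu>))"
    using cf cf' by (auto simp: colourings_of_def f_def f'_def)
  moreover have "inj_on (\<lambda>x. (f x, f' x)) ?X"
  proof (rule inj_onI)
    fix x y assume xy: "x \<in> ?X" "y \<in> ?X" "(f x, f' x) = (f y, f' y)"
    then have "b x = b y" by (simp add: f_def f'_def prod_eq_iff)
    then show "x = y" using inj_onD[OF inj] xy by blast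
  qed
  ultimately show ?thesis by (intro bexI)
qed

text \<open>A common constituent labelled \<open>\<nu>\<close> gives a pair of separating colourings with contents \<open>\<nu>\<close> and \<open>\<mu>\<^sup>*\<close>, whence
  \<open>\<Sum> \<nu>\<^sub>i\<^sup>2 \<le> \<Sum> \<mu>\<^sub>i\<^sup>2\<close>; but a constituent \<open>\<nu> \<noteq> \<mu>\<close> of the permutation character of \<open>\<mu>\<close> has a larger sum of
  squares.\<close>

lemma common_constituent_characterization:
  assumes \<mu>: "\<mu> \<in> partitions n" and N: "n \<le> N"
  shows "\<chi> \<in> Irr (sym_group n) \<and>
      bilin (sym_group n) (perm_char N n (part_vec \<mu>)) \<chi> \<noteq> 0 \<and>
      bilin (sym_group n) (sign_perm_char N n (part_vec (conj_part \<mu>))) \<chi> \<noteq> 0 \<longleftrightarrow> \<chi> = part_char N n \<mu>"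
proof -
  let ?G = "sym_group n" and ?\<epsilon> = "sign_perm_char N n (part_vec (conj_part \<mu>))"
  note cc = common_constituent_iff[OF sym_group_is_group finite_sym_carrier is_character_perm_char is_character_sign_perm_char]
  have unique: "\<nu> = \<mu>" if \<nu>: "\<nu> \<in> partitions n" and 1: "bilin ?G (perm_char N n (part_vec \<mu>)) (part_char N n \<nu>) \<noteq> 0"
    and 2: "bilin ?G ?\<epsilon> (part_char N n \<nu>) \<noteq> 0" for \<nu>
  proof -
    have "bilin ?G (perm_char N n (part_vec \<nu>)) (part_char N n \<nu>) \<noteq> 0"
      using bilin_perm_part_char[OF \<nu> \<nu> N] by simp
    then have "bilin ?G (perm_char N n (part_vec \<nu>)) ?\<epsilon> \<noteq> 0"
      using 2 part_char_Irr[OF \<nu> N] unfolding cc by blast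
    then have "card {(f, f') \<in> colourings_of N n (part_vec \<nu>) \<times> colourings_of N n (part_vec (conj_part \<mu>)).
        inj_on (\<lambda>x. (f x, f' x)) {1..n}} \<noteq> 0"
      unfolding bilin_perm_sign_char by auto
    then have "{(f, f') \<in> colourings_of N n (part_vec \<nu>) \<times> colourings_of N n (part_vec (conj_part \<mu>)).
        inj_on (\<lambda>x. (f x, f' x)) {1..n}} \<noteq> {}" by (metis card.empty)
    then obtain f f' where "f \<in> colourings_of N n (part_vec \<nu>)" "f' \<in> colourings_of N n (part_vec (conj_part \<mu>))"
      "inj_on (\<lambda>x. (f x, f' x)) {1..n}" by auto
    then have "sq_norm N (part_vec \<nu>) \<le> sq_norm N (part_vec \<mu>)"
      unfolding sq_norm_eq_sum_min[OF \<mu> N] by (rule sq_norm_le_sum_min)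
    then show ?thesis using bilin_perm_part_char[OF \<mu> \<nu> N] 1 by (auto split: if_splits)
  qed
  have "bilin ?G (perm_char N n (part_vec \<mu>)) ?\<epsilon> \<noteq> 0"
  proof -
    let ?S = "{(f, f') \<in> colourings_of N n (part_vec \<mu>) \<times> colourings_of N n (part_vec (conj_part \<mu>)).
        inj_on (\<lambda>x. (f x, f' x)) {1..n}}"
    have "finite ?S" by (rule finite_subset[of _ "colourings_of N n (part_vec \<mu>) \<times> colourings_of N n (part_vec (conj_part \<mu>))"]) auto
    moreover have "?S \<noteq> {}" using ex_separating_colourings[OF \<mu> N] by blast
    ultimately show ?thesis unfolding bilin_perm_sign_char by simp
  qed
  then obtain \<chi>0 where \<chi>0: "\<chi>0 \<in> Irr ?G" "bilin ?G (perm_char N n (part_vec \<mu>)) \<chi>0 \<noteq> 0" "bilin ?G ?\<epsilon> \<chi>0 \<noteq> 0"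
    unfolding cc by blast
  have all: "\<chi> = part_char N n \<mu>" if "\<chi> \<in> Irr ?G" "bilin ?G (perm_char N n (part_vec \<mu>)) \<chi> \<noteq> 0" "bilin ?G ?\<epsilon> \<chi> \<noteq> 0" for \<chi>
    using that unique unfolding Irr_sym_group[OF N] by blast
  then show ?thesis using \<chi>0 by blast
qed

section \<open>Young subgroups\<close>

lemma sum_take_Suc:
  "sum_list (take (Suc i) \<mu>) = sum_list (take i \<mu>) + part_vec \<mu> i"
  by (cases "i < length \<mu>") (simp_all add: take_Suc_conv_app_nth part_vec_def part_def)

lemma sum_take_mono: "i \<le> j \<Longrightarrow> sum_list (take i \<mu>) \<le> sum_list (take j (\<mu> :: nat list))"
  by (rule lift_Suc_mono_le[of "\<lambda>i. sum_list (take i \<mu>)"]) (simp add: sum_take_Suc)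

definition block_index :: "nat list \<Rightarrow> nat \<Rightarrow> nat" where
  "block_index \<mu> x = (LEAST i. x \<le> sum_list (take (Suc i) \<mu>))"

lemma block_index_less:
  assumes "1 \<le> x" "x \<le> sum_list \<mu>"
  shows "block_index \<mu> x < length \<mu>"
proof -
  have len: "0 < length \<mu>" using assms by (cases \<mu>) auto
  then have "block_index \<mu> x \<le> length \<mu> - 1"
    unfolding block_index_def using assms by (intro Least_le) simp
  then show ?thesis using len by linarith
qed

lemma block_index_eq_iff:
  assumes x: "1 \<le> x" "x \<le> sum_list \<mu>"
  shows "block_index \<mu> x = i \<longleftrightarrow> x \<in> young_block \<mu> i"
proof
  assume i: "block_index \<mu> x = i"
  have "x \<le> sum_list (take (Suc (length \<mu>)) \<mu>)" using x by simp
  then have "x \<le> sum_list (take (Suc i) \<mu>)" unfolding i[symmetric] block_index_def by (rule LeastI)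
  moreover have "sum_list (take i \<mu>) < x"
  proof (cases i)
    case (Suc k)
    then have "k < block_index \<mu> x" using i by simp
    then have "\<not> x \<le> sum_list (take (Suc k) \<mu>)" unfolding block_index_def by (rule not_less_Least)
    then show ?thesis using Suc by simp
  qed (use x in simp)
  ultimately show "x \<in> young_block \<mu> i" by (simp add: young_block_def)
next
  assume "x \<in> young_block \<mu> i"
  then have i: "sum_list (take i \<mu>) < x" "x \<le> sum_list (take (Suc i) \<mu>)" by (auto simp: young_block_def)
  show "block_index \<mu> x = i"
    unfolding block_index_def
  proof (rule Least_equality)
    show "x \<le> sum_list (take (Suc i) \<mu>)" by (rule i(2))
  next
    fix k assume k: "x \<le> sum_list (take (Suc k) \<mu>)"
    show "i \<le> k"
    proof (rule ccontr)
      assume "\<not> i \<le> k"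
      then have "sum_list (take (Suc k) \<mu>) \<le> sum_list (take i \<mu>)" by (intro sum_take_mono) simp
      then show False using i k by simp
    qed
  qed
qed

lemma young_block_subset: "young_block \<mu> i \<subseteq> {1..sum_list \<mu>}"
proof
  fix x assume x: "x \<in> young_block \<mu> i"
  have "sum_list (take (Suc i) \<mu>) \<le> sum_list (take (max (Suc i) (length \<mu>)) \<mu>)" by (rule sum_take_mono) simp
  then show "x \<in> {1..sum_list \<mu>}" using x by (auto simp: young_block_def)
qed

definition standard_colouring :: "nat list \<Rightarrow> nat \<Rightarrow> nat" where
  "standard_colouring \<mu> = restrict (block_index \<mu>) {1..sum_list \<mu>}"

lemma standard_colouring_in:
  assumes \<mu>: "\<mu> \<in> partitions n" and N: "n \<le> N"
  shows "standard_colouring \<mu> \<in> colourings_of N n (part_vec \<mu>)"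
proof -
  have sum: "sum_list \<mu> = n" using \<mu> by (simp add: partitions_def)
  have "content {1..n} (standard_colouring \<mu>) i = part_vec \<mu> i" for i
  proof -
    have "{x\<in>{1..n}. standard_colouring \<mu> x = i} = young_block \<mu> i"
      using block_index_eq_iff[of _ \<mu> i] young_block_subset[of \<mu> i] sum by (auto simp: standard_colouring_def)
    then show ?thesis by (simp add: content_def young_block_def sum_take_Suc)
  qed
  moreover have "block_index \<mu> x < N" if "x \<in> {1..n}" for x
    using block_index_less[of x \<mu>] length_partition_le[OF \<mu>] that sum N by auto
  ultimately show ?thesis by (auto simp: colourings_of_def standard_colouring_def sum)
qed

lemma young_subgroup_iff:
  assumes \<mu>: "\<mu> \<in> partitions n"
  shows "g \<in> young_subgroup \<mu> \<longleftrightarrow> g permutes {1..n} \<and> (\<forall>x\<in>{1..n}. standard_colouring \<mu> (g x) = standard_colouring \<mu> x)"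
proof -
  let ?X = "{1..n}"
  have sum: "sum_list \<mu> = n" using \<mu> by (simp add: partitions_def)
  have std: "standard_colouring \<mu> x = i \<longleftrightarrow> x \<in> young_block \<mu> i" if "x \<in> ?X" for x i
    using block_index_eq_iff[of x \<mu> i] that sum by (simp add: standard_colouring_def)
  have "(\<forall>i<length \<mu>. g ` young_block \<mu> i = young_block \<mu> i) \<longleftrightarrow>
        (\<forall>x\<in>?X. standard_colouring \<mu> (g x) = standard_colouring \<mu> x)" if g: "g permutes ?X"
  proof
    assume blocks: "\<forall>i<length \<mu>. g ` young_block \<mu> i = young_block \<mu> i"
    show "\<forall>x\<in>?X. standard_colouring \<mu> (g x) = standard_colouring \<mu> x"
    proof
      fix x assume x: "x \<in> ?X"
      then have gx: "g x \<in> ?X" using permutes_in_image[OF g] by simp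
      let ?i = "standard_colouring \<mu> x"
      have "?i < length \<mu>" using block_index_less[of x \<mu>] x sum by (simp add: standard_colouring_def)
      then have "g ` young_block \<mu> ?i = young_block \<mu> ?i" using blocks by blast
      moreover have "x \<in> young_block \<mu> ?i" using std[OF x] by blast
      ultimately have "g x \<in> young_block \<mu> ?i" by blast
      then show "standard_colouring \<mu> (g x) = ?i" using std[OF gx] by blast
    qed
  next
    assume inv: "\<forall>x\<in>?X. standard_colouring \<mu> (g x) = standard_colouring \<mu> x"
    show "\<forall>i<length \<mu>. g ` young_block \<mu> i = young_block \<mu> i"
    proof (intro allI impI endo_inj_surj)
      fix i
      show "finite (young_block \<mu> i)" by (simp add: young_block_def)
      show "inj_on g (young_block \<mu> i)" using permutes_inj[OF g] by (rule inj_on_subset) simp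
      show "g ` young_block \<mu> i \<subseteq> young_block \<mu> i"
      proof (rule image_subsetI)
        fix x assume xb: "x \<in> young_block \<mu> i"
        then have x: "x \<in> ?X" using young_block_subset[of \<mu> i] sum by blast
        then have gx: "g x \<in> ?X" using permutes_in_image[OF g] by simp
        have "standard_colouring \<mu> x = i" using std[OF x] xb by blast
        then have "standard_colouring \<mu> (g x) = i" using inv x by simp
        then show "g x \<in> young_block \<mu> i" using std[OF gx] by blast
      qed
    qed
  qed
  then show ?thesis unfolding young_subgroup_def sum by blast
qed

text \<open>The map \<open>x \<mapsto> f \<circ> x\<^sup>-\<^sup>1\<close>, with \<open>f\<close> the standard colouring, is onto the colourings of content \<open>\<mu>\<close>; its
  fibres are cosets of the Young subgroup, and \<open>x\<^sup>-\<^sup>1 g x\<close> is in the Young subgroup if and only if \<open>g\<close>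
  fixes the image of \<open>x\<close>.\<close>

lemma card_conjugators:
  assumes \<mu>: "\<mu> \<in> partitions n" and N: "n \<le> N" and g: "g permutes {1..n}"
  shows "card {x. x permutes {1..n} \<and> inv_into UNIV x \<circ> g \<circ> x \<in> young_subgroup \<mu>}
       = card (young_subgroup \<mu>) * card {f \<in> colourings_of N n (part_vec \<mu>). \<forall>x\<in>{1..n}. f (g x) = f x}"
proof -
  let ?X = "{1..n}" and ?P = "{x. x permutes {1..n}}" and ?c = "standard_colouring \<mu>"
  let ?\<Omega> = "colourings_of N n (part_vec \<mu>)" and ?i = "\<lambda>x. inv_into UNIV x :: nat \<Rightarrow> nat"
  let ?f = "\<lambda>x. restrict (?c \<circ> ?i x) ?X" and ?fix = "\<lambda>f. \<forall>x\<in>?X. f (g x) = f x"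
  note c\<Omega> = standard_colouring_in[OF \<mu> N]
  have finP: "finite ?P" by (simp add: finite_permutations)
  have PX: "x y \<in> ?X \<longleftrightarrow> y \<in> ?X" "?i x y \<in> ?X \<longleftrightarrow> y \<in> ?X" if "x permutes ?X" for x y
    using permutes_in_image[OF that] permutes_in_image[OF permutes_inv[OF that]] by blast+
  have f\<Omega>: "?f x \<in> ?\<Omega>" if "x permutes ?X" for x
    by (rule colourings_of_comp[OF permutes_inv[OF that] c\<Omega>])
  have iff: "?i x \<circ> g \<circ> x \<in> young_subgroup \<mu> \<longleftrightarrow> ?fix (?f x)" if x: "x permutes ?X" for x
  proof -
    have "?i x \<circ> g \<circ> x permutes ?X" using x g by (intro permutes_compose permutes_inv)
    then have "?i x \<circ> g \<circ> x \<in> young_subgroup \<mu> \<longleftrightarrow> (\<forall>z\<in>?X. ?c (?i x (g (x z))) = ?c z)"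
      by (simp add: young_subgroup_iff[OF \<mu>])
    also have "\<dots> \<longleftrightarrow> (\<forall>y\<in>?X. ?c (?i x (g y)) = ?c (?i x y))"
    proof
      assume *: "\<forall>z\<in>?X. ?c (?i x (g (x z))) = ?c z"
      show "\<forall>y\<in>?X. ?c (?i x (g y)) = ?c (?i x y)"
      proof
        fix y assume "y \<in> ?X"
        then have "?i x y \<in> ?X" using PX(2)[OF x] by blast
        then show "?c (?i x (g y)) = ?c (?i x y)" using * permutes_inverses(1)[OF x] by metis
      qed
    next
      assume *: "\<forall>y\<in>?X. ?c (?i x (g y)) = ?c (?i x y)"
      show "\<forall>z\<in>?X. ?c (?i x (g (x z))) = ?c z"
      proof
        fix z assume "z \<in> ?X"
        then have "x z \<in> ?X" using PX(1)[OF x] by blast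
        then show "?c (?i x (g (x z))) = ?c z" using * permutes_inverses(2)[OF x] by metis
      qed
    qed
    also have "\<dots> \<longleftrightarrow> ?fix (?f x)" using PX(1)[OF g] by auto
    finally show ?thesis .
  qed
  have fibre: "card {x \<in> ?P. ?f x = f} = card (young_subgroup \<mu>)" if f: "f \<in> ?\<Omega>" for f
  proof -
    have "content ?X f = content ?X ?c" using f c\<Omega> by (simp add: colourings_of_def)
    then obtain \<sigma> where \<sigma>: "\<sigma> permutes ?X" "\<forall>x\<in>?X. f x = ?c (\<sigma> x)"
      using content_eq_imp_permutes[of ?X f ?c] by auto
    have fx: "?f x = f \<longleftrightarrow> \<sigma> \<circ> x \<in> young_subgroup \<mu>" if x: "x permutes ?X" for x
    proof -
      have out: "f y = undefined" if "y \<notin> ?X" for y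
        using f that by (auto simp: colourings_of_def PiE_def extensional_def)
      have "?f x = f \<longleftrightarrow> (\<forall>y\<in>?X. ?c (?i x y) = ?c (\<sigma> y))"
        using \<sigma>(2) out by (auto simp: fun_eq_iff)
      also have "\<dots> \<longleftrightarrow> (\<forall>z\<in>?X. ?c (\<sigma> (x z)) = ?c z)"
      proof
        assume *: "\<forall>y\<in>?X. ?c (?i x y) = ?c (\<sigma> y)"
        show "\<forall>z\<in>?X. ?c (\<sigma> (x z)) = ?c z"
        proof
          fix z assume "z \<in> ?X"
          then have "x z \<in> ?X" using PX(1)[OF x] by blast
          then show "?c (\<sigma> (x z)) = ?c z" using * permutes_inverses(2)[OF x] by metis
        qed
      next
        assume *: "\<forall>z\<in>?X. ?c (\<sigma> (x z)) = ?c z"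
        show "\<forall>y\<in>?X. ?c (?i x y) = ?c (\<sigma> y)"
        proof
          fix y assume "y \<in> ?X"
          then have "?i x y \<in> ?X" using PX(2)[OF x] by blast
          then show "?c (?i x y) = ?c (\<sigma> y)" using * permutes_inverses(1)[OF x] by metis
        qed
      qed
      also have "\<dots> \<longleftrightarrow> \<sigma> \<circ> x \<in> young_subgroup \<mu>"
        using permutes_compose[OF x \<sigma>(1)] by (simp add: young_subgroup_iff[OF \<mu>])
      finally show ?thesis .
    qed
    have "bij_betw (\<lambda>x. \<sigma> \<circ> x) {x \<in> ?P. ?f x = f} (young_subgroup \<mu>)"
    proof (rule bij_betw_byWitness[where f' = "\<lambda>h. ?i \<sigma> \<circ> h"])
      show "\<forall>x\<in>{x \<in> ?P. ?f x = f}. ?i \<sigma> \<circ> (\<sigma> \<circ> x) = x" "\<forall>h\<in>young_subgroup \<mu>. \<sigma> \<circ> (?i \<sigma> \<circ> h) = h"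
        by (auto simp: fun_eq_iff permutes_inverses[OF \<sigma>(1)])
      show "(\<lambda>x. \<sigma> \<circ> x) ` {x \<in> ?P. ?f x = f} \<subseteq> young_subgroup \<mu>" using fx by auto
      show "(\<lambda>h. ?i \<sigma> \<circ> h) ` young_subgroup \<mu> \<subseteq> {x \<in> ?P. ?f x = f}"
      proof (rule image_subsetI)
        fix h assume h: "h \<in> young_subgroup \<mu>"
        then have "h permutes ?X" by (simp add: young_subgroup_iff[OF \<mu>])
        then have p: "?i \<sigma> \<circ> h permutes ?X" by (intro permutes_compose permutes_inv \<sigma>(1))
        have "\<sigma> \<circ> (?i \<sigma> \<circ> h) = h" by (auto simp: fun_eq_iff permutes_inverses[OF \<sigma>(1)])
        then have "?f (?i \<sigma> \<circ> h) = f" using h unfolding fx[OF p] by simp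
        then show "?i \<sigma> \<circ> h \<in> {x \<in> ?P. ?f x = f}" using p by simp
      qed
    qed
    then show ?thesis by (rule bij_betw_same_card)
  qed
  have set: "{x. x permutes ?X \<and> ?i x \<circ> g \<circ> x \<in> young_subgroup \<mu>} = {x \<in> ?P. ?fix (?f x)}" using iff by blast
  have 1: "card {x \<in> ?P. ?fix (?f x)} = (\<Sum>f | f \<in> ?\<Omega> \<and> ?fix f. card {x \<in> {x \<in> ?P. ?fix (?f x)}. ?f x = f})"
  proof -
    have sub: "?f ` {x \<in> ?P. ?fix (?f x)} \<subseteq> {f \<in> ?\<Omega>. ?fix f}" using f\<Omega> by blast
    have "(\<Sum>f | f \<in> ?\<Omega> \<and> ?fix f. \<Sum>x\<in>{x \<in> {x \<in> ?P. ?fix (?f x)}. ?f x = f}. 1) = (\<Sum>x\<in>{x \<in> ?P. ?fix (?f x)}. 1)"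
      by (rule sum.group[OF _ _ sub]) (use finP in auto)
    from this[symmetric] show ?thesis by (simp only: card_eq_sum)
  qed
  have 2: "(\<Sum>f | f \<in> ?\<Omega> \<and> ?fix f. card {x \<in> {x \<in> ?P. ?fix (?f x)}. ?f x = f})
      = (\<Sum>f | f \<in> ?\<Omega> \<and> ?fix f. card (young_subgroup \<mu>))"
  proof (rule sum.cong[OF refl])
    fix f assume f: "f \<in> {f \<in> ?\<Omega>. ?fix f}"
    then have "{x \<in> {x \<in> ?P. ?fix (?f x)}. ?f x = f} = {x \<in> ?P. ?f x = f}" by blast
    then show "card {x \<in> {x \<in> ?P. ?fix (?f x)}. ?f x = f} = card (young_subgroup \<mu>)" using fibre f by simp
  qed
  show ?thesis unfolding set 1 2 by simp
qed

lemma induced_young_subgroup: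
  assumes \<mu>: "\<mu> \<in> partitions n" and N: "n \<le> N"
    and s: "\<And>g x. g permutes {1..n} \<Longrightarrow> x permutes {1..n} \<Longrightarrow> s (inv_into UNIV x \<circ> g \<circ> x) = s g"
  shows "induced (sym_group n) (young_subgroup \<mu>) s = twisted_perm_char s N n (part_vec \<mu>)"
proof
  fix g
  show "induced (sym_group n) (young_subgroup \<mu>) s g = twisted_perm_char s N n (part_vec \<mu>) g"
  proof (cases "g permutes {1..n}")
    case g: True
    have "finite (young_subgroup \<mu>)"
      by (rule finite_subset[OF _ finite_permutations[of "{1..n}"]]) (auto simp: young_subgroup_iff[OF \<mu>])
    moreover have "id \<in> young_subgroup \<mu>" by (simp add: young_subgroup_iff[OF \<mu>] permutes_id)
    ultimately have card: "card (young_subgroup \<mu>) \<noteq> 0" by auto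
    have "(\<Sum>x | x \<in> carrier (sym_group n) \<and> inv\<^bsub>sym_group n\<^esub> x \<otimes>\<^bsub>sym_group n\<^esub> g \<otimes>\<^bsub>sym_group n\<^esub> x \<in> young_subgroup \<mu>.
          s (inv\<^bsub>sym_group n\<^esub> x \<otimes>\<^bsub>sym_group n\<^esub> g \<otimes>\<^bsub>sym_group n\<^esub> x))
        = (\<Sum>x | x permutes {1..n} \<and> inv_into UNIV x \<circ> g \<circ> x \<in> young_subgroup \<mu>. s g)"
      by (intro sum.cong) (auto simp: sym_group_mult sym_inv s[OF g])
    also have "\<dots> = s g * (of_nat (card (young_subgroup \<mu>)) *
        of_nat (card {f \<in> colourings_of N n (part_vec \<mu>). \<forall>x\<in>{1..n}. f (g x) = f x}))"
      unfolding sum_constant card_conjugators[OF \<mu> N g] of_nat_mult by (simp only: mult.commute)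
    finally show ?thesis using g card by (simp add: induced_def twisted_perm_char_def)
  qed (simp add: induced_def twisted_perm_char_def)
qed

theorem sym_char_eq:
  assumes \<mu>: "\<mu> \<in> partitions n" and N: "n \<le> N"
  shows "sym_char \<mu> = part_char N n \<mu>"
proof -
  let ?G = "sym_group n"
  have sum: "sum_list \<mu> = n" using \<mu> by (simp add: partitions_def)
  have i1: "induced ?G (young_subgroup \<mu>) (\<lambda>_. 1) = perm_char N n (part_vec \<mu>)"
    by (rule induced_young_subgroup[OF \<mu> N]) simp
  have i2: "induced ?G (young_subgroup (conj_part \<mu>)) (\<lambda>g. of_int (sign g)) = sign_perm_char N n (part_vec (conj_part \<mu>))"
  proof (rule induced_young_subgroup[OF conj_part_in[OF \<mu>] N])
    fix g x :: "nat \<Rightarrow> nat" assume g: "g permutes {1..n}" and x: "x permutes {1..n}"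
    have "sign (inv_into UNIV x \<circ> g \<circ> x) = sign (inv_into UNIV x) * sign g * sign x"
      using g x by (simp add: sign_comp_sym[of _ n] permutes_compose permutes_inv)
    moreover have "sign (inv_into UNIV x) = sign x"
      using x permutation_permutes by (intro sign_inverse) blast
    moreover have "sign x * sign x = 1" by (simp add: sign_def)
    ultimately have "sign (inv_into UNIV x \<circ> g \<circ> x) = sign g" by (simp add: mult.commute mult.left_commute)
    then show "complex_of_int (sign (inv_into UNIV x \<circ> g \<circ> x)) = of_int (sign g)" by simp
  qed
  have "(\<chi> \<in> Irr ?G \<and> char_inner ?G (perm_char N n (part_vec \<mu>)) \<chi> \<noteq> 0 \<and>
      char_inner ?G (sign_perm_char N n (part_vec (conj_part \<mu>))) \<chi> \<noteq> 0) \<longleftrightarrow> \<chi> = part_char N n \<mu>" for \<chi>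
  proof (cases "\<chi> \<in> Irr ?G")
    case True
    then obtain \<nu> where "\<chi> = part_char N n \<nu>" unfolding Irr_sym_group[OF N] by blast
    then show ?thesis
      using common_constituent_characterization[OF \<mu> N, of \<chi>] by (simp add: char_inner_det_char)
  next
    case False
    then show ?thesis using part_char_Irr[OF \<mu> N] by blast
  qed
  then show ?thesis unfolding sym_char_def sum Let_def i1 i2 by simp
qed

section \<open>Elements of order prime to p\<close>

lemma funpow_fixed_iff:
  assumes g: "permutation g"
  shows "(g ^^ k) x = x \<longleftrightarrow> card (orbit g x) dvd k"
proof -
  let ?q = "funpow_dist1 g x x"
  note self = permutation_self_in_orbit[OF g, of x]
  have card: "card (orbit g x) = ?q"
    using orbit_conv_funpow_dist1[OF self] card_image[OF inj_on_funpow_dist1[OF self]] by simp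
  have "(g ^^ k) x = (g ^^ (k mod ?q)) x"
    using funpow_mod_eq[OF funpow_dist1_prop[OF self], of k] by simp
  moreover have "(g ^^ (k mod ?q)) x = x \<longleftrightarrow> k mod ?q = 0"
    using funpow_dist1_least[of "k mod ?q" g x x] by (cases "k mod ?q = 0") auto
  ultimately show ?thesis unfolding card dvd_eq_mod_eq_0 by simp
qed

text \<open>The order of \<open>g\<close> is divisible by the length of each cycle and divides the product of these lengths.\<close>

lemma coprime_ord_iff:
  assumes g: "g permutes {1..n}" and p: "prime p"
  shows "coprime (group.ord (sym_group n) g) p \<longleftrightarrow> (\<forall>x\<in>{1..n}. \<not> p dvd card (orbit g x))"
proof -
  interpret group "sym_group n" by (rule sym_group_is_group)
  have perm: "permutation g" using g permutation_permutes by blast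
  have pow: "g [^]\<^bsub>sym_group n\<^esub> k = g ^^ k" for k :: nat
    by (induction k) (auto simp: sym_group_one sym_group_mult funpow_Suc_right simp del: funpow.simps(2))
  have ord: "ord g dvd k \<longleftrightarrow> g ^^ k = id" for k
    using pow_eq_id[of g k] g by (simp add: pow sym_group_one)
  show ?thesis
  proof
    assume cop: "coprime (ord g) p"
    show "\<forall>x\<in>{1..n}. \<not> p dvd card (orbit g x)"
    proof (intro ballI notI)
      fix x assume "p dvd card (orbit g x)"
      moreover have "g ^^ ord g = id" using ord[of "ord g"] by simp
      then have "card (orbit g x) dvd ord g" using funpow_fixed_iff[OF perm, of "ord g" x] by simp
      ultimately have "p dvd ord g" by (rule dvd_trans)
      then show False using cop p by (metis coprime_common_divisor_nat dvd_refl prime_nat_iff less_irrefl prime_gt_1_nat)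
    qed
  next
    assume reg: "\<forall>x\<in>{1..n}. \<not> p dvd card (orbit g x)"
    let ?L = "\<Prod>x\<in>{1..n}. card (orbit g x)"
    have "(g ^^ ?L) x = x" for x
    proof (cases "x \<in> {1..n}")
      case True
      then have "card (orbit g x) dvd ?L" by (intro dvd_prodI) simp_all
      then show ?thesis using funpow_fixed_iff[OF perm] by blast
    next
      case False
      then have "g x = x" using permutes_not_in[OF g] by simp
      have "(g ^^ k) x = x" for k by (induction k) (simp_all add: \<open>g x = x\<close>)
      then show ?thesis .
    qed
    then have "g ^^ ?L = id" by auto
    then have "ord g dvd ?L" by (simp add: ord)
    moreover have "\<not> p dvd ?L" using reg p by (simp add: prime_dvd_prod_iff)
    ultimately have "\<not> p dvd ord g" using dvd_trans by blast
    then have "coprime p (ord g)" by (rule prime_imp_coprime[OF p])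
    then show "coprime (ord g) p" by (simp add: coprime_commute)
  qed
qed

section \<open>The basic set\<close>

lemma Psi_killed_by_power_sums:
  assumes g: "g permutes {1..n}" and reg: "\<forall>x\<in>{1..n}. \<not> p dvd card (orbit g x)" and N: "2 * n \<le> N" and p: "0 < p"
  shows "killed_by_power_sums N p n (Psi N {1..n} g)"
  unfolding killed_by_power_sums_def
proof (intro conjI allI impI)
  have oc: "orbit_closed g {1..n}" using orbit_closed_permutes[OF _ g] by simp
  show "alternating N (Psi N {1..n} g)" by (rule alternating_Psi[OF orbit_closed_image[OF oc]])
  fix k \<gamma> assume "1 \<le> k" "sum \<gamma> {..<N} + p * k = n + stair N"
  then show "up N (p * k) (Psi N {1..n} g) \<gamma> = 0"
    using reg N p by (intro up_Psi_eq_0[OF _ oc]) auto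
qed

text \<open>Pair the relation with the class function attached to a dual vector \<open>y\<close>.  That function is zero at
  each \<open>g\<close> with a cycle of length divisible by \<open>p\<close>, because \<open>y\<close> is killed by the power sums of such
  degrees, and the relation holds at all other \<open>g\<close>; so the pairing is zero, while orthogonality
  evaluates it to a nonzero multiple of \<open>a \<gamma>0\<close>.\<close>

lemma flat_chars_independent:
  assumes rel: "\<And>g. g permutes {1..n} \<Longrightarrow> \<forall>x\<in>{1..n}. \<not> p dvd card (orbit g x) \<Longrightarrow>
      (\<Sum>\<gamma>\<in>flat_vecs N p c n. a \<gamma> * Psi N {1..n} g \<gamma>) = 0"
    and N: "2 * n \<le> N" and p: "0 < p" and c: "c < p" and \<gamma>0: "\<gamma>0 \<in> flat_vecs N p c n"
  shows "a \<gamma>0 = 0"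
proof -
  let ?X = "{1..n}" and ?V = "vecs N (n + stair N)" and ?T = "flat_vecs N p c n" and ?P = "{g. g permutes {1..n}}"
  obtain y C where y: "killed_by_power_sums N p n y" and C: "C \<noteq> 0"
    and y\<gamma>: "\<And>\<gamma>. \<gamma> \<in> ?T \<Longrightarrow> y \<gamma> = (if \<gamma> = \<gamma>0 then C else 0)"
    using ex_killed_dual[OF N p c \<gamma>0] by blast
  have alt: "alternating N y" using y by (simp add: killed_by_power_sums_def)
  let ?F = "\<lambda>g. \<Sum>\<gamma>\<in>?T. a \<gamma> * Psi N ?X g \<gamma>" and ?Y = "\<lambda>g. \<Sum>\<beta>\<in>?V. y \<beta> * Psi N ?X g \<beta>"
  have finT: "finite ?T" by simp
  have "?F g * ?Y g = 0" if g: "g permutes ?X" for g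
  proof (cases "\<forall>x\<in>?X. \<not> p dvd card (orbit g x)")
    case True
    then show ?thesis using rel[OF g] by simp
  next
    case False
    then obtain x where x: "x \<in> ?X" "p dvd card (orbit g x)" by blast
    let ?l = "card (orbit g x)"
    obtain k where k: "?l = p * k" using x(2) by (auto elim: dvdE)
    have oc: "orbit_closed g ?X" using orbit_closed_permutes[OF _ g] by simp
    have sub: "orbit g x \<subseteq> ?X" using oc x by (auto simp: orbit_closed_def)
    have "x \<in> orbit g x" using oc permutation_self_in_orbit by (auto simp: orbit_closed_def)
    then have "?l > 0" using finite_subset[OF sub] card_gt_0_iff by blast
    moreover have "?l \<le> n" using card_mono[OF _ sub] by simp
    ultimately have k1: "1 \<le> k" and eq: "n + stair N = (n + stair N - ?l) + ?l" using k by (auto simp: Suc_le_eq)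
    have "(\<Sum>\<beta>\<in>vecs N ((n + stair N - ?l) + ?l). y \<beta> * Psi N ?X g \<beta>) = 0"
    proof (rule sum_Psi_orbit_eq_0[OF _ oc x(1)])
      fix \<gamma> assume "\<gamma> \<in> vecs N (n + stair N - ?l)"
      then have "sum \<gamma> {..<N} + p * k = n + stair N" using eq k by (simp add: weak_comps_def)
      then show "up N ?l y \<gamma> = 0" using y k1 by (simp add: killed_by_power_sums_def k)
    qed simp
    then show ?thesis using eq by simp
  qed
  then have "(\<Sum>g\<in>?P. ?F g * ?Y g) = 0" by (intro sum.neutral) blast
  then have "0 = (\<Sum>g\<in>?P. ?F g * ?Y g)" by (rule sym)
  also have "\<dots> = (\<Sum>g\<in>?P. \<Sum>\<gamma>\<in>?T. \<Sum>\<beta>\<in>?V. a \<gamma> * (y \<beta> * (Psi N ?X g \<beta> * Psi N ?X g \<gamma>)))"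
    unfolding sum_product by (intro sum.cong refl) (simp add: mult_ac)
  also have "\<dots> = (\<Sum>\<gamma>\<in>?T. \<Sum>\<beta>\<in>?V. \<Sum>g\<in>?P. a \<gamma> * (y \<beta> * (Psi N ?X g \<beta> * Psi N ?X g \<gamma>)))"
    by (subst sum.swap, rule sum.cong[OF refl], rule sum.swap)
  also have "\<dots> = (\<Sum>\<gamma>\<in>?T. a \<gamma> * (fact n * (fact N * y \<gamma>)))"
  proof (rule sum.cong[OF refl])
    fix \<gamma> assume \<gamma>: "\<gamma> \<in> ?T"
    have "(\<Sum>\<beta>\<in>?V. \<Sum>g\<in>?P. a \<gamma> * (y \<beta> * (Psi N ?X g \<beta> * Psi N ?X g \<gamma>)))
        = (\<Sum>\<beta>\<in>?V. a \<gamma> * (fact n * (alt_delta N \<gamma> \<beta> * y \<beta>)))"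
    proof (rule sum.cong[OF refl])
      fix \<beta> assume \<beta>: "\<beta> \<in> ?V"
      have "(\<Sum>g\<in>?P. Psi N ?X g \<beta> * Psi N ?X g \<gamma>) = fact n * alt_delta N \<gamma> \<beta>"
        using sum_Psi_Psi[of ?X \<beta> N \<gamma>] \<beta> \<gamma> by simp
      then show "(\<Sum>g\<in>?P. a \<gamma> * (y \<beta> * (Psi N ?X g \<beta> * Psi N ?X g \<gamma>))) = a \<gamma> * (fact n * (alt_delta N \<gamma> \<beta> * y \<beta>))"
        unfolding sum_distrib_left[symmetric] by (simp add: mult_ac)
    qed
    also have "\<dots> = a \<gamma> * (fact n * (\<Sum>\<beta>\<in>?V. alt_delta N \<gamma> \<beta> * y \<beta>))"
      unfolding sum_distrib_left[symmetric] ..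
    also have "(\<Sum>\<beta>\<in>?V. alt_delta N \<gamma> \<beta> * y \<beta>) = fact N * y \<gamma>"
      using \<gamma> by (intro sum_alt_delta[OF alt]) simp
    finally show "(\<Sum>\<beta>\<in>?V. \<Sum>g\<in>?P. a \<gamma> * (y \<beta> * (Psi N ?X g \<beta> * Psi N ?X g \<gamma>))) = a \<gamma> * (fact n * (fact N * y \<gamma>))" .
  qed
  also have "\<dots> = (\<Sum>\<gamma>\<in>?T. if \<gamma> = \<gamma>0 then a \<gamma>0 * (fact n * (fact N * C)) else 0)"
    by (intro sum.cong refl) (simp add: y\<gamma>)
  also have "\<dots> = a \<gamma>0 * (fact n * (fact N * C))"
    using finT \<gamma>0 by (simp only: sum.delta if_True)
  finally show ?thesis using C by simp
qed

text \<open>Every runner \<open>c\<close> gives a basic set: straightening shows that the restrictions span, and the dual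
  vectors show that they are independent.\<close>

theorem flat_chars_basic_set:
  assumes p: "prime p" and N: "2 * n \<le> N" and c: "c < p"
  shows "p_basic_set p (sym_group n) (det_char N n ` flat_vecs N p c n)"
proof -
  let ?G = "sym_group n" and ?T = "flat_vecs N p c n" and ?X = "{1..n}"
  let ?R = "p_reg_part p (sym_group n)" and ?h = "\<lambda>\<gamma>. p_reg_part p (sym_group n) (det_char N n \<gamma>)"
  have p0: "0 < p" using p by (simp add: prime_gt_0_nat)
  have nN: "n \<le> N" using N by simp
  have finT: "finite ?T" by simp
  have reg: "?h \<gamma> g = (if g permutes ?X \<and> (\<forall>x\<in>?X. \<not> p dvd card (orbit g x)) then Psi N ?X g \<gamma> else 0)" for \<gamma> g
    by (auto simp: p_reg_part_def det_char_def coprime_ord_iff[OF _ p])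
  have indep: "\<forall>\<gamma>\<in>?T. a \<gamma> = 0" if "(\<Sum>\<gamma>\<in>?T. int_scale (a \<gamma>) (?h \<gamma>)) = 0" for a
  proof
    fix \<gamma> assume \<gamma>: "\<gamma> \<in> ?T"
    have "complex_of_int (a \<gamma>) = 0"
    proof (rule flat_chars_independent[OF _ N p0 c \<gamma>])
      fix g assume g: "g permutes ?X" "\<forall>x\<in>?X. \<not> p dvd card (orbit g x)"
      have "(\<Sum>\<gamma>\<in>?T. int_scale (a \<gamma>) (?h \<gamma>)) g = 0" unfolding that by simp
      then show "(\<Sum>\<gamma>\<in>?T. of_int (a \<gamma>) * Psi N ?X g \<gamma>) = 0"
        using g by (simp add: sum_fun_apply int_scale_def reg)
    qed
    then show "a \<gamma> = 0" by simp
  qed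
  have inj: "inj_on ?h ?T"
  proof (rule inj_onI, rule ccontr)
    fix \<gamma> \<gamma>' assume \<gamma>: "\<gamma> \<in> ?T" and \<gamma>': "\<gamma>' \<in> ?T" and eq: "?h \<gamma> = ?h \<gamma>'" and ne: "\<gamma> \<noteq> \<gamma>'"
    define a :: "(nat \<Rightarrow> nat) \<Rightarrow> int" where "a \<delta> = (if \<delta> = \<gamma> then 1 else if \<delta> = \<gamma>' then -1 else 0)" for \<delta>
    have "(\<Sum>\<delta>\<in>?T. int_scale (a \<delta>) (?h \<delta>)) = (\<Sum>\<delta>\<in>{\<gamma>, \<gamma>'}. int_scale (a \<delta>) (?h \<delta>))"
      using \<gamma> \<gamma>' finT by (intro sum.mono_neutral_right) (auto simp: a_def int_scale_def fun_eq_iff)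
    also have "\<dots> = int_scale (a \<gamma>) (?h \<gamma>) + int_scale (a \<gamma>') (?h \<gamma>')" using ne by simp
    also have "\<dots> = 0" unfolding eq using ne by (auto simp: a_def int_scale_def fun_eq_iff)
    finally show False using indep[of a] \<gamma> by (auto simp: a_def)
  qed
  have image: "?R ` (det_char N n ` ?T) = ?h ` ?T" by (simp add: image_image)
  have "det_char N n ` ?T \<subseteq> Irr ?G"
  proof (rule image_subsetI)
    fix \<gamma> assume "\<gamma> \<in> ?T"
    then obtain \<mu> where "\<mu> \<in> partitions n" "\<gamma> = beta_vec N \<mu>" using beta_vec_surj[of \<gamma> N n] by blast
    then show "det_char N n \<gamma> \<in> Irr ?G" using part_char_Irr[OF _ nN] by blast
  qed
  moreover have "inj_on ?R (det_char N n ` ?T)"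
    using inj by (intro inj_on_imageI) (simp add: comp_def)
  moreover have "int_fun.independent (?R ` (det_char N n ` ?T))"
    unfolding image int_fun.dependent_explicit
  proof (rule notI, elim exE conjE bexE)
    fix t u v assume t: "finite t" "t \<subseteq> ?h ` ?T" and sum: "(\<Sum>v\<in>t. int_scale (u v) v) = 0" and v: "v \<in> t" "u v \<noteq> 0"
    define a where "a \<gamma> = (if ?h \<gamma> \<in> t then u (?h \<gamma>) else 0)" for \<gamma>
    have "(\<Sum>\<gamma>\<in>?T. int_scale (a \<gamma>) (?h \<gamma>)) = (\<Sum>v\<in>?h ` ?T. int_scale (if v \<in> t then u v else 0) v)"
      using inj by (simp add: sum.reindex a_def)
    also have "\<dots> = (\<Sum>v\<in>t. int_scale (if v \<in> t then u v else 0) v)"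
    proof (rule sum.mono_neutral_right)
      show "finite (?h ` ?T)" using finT by (rule finite_imageI)
      show "t \<subseteq> ?h ` ?T" by (rule t(2))
      show "\<forall>v\<in>?h ` ?T - t. int_scale (if v \<in> t then u v else 0) v = 0"
        by (simp add: int_scale_def fun_eq_iff del: image_iff)
    qed
    also have "\<dots> = (\<Sum>v\<in>t. int_scale (u v) v)" by (rule sum.cong[OF refl]) simp
    finally have "(\<Sum>\<gamma>\<in>?T. int_scale (a \<gamma>) (?h \<gamma>)) = 0" unfolding sum .
    then have "\<forall>\<gamma>\<in>?T. a \<gamma> = 0" by (rule indep)
    moreover obtain \<gamma> where "\<gamma> \<in> ?T" "v = ?h \<gamma>" using v t by blast
    ultimately show False using v by (auto simp: a_def)
  qed
  moreover have "int_fun.span (?R ` (det_char N n ` ?T)) = int_fun.span (?R ` Irr ?G)"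
  proof (rule antisym)
    show "int_fun.span (?R ` (det_char N n ` ?T)) \<subseteq> int_fun.span (?R ` Irr ?G)"
      using \<open>det_char N n ` ?T \<subseteq> Irr ?G\<close> by (intro int_fun.span_mono image_mono)
    show "int_fun.span (?R ` Irr ?G) \<subseteq> int_fun.span (?R ` (det_char N n ` ?T))"
    proof (rule int_fun.span_minimal[OF image_subsetI int_fun.subspace_span])
      fix \<chi> assume "\<chi> \<in> Irr ?G"
      then obtain \<mu> where \<mu>: "\<mu> \<in> partitions n" "\<chi> = part_char N n \<mu>" unfolding Irr_sym_group[OF nN] by blast
      obtain d :: "(nat \<Rightarrow> nat) \<Rightarrow> int" where d: "\<And>y. killed_by_power_sums N p n y \<Longrightarrow>
          y (beta_vec N \<mu>) = (\<Sum>\<gamma>\<in>?T. of_int (d \<gamma>) * y \<gamma>)"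
        using flat_combination_eval[OF p0 beta_vec_in[OF \<mu>(1) nN], of c] unfolding flat_combination_def by blast
      have "?R \<chi> = (\<Sum>\<gamma>\<in>?T. int_scale (d \<gamma>) (?h \<gamma>))"
      proof
        fix g
        show "?R \<chi> g = (\<Sum>\<gamma>\<in>?T. int_scale (d \<gamma>) (?h \<gamma>)) g"
        proof (cases "g permutes ?X \<and> (\<forall>x\<in>?X. \<not> p dvd card (orbit g x))")
          case True
          then show ?thesis
            using d[OF Psi_killed_by_power_sums[OF _ _ N p0, of g]] by (simp add: \<mu>(2) reg sum_fun_apply int_scale_def)
        next
          case False
          then show ?thesis unfolding \<mu>(2) sum_fun_apply int_scale_def reg if_not_P[OF False] by simp
        qed
      qed
      also have "\<dots> \<in> int_fun.span (?R ` (det_char N n ` ?T))"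
        by (intro int_fun.span_sum int_fun.span_scale int_fun.span_base) blast
      finally show "?R \<chi> \<in> int_fun.span (?R ` (det_char N n ` ?T))" .
    qed
  qed
  ultimately show ?thesis unfolding p_basic_set_def by blast
qed

text \<open>The number \<open>p (2 n)\<close> of beads is divisible by \<open>p\<close>, so that the runners of the two abaci agree, and it
  leaves enough room for the Heisenberg relation.  Runner \<open>j\<close> of the abacus consists of the positions
  congruent to \<open>j - 1\<close>.\<close>

lemma B_empty_eq:
  assumes p: "0 < p" "odd p"
  shows "B_empty p n = det_char (p * (2 * n)) n ` flat_vecs (p * (2 * n)) p ((p + 1) div 2 - 1) n"
proof -
  let ?N = "p * (2 * n)" and ?j = "(p + 1) div 2"
  have N: "n \<le> ?N" using p by (cases p) auto
  have j: "1 \<le> ?j" "?j \<le> p" using p by (auto elim!: oddE)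
  have mem: "beta_vec ?N \<mu> \<in> flat_vecs ?N p (?j - 1) n \<longleftrightarrow> \<mu> \<in> Lambda_empty p n" if \<mu>: "\<mu> \<in> partitions n" for \<mu>
    using p_quotient_empty_iff_flat[OF \<mu> p(1) j N refl] beta_vec_in[OF \<mu> N] strict_dec_beta_vec[OF \<mu>] \<mu>
    by (simp add: Lambda_empty_def)
  have "beta_vec ?N ` Lambda_empty p n = flat_vecs ?N p (?j - 1) n"
  proof (intro equalityI subsetI)
    fix \<gamma> assume "\<gamma> \<in> beta_vec ?N ` Lambda_empty p n"
    then obtain \<mu> where "\<mu> \<in> Lambda_empty p n" "\<gamma> = beta_vec ?N \<mu>" by blast
    then show "\<gamma> \<in> flat_vecs ?N p (?j - 1) n" using mem[of \<mu>] by (simp add: Lambda_empty_def)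
  next
    fix \<gamma> assume \<gamma>: "\<gamma> \<in> flat_vecs ?N p (?j - 1) n"
    then obtain \<mu> where "\<mu> \<in> partitions n" "\<gamma> = beta_vec ?N \<mu>" using beta_vec_surj[of \<gamma> ?N n] by blast
    then show "\<gamma> \<in> beta_vec ?N ` Lambda_empty p n" using mem[of \<mu>] \<gamma> by blast
  qed
  note flat = this
  have "B_empty p n = sym_char ` Lambda_empty p n" by (auto simp: B_empty_def)
  also have "sym_char ` Lambda_empty p n = part_char ?N n ` Lambda_empty p n"
    by (rule image_cong[OF refl], rule sym_char_eq[OF _ N]) (simp add: Lambda_empty_def)
  finally show ?thesis unfolding flat[symmetric] image_image .
qed

lemma sym_char_in_B_empty_iff:
  assumes \<mu>: "\<mu> \<in> partitions n"
  shows "sym_char \<mu> \<in> B_empty p n \<longleftrightarrow> p_quotient p \<mu> ((p + 1) div 2) = []"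
proof
  assume "sym_char \<mu> \<in> B_empty p n"
  then obtain \<nu> where \<nu>: "\<nu> \<in> Lambda_empty p n" "sym_char \<mu> = sym_char \<nu>" by (auto simp: B_empty_def)
  then have \<nu>n: "\<nu> \<in> partitions n" by (simp add: Lambda_empty_def)
  have "part_char n n \<mu> = part_char n n \<nu>"
    using \<nu>(2) sym_char_eq[OF \<mu> order_refl] sym_char_eq[OF \<nu>n order_refl] by simp
  then have "\<mu> = \<nu>"
    using bilin_part_char[OF \<mu> \<nu>n order_refl] bilin_part_char[OF \<nu>n \<nu>n order_refl] by (auto split: if_splits)
  then show "p_quotient p \<mu> ((p + 1) div 2) = []" using \<nu>(1) by (simp add: Lambda_empty_def)
qed (use \<mu> in \<open>auto simp: B_empty_def Lambda_empty_def\<close>)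

theorem theorem1p1:
  fixes p n :: nat
  assumes "prime p" and "odd p"
  shows "p_basic_set p (sym_group n) (B_empty p n) \<and>
    (\<forall>\<mu>\<in>partitions n. sym_char \<mu> \<in> B_empty p n \<longrightarrow> sym_char (conj_part \<mu>) \<in> B_empty p n) \<and>
    (\<forall>\<mu>\<in>partitions n. \<mu> = conj_part \<mu> \<longrightarrow>
       (sym_char \<mu> \<in> B_empty p n \<longleftrightarrow> p_regular_partition p (diag_hooks \<mu>)))"
proof (intro conjI ballI impI)
  have p: "0 < p" using assms(1) by (simp add: prime_gt_0_nat)
  have "(p + 1) div 2 - 1 < p" using p by simp
  moreover have "2 * n \<le> p * (2 * n)" using p by (cases p) auto
  ultimately show "p_basic_set p (sym_group n) (B_empty p n)"
    unfolding B_empty_eq[OF p assms(2)] by (intro flat_chars_basic_set[OF assms(1)])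
next
  fix \<mu> assume \<mu>: "\<mu> \<in> partitions n" and "sym_char \<mu> \<in> B_empty p n"
  then show "sym_char (conj_part \<mu>) \<in> B_empty p n"
    unfolding sym_char_in_B_empty_iff[OF \<mu>] sym_char_in_B_empty_iff[OF conj_part_in[OF \<mu>]]
    using p_quotient_conj_empty[OF \<mu> assms(2)] by blast
next
  fix \<mu> assume \<mu>: "\<mu> \<in> partitions n" and "\<mu> = conj_part \<mu>"
  then show "sym_char \<mu> \<in> B_empty p n \<longleftrightarrow> p_regular_partition p (diag_hooks \<mu>)"
    unfolding sym_char_in_B_empty_iff[OF \<mu>] using self_conjugate_empty_iff[OF \<mu> assms(2)] by blast
qed

end
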